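(* Assume propositional resizing. Then for all universes $\mathcal{U},\mathcal{V}$, the universe $\mathcal{U}$ is a retract of the larger universe $\mathcal{U}\sqcup\mathcal{V}$, with a section $\mathcal{U}\to\mathcal{U}\sqcup\mathcal{V}$ that is an embedding.
   Context: Foundation: intensional Martin-Löf type theory with $\mathbb{0},\mathbb{1},\mathbb{N},+,\Pi,\Sigma,\mathrm{Id}$ and universes $\mathcal{U},\mathcal{V},\mathcal{W},\mathcal{T}$ (not assumed cumulative), with successor $\mathcal{U}^+$ and least upper bound $\mathcal{U}\sqcup\mathcal{V}$; if $X:\mathcal{U}$ and $Y:\mathcal{V}$ then $X+Y:\mathcal{U}\sqcup\mathcal{V}$, and if $A:X\to\mathcal{V}$ then $\Pi A,\Sigma A:\mathcal{U}\sqcup\mathcal{V}$. Each universe has its own copies of $\mathbb{0}$ and $\mathbb{1}$. Univalence (hence function and propositional extensionality) and existence of propositional truncations are assumed. Excluded middle is neither assumed nor rejected. A proposition (subsingleton) is a type any two of whose elements are equal. A map $j:X\to Y$ is an embedding if each fiber $j^{-1}(y):=\Sigma(x:X),\,j\,x=y$ is a subsingleton. "$A$ is a retract of $B$" means there are designated maps $s:A\to B$ (the section) and $r:B\to A$ (the retraction) with $r\circ s\sim\mathrm{id}$ pointwise. Propositional resizing: for any two universes $\mathcal{U},\mathcal{V}$, every proposition in $\mathcal{U}$ has an equivalent copy in $\mathcal{V}$. *)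

theory Defs
  imports Main
begin

text \<open>
  Intensional Martin-Loef type theory is embedded deeply: raw terms, contexts, and mutually
  inductive judgements for well-formed contexts, typing and judgemental equality.
  A statement of type theory is rendered as the existence of a closed term of the
  corresponding type.
\<close>

section \<open>Universe levels\<close>

text \<open>
  The universes are indexed by an arbitrary join-semilattice of levels, not only by the natural
  numbers. The level \<open>bot\<close> is only used to host the type of natural numbers.
\<close>

class universe_level = bounded_semilattice_sup_bot +
  fixes lsuc :: "'a \<Rightarrow> 'a"
  assumes less_lsuc: "u < lsuc u"

instantiation nat :: universe_level
begin
definition lsuc_nat :: "nat \<Rightarrow> nat" where "lsuc_nat = Suc"
instance by standard (simp_all add: lsuc_nat_def bot_nat_def)
end


section \<open>Raw terms\<close>

datatype 'l postulate =
    Univalence 'l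
  | Trunc 'l
  | TruncIntro 'l
  | TruncProp 'l
  | TruncRec 'l 'l
  | Resizing 'l 'l

text \<open>
  Terms use de Bruijn indices. The arguments that live under binders are: the second arguments of
  \<open>Pi\<close>, \<open>Lam\<close>, \<open>Sg\<close> (one variable); all motives, given as first argument of the eliminators
  (one variable, but three for \<open>IdElim\<close>: two points and an identification between them, the
  latter being \<open>Var 0\<close>); the branches of \<open>SgElim\<close> (two variables), \<open>SumElim\<close> (one each) and
  \<open>IdElim\<close> (one), and the successor branch of \<open>NatElim\<close> (two, the induction hypothesis being
  \<open>Var 0\<close>).
\<close>

datatype 'l tm =
    Var nat
  | Post "'l postulate"
  | Univ 'l
  | Pi "'l tm" "'l tm"
  | Lam "'l tm" "'l tm"
  | App "'l tm" "'l tm"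
  | Sg "'l tm" "'l tm"
  | MkPair "'l tm" "'l tm"
  | SgElim "'l tm" "'l tm" "'l tm"
  | Sum "'l tm" "'l tm"
  | InL "'l tm"
  | InR "'l tm"
  | SumElim "'l tm" "'l tm" "'l tm" "'l tm"
  | Empty 'l
  | EmptyElim "'l tm" "'l tm"
  | Unit 'l
  | Star 'l
  | UnitElim "'l tm" "'l tm" "'l tm"
  | NatT
  | ZeroT
  | SucT "'l tm"
  | NatElim "'l tm" "'l tm" "'l tm" "'l tm"
  | Id "'l tm" "'l tm" "'l tm"
  | Refl "'l tm"
  | IdElim "'l tm" "'l tm" "'l tm" "'l tm" "'l tm"

definition up_ren :: "(nat \<Rightarrow> nat) \<Rightarrow> nat \<Rightarrow> nat" where
  "up_ren r = case_nat 0 (\<lambda>n. Suc (r n))"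

primrec rename :: "(nat \<Rightarrow> nat) \<Rightarrow> 'l tm \<Rightarrow> 'l tm" where
  "rename r (Var n) = Var (r n)"
| "rename r (Post c) = Post c"
| "rename r (Univ u) = Univ u"
| "rename r (Pi A B) = Pi (rename r A) (rename (up_ren r) B)"
| "rename r (Lam A b) = Lam (rename r A) (rename (up_ren r) b)"
| "rename r (App f a) = App (rename r f) (rename r a)"
| "rename r (Sg A B) = Sg (rename r A) (rename (up_ren r) B)"
| "rename r (MkPair a b) = MkPair (rename r a) (rename r b)"
| "rename r (SgElim C g p) =
     SgElim (rename (up_ren r) C) (rename (up_ren (up_ren r)) g) (rename r p)"
| "rename r (Sum A B) = Sum (rename r A) (rename r B)"
| "rename r (InL a) = InL (rename r a)"
| "rename r (InR b) = InR (rename r b)"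
| "rename r (SumElim C f g s) =
     SumElim (rename (up_ren r) C) (rename (up_ren r) f) (rename (up_ren r) g) (rename r s)"
| "rename r (Empty u) = Empty u"
| "rename r (EmptyElim C e) = EmptyElim (rename (up_ren r) C) (rename r e)"
| "rename r (Unit u) = Unit u"
| "rename r (Star u) = Star u"
| "rename r (UnitElim C c t) = UnitElim (rename (up_ren r) C) (rename r c) (rename r t)"
| "rename r NatT = NatT"
| "rename r ZeroT = ZeroT"
| "rename r (SucT n) = SucT (rename r n)"
| "rename r (NatElim C z s n) =
     NatElim (rename (up_ren r) C) (rename r z) (rename (up_ren (up_ren r)) s) (rename r n)"
| "rename r (Id A a b) = Id (rename r A) (rename r a) (rename r b)"
| "rename r (Refl a) = Refl (rename r a)"
| "rename r (IdElim C c a b p) =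
     IdElim (rename (up_ren (up_ren (up_ren r))) C) (rename (up_ren r) c)
       (rename r a) (rename r b) (rename r p)"

definition shift :: "nat \<Rightarrow> 'l tm \<Rightarrow> 'l tm" where
  "shift k = rename (\<lambda>n. n + k)"

definition up :: "(nat \<Rightarrow> 'l tm) \<Rightarrow> nat \<Rightarrow> 'l tm" where
  "up \<sigma> = case_nat (Var 0) (\<lambda>n. shift 1 (\<sigma> n))"

primrec subst :: "(nat \<Rightarrow> 'l tm) \<Rightarrow> 'l tm \<Rightarrow> 'l tm" where
  "subst \<sigma> (Var n) = \<sigma> n"
| "subst \<sigma> (Post c) = Post c"
| "subst \<sigma> (Univ u) = Univ u"
| "subst \<sigma> (Pi A B) = Pi (subst \<sigma> A) (subst (up \<sigma>) B)"
| "subst \<sigma> (Lam A b) = Lam (subst \<sigma> A) (subst (up \<sigma>) b)"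
| "subst \<sigma> (App f a) = App (subst \<sigma> f) (subst \<sigma> a)"
| "subst \<sigma> (Sg A B) = Sg (subst \<sigma> A) (subst (up \<sigma>) B)"
| "subst \<sigma> (MkPair a b) = MkPair (subst \<sigma> a) (subst \<sigma> b)"
| "subst \<sigma> (SgElim C g p) = SgElim (subst (up \<sigma>) C) (subst (up (up \<sigma>)) g) (subst \<sigma> p)"
| "subst \<sigma> (Sum A B) = Sum (subst \<sigma> A) (subst \<sigma> B)"
| "subst \<sigma> (InL a) = InL (subst \<sigma> a)"
| "subst \<sigma> (InR b) = InR (subst \<sigma> b)"
| "subst \<sigma> (SumElim C f g s) =
     SumElim (subst (up \<sigma>) C) (subst (up \<sigma>) f) (subst (up \<sigma>) g) (subst \<sigma> s)"
| "subst \<sigma> (Empty u) = Empty u"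
| "subst \<sigma> (EmptyElim C e) = EmptyElim (subst (up \<sigma>) C) (subst \<sigma> e)"
| "subst \<sigma> (Unit u) = Unit u"
| "subst \<sigma> (Star u) = Star u"
| "subst \<sigma> (UnitElim C c t) = UnitElim (subst (up \<sigma>) C) (subst \<sigma> c) (subst \<sigma> t)"
| "subst \<sigma> NatT = NatT"
| "subst \<sigma> ZeroT = ZeroT"
| "subst \<sigma> (SucT n) = SucT (subst \<sigma> n)"
| "subst \<sigma> (NatElim C z s n) =
     NatElim (subst (up \<sigma>) C) (subst \<sigma> z) (subst (up (up \<sigma>)) s) (subst \<sigma> n)"
| "subst \<sigma> (Id A a b) = Id (subst \<sigma> A) (subst \<sigma> a) (subst \<sigma> b)"
| "subst \<sigma> (Refl a) = Refl (subst \<sigma> a)"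
| "subst \<sigma> (IdElim C c a b p) =
     IdElim (subst (up (up (up \<sigma>))) C) (subst (up \<sigma>) c) (subst \<sigma> a) (subst \<sigma> b) (subst \<sigma> p)"

text \<open>
  \<open>inst k ts t\<close> replaces the variables \<open>0, \<dots>, length ts - 1\<close> of \<open>t\<close> by the terms \<open>ts\<close>, which live
  in an extension of the remaining context by \<open>k\<close> variables.
\<close>

definition inst :: "nat \<Rightarrow> 'l tm list \<Rightarrow> 'l tm \<Rightarrow> 'l tm" where
  "inst k ts = subst (\<lambda>n. if n < length ts then ts ! n else Var (n - length ts + k))"


section \<open>Types expressing the notions of univalent mathematics\<close>

definition arrow :: "'l tm \<Rightarrow> 'l tm \<Rightarrow> 'l tm" where
  "arrow A B = Pi A (shift 1 B)"

definition product :: "'l tm \<Rightarrow> 'l tm \<Rightarrow> 'l tm" where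
  "product A B = Sg A (shift 1 B)"

definition is_prop :: "'l tm \<Rightarrow> 'l tm" where
  "is_prop A = Pi A (Pi (shift 1 A) (Id (shift 2 A) (Var 1) (Var 0)))"

definition fiber :: "'l tm \<Rightarrow> 'l tm \<Rightarrow> 'l tm \<Rightarrow> 'l tm \<Rightarrow> 'l tm" where
  "fiber A B f y = Sg A (Id (shift 1 B) (App (shift 1 f) (Var 0)) (shift 1 y))"

definition is_embedding :: "'l tm \<Rightarrow> 'l tm \<Rightarrow> 'l tm \<Rightarrow> 'l tm" where
  "is_embedding A B f = Pi B (is_prop (fiber (shift 1 A) (shift 1 B) (shift 1 f) (Var 0)))"

text \<open>\<open>inverse_law A r s\<close> is the type \<open>\<Pi>(a : A). r (s a) = a\<close>.\<close>

definition inverse_law :: "'l tm \<Rightarrow> 'l tm \<Rightarrow> 'l tm \<Rightarrow> 'l tm" where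
  "inverse_law A r s = Pi A (Id (shift 1 A) (App (shift 1 r) (App (shift 1 s) (Var 0))) (Var 0))"

text \<open>
  The type of tuples consisting of maps \<open>s : A \<rightarrow> B\<close> and \<open>r : B \<rightarrow> A\<close>, a pointwise identification of
  \<open>r \<circ> s\<close> with the identity, and a proof that \<open>s\<close> is an embedding; \<open>Var 1\<close> is \<open>s\<close>, \<open>Var 0\<close> is \<open>r\<close>.
\<close>

definition retract_with_embedding :: "'l tm \<Rightarrow> 'l tm \<Rightarrow> 'l tm" where
  "retract_with_embedding A B =
     Sg (arrow A B) (Sg (arrow (shift 1 B) (shift 1 A))
       (product (inverse_law (shift 2 A) (Var 0) (Var 1))
                (is_embedding (shift 2 A) (shift 2 B) (Var 1))))"

definition is_equiv :: "'l tm \<Rightarrow> 'l tm \<Rightarrow> 'l tm \<Rightarrow> 'l tm" where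
  "is_equiv A B f =
     product (Sg (arrow B A) (inverse_law (shift 1 B) (shift 1 f) (Var 0)))
             (Sg (arrow B A) (inverse_law (shift 1 A) (Var 0) (shift 1 f)))"

definition equiv :: "'l tm \<Rightarrow> 'l tm \<Rightarrow> 'l tm" where
  "equiv A B = Sg (arrow A B) (is_equiv (shift 1 A) (shift 1 B) (Var 0))"

definition id_map :: "'l tm \<Rightarrow> 'l tm" where
  "id_map A = Lam A (Var 0)"

definition id_equiv :: "'l tm \<Rightarrow> 'l tm" where
  "id_equiv A =
     MkPair (id_map A)
       (MkPair (MkPair (id_map A) (Lam A (Refl (Var 0))))
               (MkPair (id_map A) (Lam A (Refl (Var 0)))))"

text \<open>The canonical map from \<open>X = Y\<close> to \<open>X \<simeq> Y\<close>, applied to \<open>p\<close>.\<close>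

definition id_to_equiv :: "'l tm \<Rightarrow> 'l tm \<Rightarrow> 'l tm \<Rightarrow> 'l tm" where
  "id_to_equiv X Y p = IdElim (equiv (Var 2) (Var 1)) (id_equiv (Var 0)) X Y p"

definition univalence :: "'l \<Rightarrow> 'l tm" where
  "univalence u =
     Pi (Univ u) (Pi (Univ u)
       (is_equiv (Id (Univ u) (Var 1) (Var 0)) (equiv (Var 1) (Var 0))
          (Lam (Id (Univ u) (Var 1) (Var 0)) (id_to_equiv (Var 2) (Var 1) (Var 0)))))"

definition prop_resizing :: "'l \<Rightarrow> 'l \<Rightarrow> 'l tm" where
  "prop_resizing u v =
     Pi (Univ u) (arrow (is_prop (Var 0)) (Sg (Univ v) (equiv (Var 1) (Var 0))))"

definition trunc :: "'l \<Rightarrow> 'l tm \<Rightarrow> 'l tm" where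
  "trunc u X = App (Post (Trunc u)) X"

text \<open>
  Propositional truncation is a proposition with the usual
  non-dependent recursion into propositions of any universe; its computation rule holds up to
  identity, as the target is a proposition.
\<close>

fun post_type :: "'l postulate \<Rightarrow> 'l tm" where
  "post_type (Univalence u) = univalence u"
| "post_type (Trunc u) = arrow (Univ u) (Univ u)"
| "post_type (TruncIntro u) = Pi (Univ u) (arrow (Var 0) (trunc u (Var 0)))"
| "post_type (TruncProp u) = Pi (Univ u) (is_prop (trunc u (Var 0)))"
| "post_type (TruncRec u v) =
     Pi (Univ u) (Pi (Univ v)
       (arrow (is_prop (Var 0)) (arrow (arrow (Var 1) (Var 0)) (arrow (trunc u (Var 1)) (Var 0)))))"
| "post_type (Resizing u v) = prop_resizing u v"

definition foundation :: "'l postulate set" where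
  "foundation =
     range Univalence \<union> range Trunc \<union> range TruncIntro \<union> range TruncProp \<union> {TruncRec u v | u v. True}"

definition propositional_resizing :: "'l postulate set" where
  "propositional_resizing = {Resizing u v | u v. True}"


section \<open>Judgements\<close>

text \<open>
  The parameter \<open>S\<close> is the set of postulates in force. Contexts are lists with the most recent
  variable first. Universes are \<open>a la\<close> Russell, without cumulativity; \<open>A\<close> is a type in context
  \<open>\<Gamma>\<close> if it is an element of some \<open>Univ u\<close>.
\<close>

inductive
  wf_ctx :: "'l::universe_level postulate set \<Rightarrow> 'l tm list \<Rightarrow> bool" and
  has_type :: "'l postulate set \<Rightarrow> 'l tm list \<Rightarrow> 'l tm \<Rightarrow> 'l tm \<Rightarrow> bool"
    ("(2_ \<parallel> _ \<turnstile>/ _ : _)" [51, 51, 51, 51] 50) and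
  jeq :: "'l postulate set \<Rightarrow> 'l tm list \<Rightarrow> 'l tm \<Rightarrow> 'l tm \<Rightarrow> 'l tm \<Rightarrow> bool"
    ("(2_ \<parallel> _ \<turnstile>/ _ \<equiv> _ : _)" [51, 51, 51, 51, 51] 50)
  for S :: "'l postulate set"
where
  ctx_nil: "wf_ctx S []"
| ctx_cons: "S \<parallel> \<Gamma> \<turnstile> A : Univ u \<Longrightarrow> wf_ctx S (A # \<Gamma>)"
| var: "wf_ctx S \<Gamma> \<Longrightarrow> n < length \<Gamma> \<Longrightarrow> S \<parallel> \<Gamma> \<turnstile> Var n : shift (Suc n) (\<Gamma> ! n)"
| post: "wf_ctx S \<Gamma> \<Longrightarrow> c \<in> S \<Longrightarrow> S \<parallel> \<Gamma> \<turnstile> Post c : post_type c"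
| conv: "S \<parallel> \<Gamma> \<turnstile> a : A \<Longrightarrow> S \<parallel> \<Gamma> \<turnstile> A \<equiv> B : Univ u \<Longrightarrow> S \<parallel> \<Gamma> \<turnstile> a : B"
| jeq_conv: "S \<parallel> \<Gamma> \<turnstile> a \<equiv> b : A \<Longrightarrow> S \<parallel> \<Gamma> \<turnstile> A \<equiv> B : Univ u \<Longrightarrow> S \<parallel> \<Gamma> \<turnstile> a \<equiv> b : B"
| jeq_refl: "S \<parallel> \<Gamma> \<turnstile> a : A \<Longrightarrow> S \<parallel> \<Gamma> \<turnstile> a \<equiv> a : A"
| jeq_sym: "S \<parallel> \<Gamma> \<turnstile> a \<equiv> b : A \<Longrightarrow> S \<parallel> \<Gamma> \<turnstile> b \<equiv> a : A"
| jeq_trans: "S \<parallel> \<Gamma> \<turnstile> a \<equiv> b : A \<Longrightarrow> S \<parallel> \<Gamma> \<turnstile> b \<equiv> c : A \<Longrightarrow> S \<parallel> \<Gamma> \<turnstile> a \<equiv> c : A"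
| univ: "wf_ctx S \<Gamma> \<Longrightarrow> S \<parallel> \<Gamma> \<turnstile> Univ u : Univ (lsuc u)"
| pi_form: "S \<parallel> \<Gamma> \<turnstile> A : Univ u \<Longrightarrow> S \<parallel> A # \<Gamma> \<turnstile> B : Univ v \<Longrightarrow>
    S \<parallel> \<Gamma> \<turnstile> Pi A B : Univ (sup u v)"
| pi_cong: "S \<parallel> \<Gamma> \<turnstile> A \<equiv> A' : Univ u \<Longrightarrow> S \<parallel> \<Gamma> \<turnstile> A : Univ u \<Longrightarrow>
    S \<parallel> A # \<Gamma> \<turnstile> B \<equiv> B' : Univ v \<Longrightarrow> S \<parallel> \<Gamma> \<turnstile> Pi A B \<equiv> Pi A' B' : Univ (sup u v)"
| lam: "S \<parallel> \<Gamma> \<turnstile> A : Univ u \<Longrightarrow> S \<parallel> A # \<Gamma> \<turnstile> b : B \<Longrightarrow>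
    S \<parallel> \<Gamma> \<turnstile> Lam A b : Pi A B"
| lam_cong: "S \<parallel> \<Gamma> \<turnstile> A \<equiv> A' : Univ u \<Longrightarrow> S \<parallel> \<Gamma> \<turnstile> A : Univ u \<Longrightarrow>
    S \<parallel> A # \<Gamma> \<turnstile> b \<equiv> b' : B \<Longrightarrow> S \<parallel> \<Gamma> \<turnstile> Lam A b \<equiv> Lam A' b' : Pi A B"
| app: "S \<parallel> \<Gamma> \<turnstile> f : Pi A B \<Longrightarrow> S \<parallel> \<Gamma> \<turnstile> a : A \<Longrightarrow>
    S \<parallel> \<Gamma> \<turnstile> App f a : inst 0 [a] B"
| app_cong: "S \<parallel> \<Gamma> \<turnstile> f \<equiv> f' : Pi A B \<Longrightarrow> S \<parallel> \<Gamma> \<turnstile> a \<equiv> a' : A \<Longrightarrow>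
    S \<parallel> \<Gamma> \<turnstile> App f a \<equiv> App f' a' : inst 0 [a] B"
| pi_beta: "S \<parallel> \<Gamma> \<turnstile> A : Univ u \<Longrightarrow> S \<parallel> A # \<Gamma> \<turnstile> b : B \<Longrightarrow> S \<parallel> \<Gamma> \<turnstile> a : A \<Longrightarrow>
    S \<parallel> \<Gamma> \<turnstile> App (Lam A b) a \<equiv> inst 0 [a] b : inst 0 [a] B"
| pi_eta: "S \<parallel> \<Gamma> \<turnstile> f : Pi A B \<Longrightarrow>
    S \<parallel> \<Gamma> \<turnstile> f \<equiv> Lam A (App (shift 1 f) (Var 0)) : Pi A B"
| sg_form: "S \<parallel> \<Gamma> \<turnstile> A : Univ u \<Longrightarrow> S \<parallel> A # \<Gamma> \<turnstile> B : Univ v \<Longrightarrow>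
    S \<parallel> \<Gamma> \<turnstile> Sg A B : Univ (sup u v)"
| sg_cong: "S \<parallel> \<Gamma> \<turnstile> A \<equiv> A' : Univ u \<Longrightarrow> S \<parallel> \<Gamma> \<turnstile> A : Univ u \<Longrightarrow>
    S \<parallel> A # \<Gamma> \<turnstile> B \<equiv> B' : Univ v \<Longrightarrow> S \<parallel> \<Gamma> \<turnstile> Sg A B \<equiv> Sg A' B' : Univ (sup u v)"
| pair: "S \<parallel> A # \<Gamma> \<turnstile> B : Univ v \<Longrightarrow> S \<parallel> \<Gamma> \<turnstile> a : A \<Longrightarrow>
    S \<parallel> \<Gamma> \<turnstile> b : inst 0 [a] B \<Longrightarrow> S \<parallel> \<Gamma> \<turnstile> MkPair a b : Sg A B"
| pair_cong: "S \<parallel> A # \<Gamma> \<turnstile> B : Univ v \<Longrightarrow> S \<parallel> \<Gamma> \<turnstile> a \<equiv> a' : A \<Longrightarrow>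
    S \<parallel> \<Gamma> \<turnstile> b \<equiv> b' : inst 0 [a] B \<Longrightarrow> S \<parallel> \<Gamma> \<turnstile> MkPair a b \<equiv> MkPair a' b' : Sg A B"
| sg_elim: "S \<parallel> Sg A B # \<Gamma> \<turnstile> C : Univ w \<Longrightarrow>
    S \<parallel> B # A # \<Gamma> \<turnstile> g : inst 2 [MkPair (Var 1) (Var 0)] C \<Longrightarrow>
    S \<parallel> \<Gamma> \<turnstile> p : Sg A B \<Longrightarrow> S \<parallel> \<Gamma> \<turnstile> SgElim C g p : inst 0 [p] C"
| sg_elim_cong: "S \<parallel> Sg A B # \<Gamma> \<turnstile> C : Univ w \<Longrightarrow> S \<parallel> Sg A B # \<Gamma> \<turnstile> C \<equiv> C' : Univ w \<Longrightarrow>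
    S \<parallel> B # A # \<Gamma> \<turnstile> g \<equiv> g' : inst 2 [MkPair (Var 1) (Var 0)] C \<Longrightarrow>
    S \<parallel> \<Gamma> \<turnstile> p \<equiv> p' : Sg A B \<Longrightarrow> S \<parallel> \<Gamma> \<turnstile> SgElim C g p \<equiv> SgElim C' g' p' : inst 0 [p] C"
| sg_beta: "S \<parallel> Sg A B # \<Gamma> \<turnstile> C : Univ w \<Longrightarrow>
    S \<parallel> B # A # \<Gamma> \<turnstile> g : inst 2 [MkPair (Var 1) (Var 0)] C \<Longrightarrow>
    S \<parallel> \<Gamma> \<turnstile> a : A \<Longrightarrow> S \<parallel> \<Gamma> \<turnstile> b : inst 0 [a] B \<Longrightarrow>
    S \<parallel> \<Gamma> \<turnstile> SgElim C g (MkPair a b) \<equiv> inst 0 [b, a] g : inst 0 [MkPair a b] C"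
| sum_form: "S \<parallel> \<Gamma> \<turnstile> A : Univ u \<Longrightarrow> S \<parallel> \<Gamma> \<turnstile> B : Univ v \<Longrightarrow>
    S \<parallel> \<Gamma> \<turnstile> Sum A B : Univ (sup u v)"
| sum_cong: "S \<parallel> \<Gamma> \<turnstile> A \<equiv> A' : Univ u \<Longrightarrow> S \<parallel> \<Gamma> \<turnstile> B \<equiv> B' : Univ v \<Longrightarrow>
    S \<parallel> \<Gamma> \<turnstile> Sum A B \<equiv> Sum A' B' : Univ (sup u v)"
| inl: "S \<parallel> \<Gamma> \<turnstile> A : Univ u \<Longrightarrow> S \<parallel> \<Gamma> \<turnstile> B : Univ v \<Longrightarrow> S \<parallel> \<Gamma> \<turnstile> a : A \<Longrightarrow>
    S \<parallel> \<Gamma> \<turnstile> InL a : Sum A B"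
| inl_cong: "S \<parallel> \<Gamma> \<turnstile> A : Univ u \<Longrightarrow> S \<parallel> \<Gamma> \<turnstile> B : Univ v \<Longrightarrow> S \<parallel> \<Gamma> \<turnstile> a \<equiv> a' : A \<Longrightarrow>
    S \<parallel> \<Gamma> \<turnstile> InL a \<equiv> InL a' : Sum A B"
| inr: "S \<parallel> \<Gamma> \<turnstile> A : Univ u \<Longrightarrow> S \<parallel> \<Gamma> \<turnstile> B : Univ v \<Longrightarrow> S \<parallel> \<Gamma> \<turnstile> b : B \<Longrightarrow>
    S \<parallel> \<Gamma> \<turnstile> InR b : Sum A B"
| inr_cong: "S \<parallel> \<Gamma> \<turnstile> A : Univ u \<Longrightarrow> S \<parallel> \<Gamma> \<turnstile> B : Univ v \<Longrightarrow> S \<parallel> \<Gamma> \<turnstile> b \<equiv> b' : B \<Longrightarrow>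
    S \<parallel> \<Gamma> \<turnstile> InR b \<equiv> InR b' : Sum A B"
| sum_elim: "S \<parallel> Sum A B # \<Gamma> \<turnstile> C : Univ w \<Longrightarrow>
    S \<parallel> A # \<Gamma> \<turnstile> f : inst 1 [InL (Var 0)] C \<Longrightarrow>
    S \<parallel> B # \<Gamma> \<turnstile> g : inst 1 [InR (Var 0)] C \<Longrightarrow>
    S \<parallel> \<Gamma> \<turnstile> s : Sum A B \<Longrightarrow> S \<parallel> \<Gamma> \<turnstile> SumElim C f g s : inst 0 [s] C"
| sum_elim_cong: "S \<parallel> Sum A B # \<Gamma> \<turnstile> C : Univ w \<Longrightarrow> S \<parallel> Sum A B # \<Gamma> \<turnstile> C \<equiv> C' : Univ w \<Longrightarrow>
    S \<parallel> A # \<Gamma> \<turnstile> f \<equiv> f' : inst 1 [InL (Var 0)] C \<Longrightarrow>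
    S \<parallel> B # \<Gamma> \<turnstile> g \<equiv> g' : inst 1 [InR (Var 0)] C \<Longrightarrow>
    S \<parallel> \<Gamma> \<turnstile> s \<equiv> s' : Sum A B \<Longrightarrow> S \<parallel> \<Gamma> \<turnstile> SumElim C f g s \<equiv> SumElim C' f' g' s' : inst 0 [s] C"
| sum_beta_l: "S \<parallel> Sum A B # \<Gamma> \<turnstile> C : Univ w \<Longrightarrow>
    S \<parallel> A # \<Gamma> \<turnstile> f : inst 1 [InL (Var 0)] C \<Longrightarrow>
    S \<parallel> B # \<Gamma> \<turnstile> g : inst 1 [InR (Var 0)] C \<Longrightarrow>
    S \<parallel> \<Gamma> \<turnstile> a : A \<Longrightarrow> S \<parallel> \<Gamma> \<turnstile> SumElim C f g (InL a) \<equiv> inst 0 [a] f : inst 0 [InL a] C"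
| sum_beta_r: "S \<parallel> Sum A B # \<Gamma> \<turnstile> C : Univ w \<Longrightarrow>
    S \<parallel> A # \<Gamma> \<turnstile> f : inst 1 [InL (Var 0)] C \<Longrightarrow>
    S \<parallel> B # \<Gamma> \<turnstile> g : inst 1 [InR (Var 0)] C \<Longrightarrow>
    S \<parallel> \<Gamma> \<turnstile> b : B \<Longrightarrow> S \<parallel> \<Gamma> \<turnstile> SumElim C f g (InR b) \<equiv> inst 0 [b] g : inst 0 [InR b] C"
| empty_form: "wf_ctx S \<Gamma> \<Longrightarrow> S \<parallel> \<Gamma> \<turnstile> Empty u : Univ u"
| empty_elim: "S \<parallel> Empty u # \<Gamma> \<turnstile> C : Univ w \<Longrightarrow> S \<parallel> \<Gamma> \<turnstile> e : Empty u \<Longrightarrow>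
    S \<parallel> \<Gamma> \<turnstile> EmptyElim C e : inst 0 [e] C"
| empty_elim_cong: "S \<parallel> Empty u # \<Gamma> \<turnstile> C : Univ w \<Longrightarrow>
    S \<parallel> Empty u # \<Gamma> \<turnstile> C \<equiv> C' : Univ w \<Longrightarrow> S \<parallel> \<Gamma> \<turnstile> e \<equiv> e' : Empty u \<Longrightarrow>
    S \<parallel> \<Gamma> \<turnstile> EmptyElim C e \<equiv> EmptyElim C' e' : inst 0 [e] C"
| unit_form: "wf_ctx S \<Gamma> \<Longrightarrow> S \<parallel> \<Gamma> \<turnstile> Unit u : Univ u"
| star: "wf_ctx S \<Gamma> \<Longrightarrow> S \<parallel> \<Gamma> \<turnstile> Star u : Unit u"
| unit_elim: "S \<parallel> Unit u # \<Gamma> \<turnstile> C : Univ w \<Longrightarrow> S \<parallel> \<Gamma> \<turnstile> c : inst 0 [Star u] C \<Longrightarrow>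
    S \<parallel> \<Gamma> \<turnstile> t : Unit u \<Longrightarrow> S \<parallel> \<Gamma> \<turnstile> UnitElim C c t : inst 0 [t] C"
| unit_elim_cong: "S \<parallel> Unit u # \<Gamma> \<turnstile> C : Univ w \<Longrightarrow> S \<parallel> Unit u # \<Gamma> \<turnstile> C \<equiv> C' : Univ w \<Longrightarrow>
    S \<parallel> \<Gamma> \<turnstile> c \<equiv> c' : inst 0 [Star u] C \<Longrightarrow> S \<parallel> \<Gamma> \<turnstile> t \<equiv> t' : Unit u \<Longrightarrow>
    S \<parallel> \<Gamma> \<turnstile> UnitElim C c t \<equiv> UnitElim C' c' t' : inst 0 [t] C"
| unit_beta: "S \<parallel> Unit u # \<Gamma> \<turnstile> C : Univ w \<Longrightarrow> S \<parallel> \<Gamma> \<turnstile> c : inst 0 [Star u] C \<Longrightarrow>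
    S \<parallel> \<Gamma> \<turnstile> UnitElim C c (Star u) \<equiv> c : inst 0 [Star u] C"
| nat_form: "wf_ctx S \<Gamma> \<Longrightarrow> S \<parallel> \<Gamma> \<turnstile> NatT : Univ bot"
| zero: "wf_ctx S \<Gamma> \<Longrightarrow> S \<parallel> \<Gamma> \<turnstile> ZeroT : NatT"
| suc: "S \<parallel> \<Gamma> \<turnstile> n : NatT \<Longrightarrow> S \<parallel> \<Gamma> \<turnstile> SucT n : NatT"
| suc_cong: "S \<parallel> \<Gamma> \<turnstile> n \<equiv> n' : NatT \<Longrightarrow> S \<parallel> \<Gamma> \<turnstile> SucT n \<equiv> SucT n' : NatT"
| nat_elim: "S \<parallel> NatT # \<Gamma> \<turnstile> C : Univ w \<Longrightarrow> S \<parallel> \<Gamma> \<turnstile> z : inst 0 [ZeroT] C \<Longrightarrow>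
    S \<parallel> C # NatT # \<Gamma> \<turnstile> s : inst 2 [SucT (Var 1)] C \<Longrightarrow>
    S \<parallel> \<Gamma> \<turnstile> n : NatT \<Longrightarrow> S \<parallel> \<Gamma> \<turnstile> NatElim C z s n : inst 0 [n] C"
| nat_elim_cong: "S \<parallel> NatT # \<Gamma> \<turnstile> C : Univ w \<Longrightarrow> S \<parallel> NatT # \<Gamma> \<turnstile> C \<equiv> C' : Univ w \<Longrightarrow>
    S \<parallel> \<Gamma> \<turnstile> z \<equiv> z' : inst 0 [ZeroT] C \<Longrightarrow>
    S \<parallel> C # NatT # \<Gamma> \<turnstile> s \<equiv> s' : inst 2 [SucT (Var 1)] C \<Longrightarrow>
    S \<parallel> \<Gamma> \<turnstile> n \<equiv> n' : NatT \<Longrightarrow> S \<parallel> \<Gamma> \<turnstile> NatElim C z s n \<equiv> NatElim C' z' s' n' : inst 0 [n] C"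
| nat_beta_zero: "S \<parallel> NatT # \<Gamma> \<turnstile> C : Univ w \<Longrightarrow> S \<parallel> \<Gamma> \<turnstile> z : inst 0 [ZeroT] C \<Longrightarrow>
    S \<parallel> C # NatT # \<Gamma> \<turnstile> s : inst 2 [SucT (Var 1)] C \<Longrightarrow>
    S \<parallel> \<Gamma> \<turnstile> NatElim C z s ZeroT \<equiv> z : inst 0 [ZeroT] C"
| nat_beta_suc: "S \<parallel> NatT # \<Gamma> \<turnstile> C : Univ w \<Longrightarrow> S \<parallel> \<Gamma> \<turnstile> z : inst 0 [ZeroT] C \<Longrightarrow>
    S \<parallel> C # NatT # \<Gamma> \<turnstile> s : inst 2 [SucT (Var 1)] C \<Longrightarrow> S \<parallel> \<Gamma> \<turnstile> n : NatT \<Longrightarrow>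
    S \<parallel> \<Gamma> \<turnstile> NatElim C z s (SucT n) \<equiv> inst 0 [NatElim C z s n, n] s : inst 0 [SucT n] C"
| id_form: "S \<parallel> \<Gamma> \<turnstile> A : Univ u \<Longrightarrow> S \<parallel> \<Gamma> \<turnstile> a : A \<Longrightarrow> S \<parallel> \<Gamma> \<turnstile> b : A \<Longrightarrow>
    S \<parallel> \<Gamma> \<turnstile> Id A a b : Univ u"
| id_cong: "S \<parallel> \<Gamma> \<turnstile> A \<equiv> A' : Univ u \<Longrightarrow> S \<parallel> \<Gamma> \<turnstile> a \<equiv> a' : A \<Longrightarrow> S \<parallel> \<Gamma> \<turnstile> b \<equiv> b' : A \<Longrightarrow>
    S \<parallel> \<Gamma> \<turnstile> Id A a b \<equiv> Id A' a' b' : Univ u"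
| refl: "S \<parallel> \<Gamma> \<turnstile> A : Univ u \<Longrightarrow> S \<parallel> \<Gamma> \<turnstile> a : A \<Longrightarrow> S \<parallel> \<Gamma> \<turnstile> Refl a : Id A a a"
| refl_cong: "S \<parallel> \<Gamma> \<turnstile> A : Univ u \<Longrightarrow> S \<parallel> \<Gamma> \<turnstile> a \<equiv> a' : A \<Longrightarrow>
    S \<parallel> \<Gamma> \<turnstile> Refl a \<equiv> Refl a' : Id A a a"
| id_elim: "S \<parallel> Id (shift 2 A) (Var 1) (Var 0) # shift 1 A # A # \<Gamma> \<turnstile> C : Univ w \<Longrightarrow>
    S \<parallel> A # \<Gamma> \<turnstile> c : inst 1 [Refl (Var 0), Var 0, Var 0] C \<Longrightarrow>
    S \<parallel> \<Gamma> \<turnstile> a : A \<Longrightarrow> S \<parallel> \<Gamma> \<turnstile> b : A \<Longrightarrow> S \<parallel> \<Gamma> \<turnstile> p : Id A a b \<Longrightarrow>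
    S \<parallel> \<Gamma> \<turnstile> IdElim C c a b p : inst 0 [p, b, a] C"
| id_elim_cong: "S \<parallel> Id (shift 2 A) (Var 1) (Var 0) # shift 1 A # A # \<Gamma> \<turnstile> C : Univ w \<Longrightarrow>
    S \<parallel> Id (shift 2 A) (Var 1) (Var 0) # shift 1 A # A # \<Gamma> \<turnstile> C \<equiv> C' : Univ w \<Longrightarrow>
    S \<parallel> A # \<Gamma> \<turnstile> c \<equiv> c' : inst 1 [Refl (Var 0), Var 0, Var 0] C \<Longrightarrow>
    S \<parallel> \<Gamma> \<turnstile> a \<equiv> a' : A \<Longrightarrow> S \<parallel> \<Gamma> \<turnstile> b \<equiv> b' : A \<Longrightarrow> S \<parallel> \<Gamma> \<turnstile> p \<equiv> p' : Id A a b \<Longrightarrow>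
    S \<parallel> \<Gamma> \<turnstile> IdElim C c a b p \<equiv> IdElim C' c' a' b' p' : inst 0 [p, b, a] C"
| id_beta: "S \<parallel> Id (shift 2 A) (Var 1) (Var 0) # shift 1 A # A # \<Gamma> \<turnstile> C : Univ w \<Longrightarrow>
    S \<parallel> A # \<Gamma> \<turnstile> c : inst 1 [Refl (Var 0), Var 0, Var 0] C \<Longrightarrow> S \<parallel> \<Gamma> \<turnstile> a : A \<Longrightarrow>
    S \<parallel> \<Gamma> \<turnstile> IdElim C c a a (Refl a) \<equiv> inst 0 [a] c : inst 0 [Refl a, a, a] C"

end

theory Submission
  imports Defs
begin

text \<open>
  The section sends \<open>X\<close> to \<open>lift X = X \<times> 1\<close>. A map is an embedding as soon as its action on identity types is
  surjective. For \<open>lift\<close>, univalence turns this into the statement that every equivalence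
  \<open>lift X \<simeq> lift Y\<close> is the lift of an equivalence \<open>X \<simeq> Y\<close>. To compare such equivalences one needs that being
  an equivalence is a proposition, and that a map \<open>lift X \<rightarrow> Z\<close> is determined by its values at \<open>(x, \<star>)\<close>; both
  follow from equivalence induction. As \<open>lift\<close> is an embedding, its fibre over \<open>Y\<close> is a proposition,
  which has a copy \<open>P Y\<close> in the universe of level \<open>u\<close> by resizing. The retraction sends \<open>Y\<close> to the sum over \<open>P Y\<close> of the
  first components of the corresponding elements of the fibre; for \<open>Y = lift X\<close> this is a sum over a
  contractible type and hence equivalent to \<open>X\<close>.
  
  The typing derivations are found by computation: a normalising type checker for annotated terms is
  sound for the judgements, and the simplifier evaluates it on the proof terms.
\<close>


section \<open>Substitution calculus\<close>

text \<open>As the universes are not cumulative, a type of level \<open>u\<close> has to be moved to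
  level \<open>sup u v\<close> by hand; the unit type of level \<open>v\<close> supplies the missing
  level. An element of the fibre over \<open>Y\<close> is a type in \<open>Univ u\<close> with an
  identification in \<open>Univ (sup u v)\<close>, so the fibre has level
  \<open>sup (lsuc u) (lsuc (sup u v))\<close>. A sum of types of level \<open>u\<close> stays in
  \<open>Univ u\<close> only if its index type does, and resizing from that large level to
  \<open>u\<close> provides such an index type.

  Two obstacles shape the formal side. Identifications between functions are reached through
  judgemental eta: after equivalence induction the remaining case of an identity equivalence is
  settled by beta and eta. The checker therefore has to normalise up to eta. Moreover, neither
  injectivity of type formers nor strengthening of contexts is available for the judgements, so the
  soundness invariant carries the typings that they would otherwise provide. Earlier results enter
  later terms as opaque closed constants, so evaluation never unfolds a proof.\<close>

lemma up_ren_simps [simp]: "up_ren r 0 = 0" "up_ren r (Suc n) = Suc (r n)"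
  by (simp_all add: up_ren_def)

lemma up_simps [simp]: "up \<sigma> 0 = Var 0" "up \<sigma> (Suc n) = shift 1 (\<sigma> n)"
  by (simp_all add: up_def)

lemma up_ren_comp [simp]: "up_ren r \<circ> up_ren s = up_ren (r \<circ> s)"
proof
  fix n show "(up_ren r \<circ> up_ren s) n = up_ren (r \<circ> s) n" by (cases n) simp_all
qed

lemma rename_rename: "rename r (rename s t) = rename (r \<circ> s) t"
  by (induction t arbitrary: r s) simp_all

lemma up_comp_up_ren [simp]: "up \<sigma> \<circ> up_ren r = up (\<sigma> \<circ> r)"
proof
  fix n show "(up \<sigma> \<circ> up_ren r) n = up (\<sigma> \<circ> r) n" by (cases n) simp_all
qed

lemma subst_rename: "subst \<sigma> (rename r t) = subst (\<sigma> \<circ> r) t"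
  by (induction t arbitrary: \<sigma> r) simp_all

lemma rename_up_ren_shift: "rename (up_ren r) (shift 1 t) = shift 1 (rename r t)"
  by (simp add: shift_def rename_rename comp_def)

lemma rename_comp_up [simp]: "rename (up_ren r) \<circ> up \<sigma> = up (rename r \<circ> \<sigma>)"
proof
  fix n show "(rename (up_ren r) \<circ> up \<sigma>) n = up (rename r \<circ> \<sigma>) n"
    by (cases n) (simp_all add: rename_up_ren_shift del: One_nat_def)
qed

lemma rename_subst: "rename r (subst \<sigma> t) = subst (rename r \<circ> \<sigma>) t"
  by (induction t arbitrary: \<sigma> r) simp_all

lemma subst_up_shift: "subst (up \<sigma>) (shift 1 t) = shift 1 (subst \<sigma> t)"
  by (simp add: shift_def subst_rename rename_subst comp_def)

lemma subst_comp_up [simp]: "subst (up \<tau>) \<circ> up \<sigma> = up (subst \<tau> \<circ> \<sigma>)"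
proof
  fix n show "(subst (up \<tau>) \<circ> up \<sigma>) n = up (subst \<tau> \<circ> \<sigma>) n"
    by (cases n) (simp_all add: subst_up_shift del: One_nat_def)
qed

lemma subst_subst: "subst \<tau> (subst \<sigma> t) = subst (subst \<tau> \<circ> \<sigma>) t"
  by (induction t arbitrary: \<sigma> \<tau>) simp_all

lemma up_Var [simp]: "up Var = Var"
proof
  fix n show "up Var n = Var n" by (cases n) (simp_all add: shift_def)
qed

lemma subst_Var [simp]: "subst Var t = t"
  by (induction t) simp_all

lemma up_Var_comp [simp]: "up (Var \<circ> r) = Var \<circ> up_ren r"
proof
  fix n show "up (Var \<circ> r) n = (Var \<circ> up_ren r) n" by (cases n) (simp_all add: shift_def)
qed

lemma rename_as_subst: "rename r t = subst (Var \<circ> r) t"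
  by (induction t arbitrary: r) (simp_all del: comp_apply, simp)

lemma shift_as_subst: "shift k t = subst (\<lambda>n. Var (n + k)) t"
  by (simp add: shift_def rename_as_subst comp_def)

lemma subst_shift: "subst \<sigma> (shift k t) = subst (\<lambda>n. \<sigma> (n + k)) t"
  by (simp add: shift_def subst_rename comp_def)

lemma shift_subst: "shift k (subst \<sigma> t) = subst (\<lambda>n. shift k (\<sigma> n)) t"
  by (simp add: shift_def rename_subst comp_def)

lemma shift_shift: "shift j (shift k t) = shift (k + j) t"
  by (simp add: shift_def rename_rename comp_def add.assoc)

lemma shift_Var [simp]: "shift k (Var n) = Var (n + k)"
  by (simp add: shift_def)

lemma shift_0 [simp]: "shift 0 t = t"
  by (simp add: shift_as_subst)

lemma subst_cong: "(\<And>n. \<sigma> n = \<tau> n) \<Longrightarrow> subst \<sigma> t = subst \<tau> t"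
  by (metis ext)

primrec ups :: "nat \<Rightarrow> (nat \<Rightarrow> 'l tm) \<Rightarrow> nat \<Rightarrow> 'l tm" where
  "ups 0 \<sigma> = \<sigma>"
| "ups (Suc k) \<sigma> = up (ups k \<sigma>)"

lemma ups_less: "n < k \<Longrightarrow> ups k \<sigma> n = Var n"
proof (induction k arbitrary: n)
  case (Suc k)
  then show ?case by (cases n) simp_all
qed simp

lemma ups_add: "ups k \<sigma> (n + k) = shift k (\<sigma> n)"
  by (induction k arbitrary: n) (simp_all add: shift_shift)

text \<open>\<open>inst k ts\<close> trades \<open>length ts\<close> variables for \<open>k\<close>
  new ones, so the substitution passes under \<open>length ts\<close> binders on one side and
  \<open>k\<close> on the other. It suffices to compare both sides on variables.\<close>

lemma subst_inst:
  "subst (ups k \<sigma>) (inst k ts t) = inst k (map (subst (ups k \<sigma>)) ts) (subst (ups (length ts) \<sigma>) t)"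
  unfolding inst_def subst_subst
proof (rule subst_cong)
  fix n
  show "(subst (ups k \<sigma>) \<circ> (\<lambda>n. if n < length ts then ts ! n else Var (n - length ts + k))) n =
    (subst (\<lambda>n. if n < length (map (subst (ups k \<sigma>)) ts) then map (subst (ups k \<sigma>)) ts ! n
       else Var (n - length (map (subst (ups k \<sigma>)) ts) + k)) \<circ> ups (length ts) \<sigma>) n"
  proof (cases "n < length ts")
    case False
    then obtain m where "n = m + length ts" by (metis add.commute le_Suc_ex not_less)
    then show ?thesis by (simp add: ups_add shift_as_subst subst_subst comp_def)
  qed (simp add: ups_less)
qed

text \<open>These are the shapes in which \<open>inst\<close> occurs in the judgement rules; as simp
  rules they let each rule commute with substitution. \<open>Suc 0\<close> is the form to which simp
  brings \<open>1\<close>.\<close>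

lemma subst_inst_simps [simp]:
  "subst \<sigma> (inst 0 [a] t) = inst 0 [subst \<sigma> a] (subst (up \<sigma>) t)"
  "subst \<sigma> (inst 0 [b, a] t) = inst 0 [subst \<sigma> b, subst \<sigma> a] (subst (up (up \<sigma>)) t)"
  "subst \<sigma> (inst 0 [c, b, a] t) =
     inst 0 [subst \<sigma> c, subst \<sigma> b, subst \<sigma> a] (subst (up (up (up \<sigma>))) t)"
  "subst (up \<sigma>) (inst (Suc 0) [a] t) = inst (Suc 0) [subst (up \<sigma>) a] (subst (up \<sigma>) t)"
  "subst (up \<sigma>) (inst (Suc 0) [c, b, a] t) =
     inst (Suc 0) [subst (up \<sigma>) c, subst (up \<sigma>) b, subst (up \<sigma>) a] (subst (up (up (up \<sigma>))) t)"
  "subst (up (up \<sigma>)) (inst 2 [a] t) = inst 2 [subst (up (up \<sigma>)) a] (subst (up \<sigma>) t)"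
  using subst_inst[of 0 \<sigma> "[a]" t] subst_inst[of 0 \<sigma> "[b, a]" t] subst_inst[of 0 \<sigma> "[c, b, a]" t]
    subst_inst[of 1 \<sigma> "[a]" t] subst_inst[of 1 \<sigma> "[c, b, a]" t] subst_inst[of 2 \<sigma> "[a]" t]
  by (simp_all add: numeral_2_eq_2)

lemma rename_inst_simps [simp]:
  "rename r (inst 0 [a] t) = inst 0 [rename r a] (rename (up_ren r) t)"
  "rename r (inst 0 [b, a] t) = inst 0 [rename r b, rename r a] (rename (up_ren (up_ren r)) t)"
  "rename r (inst 0 [c, b, a] t) =
     inst 0 [rename r c, rename r b, rename r a] (rename (up_ren (up_ren (up_ren r))) t)"
  "rename (up_ren r) (inst (Suc 0) [a] t) = inst (Suc 0) [rename (up_ren r) a] (rename (up_ren r) t)"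
  "rename (up_ren r) (inst (Suc 0) [c, b, a] t) =
     inst (Suc 0) [rename (up_ren r) c, rename (up_ren r) b, rename (up_ren r) a]
       (rename (up_ren (up_ren (up_ren r))) t)"
  "rename (up_ren (up_ren r)) (inst 2 [a] t) = inst 2 [rename (up_ren (up_ren r)) a] (rename (up_ren r) t)"
  using subst_inst_simps[where \<sigma> = "Var \<circ> r"] by (simp_all add: rename_as_subst)

lemma rename_up_ren_shift_simps [simp]:
  "rename (up_ren r) (shift (Suc 0) t) = shift (Suc 0) (rename r t)"
  "rename (up_ren (up_ren r)) (shift 2 t) = shift 2 (rename r t)"
  by (simp_all add: shift_def rename_rename comp_def numeral_2_eq_2)

lemma subst_up_shift_simps [simp]:
  "subst (up \<sigma>) (shift (Suc 0) t) = shift (Suc 0) (subst \<sigma> t)"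
  "subst (up (up \<sigma>)) (shift 2 t) = shift 2 (subst \<sigma> t)"
  using subst_up_shift[of \<sigma> t] by (simp_all add: subst_shift shift_subst numeral_2_eq_2 shift_shift)

text \<open>The rule \<open>post\<close> assigns the same type in every context; its stability rests
  on the types of the postulates being closed.\<close>

lemma rename_post_type [simp]: "rename r (post_type c) = post_type c"
  by (cases c) (simp_all add: univalence_def prop_resizing_def is_prop_def arrow_def product_def
      equiv_def is_equiv_def inverse_law_def id_to_equiv_def id_equiv_def id_map_def trunc_def
      shift_def rename_rename comp_def numeral_2_eq_2)

lemma subst_post_type [simp]: "subst \<sigma> (post_type c) = post_type c"
  by (cases c) (simp_all add: univalence_def prop_resizing_def is_prop_def arrow_def product_def
      equiv_def is_equiv_def inverse_law_def id_to_equiv_def id_equiv_def id_map_def trunc_def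
      shift_def numeral_2_eq_2)


section \<open>Stability of the judgements under substitution\<close>

text \<open>The rule is restated with each premise in the shape of an induction hypothesis, so that
  \<open>blast\<close> can match it later; the simp rules for \<open>inst\<close> bridge the
  difference. The next lemmas do the same for sums, numbers and identity types.\<close>

lemma sg_elim_subst:
  assumes "S \<parallel> subst \<sigma> (Sg A B) # \<Delta> \<turnstile> subst (up \<sigma>) C : subst (up \<sigma>) (Univ w)"
    "S \<parallel> subst (up \<sigma>) B # subst \<sigma> A # \<Delta> \<turnstile> subst (up (up \<sigma>)) g :
      subst (up (up \<sigma>)) (inst 2 [MkPair (Var 1) (Var 0)] C)"
    "S \<parallel> \<Delta> \<turnstile> subst \<sigma> p : subst \<sigma> (Sg A B)"
  shows "S \<parallel> \<Delta> \<turnstile> subst \<sigma> (SgElim C g p) : subst \<sigma> (inst 0 [p] C)"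
  using sg_elim[of S "subst \<sigma> A" "subst (up \<sigma>) B" \<Delta> "subst (up \<sigma>) C"] assms by simp

lemma sg_elim_cong_subst:
  assumes "S \<parallel> subst \<sigma> (Sg A B) # \<Delta> \<turnstile> subst (up \<sigma>) C : subst (up \<sigma>) (Univ w)"
    "S \<parallel> subst \<sigma> (Sg A B) # \<Delta> \<turnstile> subst (up \<sigma>) C \<equiv> subst (up \<sigma>) C' : subst (up \<sigma>) (Univ w)"
    "S \<parallel> subst (up \<sigma>) B # subst \<sigma> A # \<Delta> \<turnstile> subst (up (up \<sigma>)) g \<equiv> subst (up (up \<sigma>)) g' :
      subst (up (up \<sigma>)) (inst 2 [MkPair (Var 1) (Var 0)] C)"
    "S \<parallel> \<Delta> \<turnstile> subst \<sigma> p \<equiv> subst \<sigma> p' : subst \<sigma> (Sg A B)"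
  shows "S \<parallel> \<Delta> \<turnstile> subst \<sigma> (SgElim C g p) \<equiv> subst \<sigma> (SgElim C' g' p') : subst \<sigma> (inst 0 [p] C)"
  using sg_elim_cong[of S "subst \<sigma> A" "subst (up \<sigma>) B" \<Delta> "subst (up \<sigma>) C"] assms by simp

lemma sg_beta_subst:
  assumes "S \<parallel> subst \<sigma> (Sg A B) # \<Delta> \<turnstile> subst (up \<sigma>) C : subst (up \<sigma>) (Univ w)"
    "S \<parallel> subst (up \<sigma>) B # subst \<sigma> A # \<Delta> \<turnstile> subst (up (up \<sigma>)) g :
      subst (up (up \<sigma>)) (inst 2 [MkPair (Var 1) (Var 0)] C)"
    "S \<parallel> \<Delta> \<turnstile> subst \<sigma> a : subst \<sigma> A" "S \<parallel> \<Delta> \<turnstile> subst \<sigma> b : subst \<sigma> (inst 0 [a] B)"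
  shows "S \<parallel> \<Delta> \<turnstile> subst \<sigma> (SgElim C g (MkPair a b)) \<equiv> subst \<sigma> (inst 0 [b, a] g) :
    subst \<sigma> (inst 0 [MkPair a b] C)"
  using sg_beta[of S "subst \<sigma> A" "subst (up \<sigma>) B" \<Delta> "subst (up \<sigma>) C"] assms by simp

lemma sum_elim_subst:
  assumes "S \<parallel> subst \<sigma> (Sum A B) # \<Delta> \<turnstile> subst (up \<sigma>) C : subst (up \<sigma>) (Univ w)"
    "S \<parallel> subst \<sigma> A # \<Delta> \<turnstile> subst (up \<sigma>) f : subst (up \<sigma>) (inst 1 [InL (Var 0)] C)"
    "S \<parallel> subst \<sigma> B # \<Delta> \<turnstile> subst (up \<sigma>) g : subst (up \<sigma>) (inst 1 [InR (Var 0)] C)"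
    "S \<parallel> \<Delta> \<turnstile> subst \<sigma> s : subst \<sigma> (Sum A B)"
  shows "S \<parallel> \<Delta> \<turnstile> subst \<sigma> (SumElim C f g s) : subst \<sigma> (inst 0 [s] C)"
  using sum_elim[of S "subst \<sigma> A" "subst \<sigma> B" \<Delta> "subst (up \<sigma>) C"] assms by simp

lemma sum_elim_cong_subst:
  assumes "S \<parallel> subst \<sigma> (Sum A B) # \<Delta> \<turnstile> subst (up \<sigma>) C : subst (up \<sigma>) (Univ w)"
    "S \<parallel> subst \<sigma> (Sum A B) # \<Delta> \<turnstile> subst (up \<sigma>) C \<equiv> subst (up \<sigma>) C' : subst (up \<sigma>) (Univ w)"
    "S \<parallel> subst \<sigma> A # \<Delta> \<turnstile> subst (up \<sigma>) f \<equiv> subst (up \<sigma>) f' : subst (up \<sigma>) (inst 1 [InL (Var 0)] C)"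
    "S \<parallel> subst \<sigma> B # \<Delta> \<turnstile> subst (up \<sigma>) g \<equiv> subst (up \<sigma>) g' : subst (up \<sigma>) (inst 1 [InR (Var 0)] C)"
    "S \<parallel> \<Delta> \<turnstile> subst \<sigma> s \<equiv> subst \<sigma> s' : subst \<sigma> (Sum A B)"
  shows "S \<parallel> \<Delta> \<turnstile> subst \<sigma> (SumElim C f g s) \<equiv> subst \<sigma> (SumElim C' f' g' s') : subst \<sigma> (inst 0 [s] C)"
  using sum_elim_cong[of S "subst \<sigma> A" "subst \<sigma> B" \<Delta> "subst (up \<sigma>) C"] assms by simp

lemma sum_beta_subst:
  assumes "S \<parallel> subst \<sigma> (Sum A B) # \<Delta> \<turnstile> subst (up \<sigma>) C : subst (up \<sigma>) (Univ w)"
    "S \<parallel> subst \<sigma> A # \<Delta> \<turnstile> subst (up \<sigma>) f : subst (up \<sigma>) (inst 1 [InL (Var 0)] C)"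
    "S \<parallel> subst \<sigma> B # \<Delta> \<turnstile> subst (up \<sigma>) g : subst (up \<sigma>) (inst 1 [InR (Var 0)] C)"
  shows "S \<parallel> \<Delta> \<turnstile> subst \<sigma> a : subst \<sigma> A \<Longrightarrow>
      S \<parallel> \<Delta> \<turnstile> subst \<sigma> (SumElim C f g (InL a)) \<equiv> subst \<sigma> (inst 0 [a] f) : subst \<sigma> (inst 0 [InL a] C)"
    and "S \<parallel> \<Delta> \<turnstile> subst \<sigma> b : subst \<sigma> B \<Longrightarrow>
      S \<parallel> \<Delta> \<turnstile> subst \<sigma> (SumElim C f g (InR b)) \<equiv> subst \<sigma> (inst 0 [b] g) : subst \<sigma> (inst 0 [InR b] C)"
  using sum_beta_l[of S "subst \<sigma> A" "subst \<sigma> B" \<Delta> "subst (up \<sigma>) C"]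
    sum_beta_r[of S "subst \<sigma> A" "subst \<sigma> B" \<Delta> "subst (up \<sigma>) C"] assms by simp_all

lemma nat_elim_subst:
  assumes "S \<parallel> subst \<sigma> NatT # \<Delta> \<turnstile> subst (up \<sigma>) C : subst (up \<sigma>) (Univ w)"
    "S \<parallel> \<Delta> \<turnstile> subst \<sigma> z : subst \<sigma> (inst 0 [ZeroT] C)"
    "S \<parallel> subst (up \<sigma>) C # subst \<sigma> NatT # \<Delta> \<turnstile> subst (up (up \<sigma>)) s : subst (up (up \<sigma>)) (inst 2 [SucT (Var 1)] C)"
  shows "S \<parallel> \<Delta> \<turnstile> subst \<sigma> n : subst \<sigma> NatT \<Longrightarrow>
      S \<parallel> \<Delta> \<turnstile> subst \<sigma> (NatElim C z s n) : subst \<sigma> (inst 0 [n] C)"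
    and "S \<parallel> \<Delta> \<turnstile> subst \<sigma> (NatElim C z s ZeroT) \<equiv> subst \<sigma> z : subst \<sigma> (inst 0 [ZeroT] C)"
    and "S \<parallel> \<Delta> \<turnstile> subst \<sigma> n : subst \<sigma> NatT \<Longrightarrow>
      S \<parallel> \<Delta> \<turnstile> subst \<sigma> (NatElim C z s (SucT n)) \<equiv> subst \<sigma> (inst 0 [NatElim C z s n, n] s) :
        subst \<sigma> (inst 0 [SucT n] C)"
  using nat_elim[of S \<Delta> "subst (up \<sigma>) C"] nat_beta_zero[of S \<Delta> "subst (up \<sigma>) C"]
    nat_beta_suc[of S \<Delta> "subst (up \<sigma>) C"] assms by simp_all

lemma nat_elim_cong_subst:
  assumes "S \<parallel> subst \<sigma> NatT # \<Delta> \<turnstile> subst (up \<sigma>) C : subst (up \<sigma>) (Univ w)"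
    "S \<parallel> subst \<sigma> NatT # \<Delta> \<turnstile> subst (up \<sigma>) C \<equiv> subst (up \<sigma>) C' : subst (up \<sigma>) (Univ w)"
    "S \<parallel> \<Delta> \<turnstile> subst \<sigma> z \<equiv> subst \<sigma> z' : subst \<sigma> (inst 0 [ZeroT] C)"
    "S \<parallel> subst (up \<sigma>) C # subst \<sigma> NatT # \<Delta> \<turnstile> subst (up (up \<sigma>)) s \<equiv> subst (up (up \<sigma>)) s' :
      subst (up (up \<sigma>)) (inst 2 [SucT (Var 1)] C)"
    "S \<parallel> \<Delta> \<turnstile> subst \<sigma> n \<equiv> subst \<sigma> n' : subst \<sigma> NatT"
  shows "S \<parallel> \<Delta> \<turnstile> subst \<sigma> (NatElim C z s n) \<equiv> subst \<sigma> (NatElim C' z' s' n') : subst \<sigma> (inst 0 [n] C)"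
  using nat_elim_cong[of S \<Delta> "subst (up \<sigma>) C"] assms by simp

lemma id_elim_subst:
  assumes "S \<parallel> subst (up (up \<sigma>)) (Id (shift 2 A) (Var 1) (Var 0)) # subst (up \<sigma>) (shift 1 A) # subst \<sigma> A # \<Delta> \<turnstile>
      subst (up (up (up \<sigma>))) C : subst (up (up (up \<sigma>))) (Univ w)"
    "S \<parallel> subst \<sigma> A # \<Delta> \<turnstile> subst (up \<sigma>) c : subst (up \<sigma>) (inst 1 [Refl (Var 0), Var 0, Var 0] C)"
  shows "S \<parallel> \<Delta> \<turnstile> subst \<sigma> a : subst \<sigma> A \<Longrightarrow> S \<parallel> \<Delta> \<turnstile> subst \<sigma> b : subst \<sigma> A \<Longrightarrow>
      S \<parallel> \<Delta> \<turnstile> subst \<sigma> p : subst \<sigma> (Id A a b) \<Longrightarrow>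
      S \<parallel> \<Delta> \<turnstile> subst \<sigma> (IdElim C c a b p) : subst \<sigma> (inst 0 [p, b, a] C)"
    and "S \<parallel> \<Delta> \<turnstile> subst \<sigma> a : subst \<sigma> A \<Longrightarrow>
      S \<parallel> \<Delta> \<turnstile> subst \<sigma> (IdElim C c a a (Refl a)) \<equiv> subst \<sigma> (inst 0 [a] c) :
        subst \<sigma> (inst 0 [Refl a, a, a] C)"
  using id_elim[of S "subst \<sigma> A" \<Delta> "subst (up (up (up \<sigma>))) C"]
    id_beta[of S "subst \<sigma> A" \<Delta> "subst (up (up (up \<sigma>))) C"] assms by simp_all

lemma id_elim_cong_subst:
  assumes "S \<parallel> subst (up (up \<sigma>)) (Id (shift 2 A) (Var 1) (Var 0)) # subst (up \<sigma>) (shift 1 A) # subst \<sigma> A # \<Delta> \<turnstile>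
      subst (up (up (up \<sigma>))) C : subst (up (up (up \<sigma>))) (Univ w)"
    "S \<parallel> subst (up (up \<sigma>)) (Id (shift 2 A) (Var 1) (Var 0)) # subst (up \<sigma>) (shift 1 A) # subst \<sigma> A # \<Delta> \<turnstile>
      subst (up (up (up \<sigma>))) C \<equiv> subst (up (up (up \<sigma>))) C' : subst (up (up (up \<sigma>))) (Univ w)"
    "S \<parallel> subst \<sigma> A # \<Delta> \<turnstile> subst (up \<sigma>) c \<equiv> subst (up \<sigma>) c' :
      subst (up \<sigma>) (inst 1 [Refl (Var 0), Var 0, Var 0] C)"
    "S \<parallel> \<Delta> \<turnstile> subst \<sigma> a \<equiv> subst \<sigma> a' : subst \<sigma> A" "S \<parallel> \<Delta> \<turnstile> subst \<sigma> b \<equiv> subst \<sigma> b' : subst \<sigma> A"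
    "S \<parallel> \<Delta> \<turnstile> subst \<sigma> p \<equiv> subst \<sigma> p' : subst \<sigma> (Id A a b)"
  shows "S \<parallel> \<Delta> \<turnstile> subst \<sigma> (IdElim C c a b p) \<equiv> subst \<sigma> (IdElim C' c' a' b' p') :
    subst \<sigma> (inst 0 [p, b, a] C)"
  using id_elim_cong[of S "subst \<sigma> A" \<Delta> "subst (up (up (up \<sigma>))) C"] assms by simp

text \<open>
  Stability under renaming and under substitution are the instances \<open>ren_ok\<close> and \<open>sub_ok\<close> below; going
  under a binder with a substitution already needs stability under renaming.
\<close>

locale stable_subst =
  fixes S :: "'l::universe_level postulate set"
    and ok :: "(nat \<Rightarrow> 'l tm) \<Rightarrow> 'l tm list \<Rightarrow> 'l tm list \<Rightarrow> bool"
  assumes ok_wf: "ok \<sigma> \<Gamma> \<Delta> \<Longrightarrow> wf_ctx S \<Delta>"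
    and ok_var: "ok \<sigma> \<Gamma> \<Delta> \<Longrightarrow> n < length \<Gamma> \<Longrightarrow> S \<parallel> \<Delta> \<turnstile> \<sigma> n : subst \<sigma> (shift (Suc n) (\<Gamma> ! n))"
    and ok_up: "ok \<sigma> \<Gamma> \<Delta> \<Longrightarrow> S \<parallel> \<Delta> \<turnstile> subst \<sigma> A : Univ u \<Longrightarrow> ok (up \<sigma>) (A # \<Gamma>) (subst \<sigma> A # \<Delta>)"
begin

text \<open>
  Premises such as the one of \<open>pair\<close> live in an extended context whose new type is not typed by
  another premise, so the induction has to carry the stability of all types in the context.
\<close>

primrec good :: "'l tm list \<Rightarrow> bool" where
  "good [] = True"
| "good (A # \<Gamma>) \<longleftrightarrow> good \<Gamma> \<and> (\<exists>u. \<forall>\<Delta> \<sigma>. ok \<sigma> \<Gamma> \<Delta> \<longrightarrow> S \<parallel> \<Delta> \<turnstile> subst \<sigma> A : Univ u)"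

declare good.simps(2) [simp del]

lemma good_tl: "good (A # \<Gamma>) \<Longrightarrow> good \<Gamma>"
  by (simp add: good.simps(2))

lemma ok_ext: "good (A # \<Gamma>) \<Longrightarrow> ok \<sigma> \<Gamma> \<Delta> \<Longrightarrow> ok (up \<sigma>) (A # \<Gamma>) (subst \<sigma> A # \<Delta>)"
  by (auto simp: good.simps(2) intro: ok_up)

text \<open>In the cases of these two types simp has already turned
  \<open>subst \<sigma> (Empty u)\<close> into \<open>Empty u\<close>, a form that
  \<open>ok_ext\<close> does not match syntactically.\<close>

lemma ok_ext_closed:
  "good (Empty u # \<Gamma>) \<Longrightarrow> ok \<sigma> \<Gamma> \<Delta> \<Longrightarrow> ok (up \<sigma>) (Empty u # \<Gamma>) (Empty u # \<Delta>)"
  "good (Unit u # \<Gamma>) \<Longrightarrow> ok \<sigma> \<Gamma> \<Delta> \<Longrightarrow> ok (up \<sigma>) (Unit u # \<Gamma>) (Unit u # \<Delta>)"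
  using ok_ext[of "Empty u"] ok_ext[of "Unit u"] by simp_all

text \<open>Each rule is applied again to its own induction hypotheses. A premise below a binder
  yields \<open>good\<close> for the extended context, and \<open>ok_ext\<close> turns this into
  \<open>ok\<close> for the lifted substitution.\<close>

theorem subst_typing:
  "wf_ctx S \<Gamma> \<Longrightarrow> good \<Gamma>"
  "S \<parallel> \<Gamma> \<turnstile> t : A \<Longrightarrow> good \<Gamma> \<and> (\<forall>\<Delta> \<sigma>. ok \<sigma> \<Gamma> \<Delta> \<longrightarrow> S \<parallel> \<Delta> \<turnstile> subst \<sigma> t : subst \<sigma> A)"
  "S \<parallel> \<Gamma> \<turnstile> t \<equiv> s : A \<Longrightarrow>
    good \<Gamma> \<and> (\<forall>\<Delta> \<sigma>. ok \<sigma> \<Gamma> \<Delta> \<longrightarrow> S \<parallel> \<Delta> \<turnstile> subst \<sigma> t \<equiv> subst \<sigma> s : subst \<sigma> A)"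
proof (induction rule: wf_ctx_has_type_jeq.inducts)
  case ctx_nil show ?case by simp
next
  case ctx_cons then show ?case by (auto simp: good.simps(2))
next
  case var then show ?case by (auto intro: ok_var)
next
  case pi_eta then show ?case by (auto intro!: wf_ctx_has_type_jeq.pi_eta[unfolded One_nat_def])
next
  case conv then show ?case
    by (simp; blast intro: wf_ctx_has_type_jeq.conv[unfolded One_nat_def] ok_wf good_tl ok_ext)
next
  case jeq_conv then show ?case
    by (simp; blast intro: wf_ctx_has_type_jeq.jeq_conv[unfolded One_nat_def] ok_wf good_tl ok_ext)
next
  case jeq_refl then show ?case
    by (simp; blast intro: wf_ctx_has_type_jeq.jeq_refl[unfolded One_nat_def] ok_wf good_tl ok_ext)
next
  case jeq_sym then show ?case
    by (simp; blast intro: wf_ctx_has_type_jeq.jeq_sym[unfolded One_nat_def] ok_wf good_tl ok_ext)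
next
  case jeq_trans then show ?case
    by (simp; blast intro: wf_ctx_has_type_jeq.jeq_trans[unfolded One_nat_def] ok_wf good_tl ok_ext)
next
  case post then show ?case
    by (simp; blast intro: wf_ctx_has_type_jeq.post[unfolded One_nat_def] ok_wf good_tl ok_ext)
next
  case univ then show ?case
    by (simp; blast intro: wf_ctx_has_type_jeq.univ[unfolded One_nat_def] ok_wf good_tl ok_ext)
next
  case pi_form then show ?case
    by (simp; blast intro: wf_ctx_has_type_jeq.pi_form[unfolded One_nat_def] ok_wf good_tl ok_ext)
next
  case pi_cong then show ?case
    by (simp; blast intro: wf_ctx_has_type_jeq.pi_cong[unfolded One_nat_def] ok_wf good_tl ok_ext)
next
  case lam then show ?case
    by (simp; blast intro: wf_ctx_has_type_jeq.lam[unfolded One_nat_def] ok_wf good_tl ok_ext)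
next
  case lam_cong then show ?case
    by (simp; blast intro: wf_ctx_has_type_jeq.lam_cong[unfolded One_nat_def] ok_wf good_tl ok_ext)
next
  case app then show ?case
    by (simp; blast intro: wf_ctx_has_type_jeq.app[unfolded One_nat_def] ok_wf good_tl ok_ext)
next
  case app_cong then show ?case
    by (simp; blast intro: wf_ctx_has_type_jeq.app_cong[unfolded One_nat_def] ok_wf good_tl ok_ext)
next
  case pi_beta then show ?case
    by (simp; blast intro: wf_ctx_has_type_jeq.pi_beta[unfolded One_nat_def] ok_wf good_tl ok_ext)
next
  case sg_form then show ?case
    by (simp; blast intro: wf_ctx_has_type_jeq.sg_form[unfolded One_nat_def] ok_wf good_tl ok_ext)
next
  case sg_cong then show ?case
    by (simp; blast intro: wf_ctx_has_type_jeq.sg_cong[unfolded One_nat_def] ok_wf good_tl ok_ext)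
next
  case pair then show ?case
    by (simp; blast intro: wf_ctx_has_type_jeq.pair[unfolded One_nat_def] ok_wf good_tl ok_ext)
next
  case pair_cong then show ?case
    by (simp; blast intro: wf_ctx_has_type_jeq.pair_cong[unfolded One_nat_def] ok_wf good_tl ok_ext)
next
  case sum_form then show ?case
    by (simp; blast intro: wf_ctx_has_type_jeq.sum_form[unfolded One_nat_def] ok_wf good_tl ok_ext)
next
  case sum_cong then show ?case
    by (simp; blast intro: wf_ctx_has_type_jeq.sum_cong[unfolded One_nat_def] ok_wf good_tl ok_ext)
next
  case inl then show ?case
    by (simp; blast intro: wf_ctx_has_type_jeq.inl[unfolded One_nat_def] ok_wf good_tl ok_ext)
next
  case inl_cong then show ?case
    by (simp; blast intro: wf_ctx_has_type_jeq.inl_cong[unfolded One_nat_def] ok_wf good_tl ok_ext)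
next
  case inr then show ?case
    by (simp; blast intro: wf_ctx_has_type_jeq.inr[unfolded One_nat_def] ok_wf good_tl ok_ext)
next
  case inr_cong then show ?case
    by (simp; blast intro: wf_ctx_has_type_jeq.inr_cong[unfolded One_nat_def] ok_wf good_tl ok_ext)
next
  case empty_form then show ?case
    by (simp; blast intro: wf_ctx_has_type_jeq.empty_form[unfolded One_nat_def] ok_wf good_tl ok_ext)
next
  case empty_elim then show ?case
    by (simp; blast intro: wf_ctx_has_type_jeq.empty_elim[unfolded One_nat_def] ok_wf good_tl ok_ext_closed)
next
  case empty_elim_cong then show ?case
    by (simp; blast intro: wf_ctx_has_type_jeq.empty_elim_cong[unfolded One_nat_def] ok_wf good_tl ok_ext_closed)
next
  case unit_form then show ?case
    by (simp; blast intro: wf_ctx_has_type_jeq.unit_form[unfolded One_nat_def] ok_wf good_tl ok_ext)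
next
  case star then show ?case
    by (simp; blast intro: wf_ctx_has_type_jeq.star[unfolded One_nat_def] ok_wf good_tl ok_ext)
next
  case unit_elim then show ?case
    by (simp; blast intro: wf_ctx_has_type_jeq.unit_elim[unfolded One_nat_def] ok_wf good_tl ok_ext_closed)
next
  case unit_elim_cong then show ?case
    by (simp; blast intro: wf_ctx_has_type_jeq.unit_elim_cong[unfolded One_nat_def] ok_wf good_tl ok_ext_closed)
next
  case unit_beta then show ?case
    by (simp; blast intro: wf_ctx_has_type_jeq.unit_beta[unfolded One_nat_def] ok_wf good_tl ok_ext_closed)
next
  case nat_form then show ?case
    by (simp; blast intro: wf_ctx_has_type_jeq.nat_form[unfolded One_nat_def] ok_wf good_tl ok_ext)
next
  case zero then show ?case
    by (simp; blast intro: wf_ctx_has_type_jeq.zero[unfolded One_nat_def] ok_wf good_tl ok_ext)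
next
  case suc then show ?case
    by (simp; blast intro: wf_ctx_has_type_jeq.suc[unfolded One_nat_def] ok_wf good_tl ok_ext)
next
  case suc_cong then show ?case
    by (simp; blast intro: wf_ctx_has_type_jeq.suc_cong[unfolded One_nat_def] ok_wf good_tl ok_ext)
next
  case id_form then show ?case
    by (simp; blast intro: wf_ctx_has_type_jeq.id_form[unfolded One_nat_def] ok_wf good_tl ok_ext)
next
  case id_cong then show ?case
    by (simp; blast intro: wf_ctx_has_type_jeq.id_cong[unfolded One_nat_def] ok_wf good_tl ok_ext)
next
  case refl then show ?case
    by (simp; blast intro: wf_ctx_has_type_jeq.refl[unfolded One_nat_def] ok_wf good_tl ok_ext)
next
  case refl_cong then show ?case
    by (simp; blast intro: wf_ctx_has_type_jeq.refl_cong[unfolded One_nat_def] ok_wf good_tl ok_ext)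
next
  case sg_elim then show ?case
    by (blast intro: sg_elim_subst ok_wf good_tl ok_ext)
next
  case sg_elim_cong then show ?case
    by (blast intro: sg_elim_cong_subst ok_wf good_tl ok_ext)
next
  case sg_beta then show ?case
    by (blast intro: sg_beta_subst ok_wf good_tl ok_ext)
next
  case sum_elim then show ?case
    by (blast intro: sum_elim_subst ok_wf good_tl ok_ext)
next
  case sum_elim_cong then show ?case
    by (blast intro: sum_elim_cong_subst ok_wf good_tl ok_ext)
next
  case sum_beta_l then show ?case
    by (blast intro: sum_beta_subst ok_wf good_tl ok_ext)
next
  case sum_beta_r then show ?case
    by (blast intro: sum_beta_subst ok_wf good_tl ok_ext)
next
  case nat_elim then show ?case
    by (blast intro: nat_elim_subst ok_wf good_tl ok_ext)
next
  case nat_elim_cong then show ?case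
    by (blast intro: nat_elim_cong_subst ok_wf good_tl ok_ext)
next
  case nat_beta_zero then show ?case
    by (blast intro: nat_elim_subst ok_wf good_tl ok_ext)
next
  case nat_beta_suc then show ?case
    by (blast intro: nat_elim_subst ok_wf good_tl ok_ext)
next
  case id_elim then show ?case
    by (blast intro: id_elim_subst ok_wf good_tl ok_ext)
next
  case id_elim_cong then show ?case
    by (blast intro: id_elim_cong_subst ok_wf good_tl ok_ext)
next
  case id_beta then show ?case
    by (blast intro: id_elim_subst ok_wf good_tl ok_ext)
qed

end

section \<open>Renaming and weakening, substitution and instantiation\<close>

definition instm :: "nat \<Rightarrow> 'l tm list \<Rightarrow> nat \<Rightarrow> 'l tm" where
  "instm k ts n = (if n < length ts then ts ! n else Var (n - length ts + k))"

lemma inst_eq: "inst k ts = subst (instm k ts)"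
  by (simp add: inst_def instm_def[abs_def])

lemma instm_Nil: "instm k [] = (\<lambda>n. Var (n + k))"
  by (simp add: instm_def fun_eq_iff)

lemma instm_Cons: "instm k (a # ts) = case_nat a (instm k ts)"
  by (simp add: instm_def fun_eq_iff split: nat.split)

text \<open>Writing a renaming as the substitution \<open>Var \<circ> r\<close> makes it an instance
  of the same locale. The types of variables have to match literally, so that going under a binder
  needs only computation with shifts.\<close>

definition ren_ok :: "'l::universe_level postulate set \<Rightarrow> (nat \<Rightarrow> 'l tm) \<Rightarrow> 'l tm list \<Rightarrow> 'l tm list \<Rightarrow> bool" where
  "ren_ok S \<sigma> \<Gamma> \<Delta> \<longleftrightarrow> wf_ctx S \<Delta> \<and> (\<exists>r. \<sigma> = Var \<circ> r \<and>
    (\<forall>n < length \<Gamma>. r n < length \<Delta> \<and> shift (Suc (r n)) (\<Delta> ! r n) = rename r (shift (Suc n) (\<Gamma> ! n))))"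

interpretation renaming: stable_subst S "ren_ok S"
proof
  fix \<sigma> \<Gamma> \<Delta> assume "ren_ok S \<sigma> \<Gamma> \<Delta>"
  then show "wf_ctx S \<Delta>" by (simp add: ren_ok_def)
next
  fix \<sigma> \<Gamma> \<Delta> n assume "ren_ok S \<sigma> \<Gamma> \<Delta>" "n < length \<Gamma>"
  then show "S \<parallel> \<Delta> \<turnstile> \<sigma> n : subst \<sigma> (shift (Suc n) (\<Gamma> ! n))"
    unfolding ren_ok_def by (metis comp_apply rename_as_subst var)
next
  fix \<sigma> \<Gamma> \<Delta> A u assume ok: "ren_ok S \<sigma> \<Gamma> \<Delta>" and A: "S \<parallel> \<Delta> \<turnstile> subst \<sigma> A : Univ u"
  then obtain r where r: "\<sigma> = Var \<circ> r"
    "\<And>n. n < length \<Gamma> \<Longrightarrow> r n < length \<Delta> \<and> shift (Suc (r n)) (\<Delta> ! r n) = rename r (shift (Suc n) (\<Gamma> ! n))"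
    by (auto simp: ren_ok_def)
  have "up_ren r n < length (subst \<sigma> A # \<Delta>) \<and>
      shift (Suc (up_ren r n)) ((subst \<sigma> A # \<Delta>) ! up_ren r n) =
      rename (up_ren r) (shift (Suc n) ((A # \<Gamma>) ! n))" if n: "n < length (A # \<Gamma>)" for n
  proof (cases n)
    case (Suc m)
    have "shift (Suc (Suc (r m))) (\<Delta> ! r m) = shift 1 (shift (Suc (r m)) (\<Delta> ! r m))"
      by (simp add: shift_shift)
    also have "\<dots> = rename (up_ren r) (shift 1 (shift (Suc m) (\<Gamma> ! m)))"
      using r(2)[of m] n Suc by simp
    finally show ?thesis using r(2)[of m] n Suc by (simp add: shift_shift)
  qed (simp add: r(1) rename_as_subst[symmetric])
  then show "ren_ok S (up \<sigma>) (A # \<Gamma>) (subst \<sigma> A # \<Delta>)"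
    unfolding ren_ok_def r(1) using ctx_cons[OF A] r(1) by auto
qed

lemma ren_ok_shift: "wf_ctx S (\<Theta> @ \<Gamma>) \<Longrightarrow> ren_ok S (\<lambda>n. Var (n + length \<Theta>)) \<Gamma> (\<Theta> @ \<Gamma>)"
  unfolding ren_ok_def
  by (intro conjI exI[of _ "\<lambda>n. n + length \<Theta>"])
    (auto simp: fun_eq_iff shift_shift nth_append simp flip: shift_def intro: arg_cong2[where f = shift])

lemma weakening:
  assumes "wf_ctx S (\<Theta> @ \<Gamma>)"
  shows "S \<parallel> \<Gamma> \<turnstile> t : A \<Longrightarrow> S \<parallel> \<Theta> @ \<Gamma> \<turnstile> shift (length \<Theta>) t : shift (length \<Theta>) A"
    and "S \<parallel> \<Gamma> \<turnstile> t \<equiv> s : A \<Longrightarrow> S \<parallel> \<Theta> @ \<Gamma> \<turnstile> shift (length \<Theta>) t \<equiv> shift (length \<Theta>) s : shift (length \<Theta>) A"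
  using renaming.subst_typing(2,3) ren_ok_shift[OF assms] unfolding shift_as_subst by blast+

lemma weakening1:
  assumes "S \<parallel> \<Gamma> \<turnstile> B : Univ u"
  shows "S \<parallel> \<Gamma> \<turnstile> t : A \<Longrightarrow> S \<parallel> B # \<Gamma> \<turnstile> shift (Suc 0) t : shift (Suc 0) A"
    and "S \<parallel> \<Gamma> \<turnstile> t \<equiv> s : A \<Longrightarrow> S \<parallel> B # \<Gamma> \<turnstile> shift (Suc 0) t \<equiv> shift (Suc 0) s : shift (Suc 0) A"
  using weakening[of S "[B]" \<Gamma>] ctx_cons[OF assms] by simp_all

definition sub_ok :: "'l::universe_level postulate set \<Rightarrow> (nat \<Rightarrow> 'l tm) \<Rightarrow> 'l tm list \<Rightarrow> 'l tm list \<Rightarrow> bool" where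
  "sub_ok S \<sigma> \<Gamma> \<Delta> \<longleftrightarrow> wf_ctx S \<Delta> \<and>
    (\<forall>n < length \<Gamma>. S \<parallel> \<Delta> \<turnstile> \<sigma> n : subst \<sigma> (shift (Suc n) (\<Gamma> ! n)))"

lemma sub_ok_case_nat:
  assumes "sub_ok S \<sigma> \<Gamma> \<Delta>" "S \<parallel> \<Delta> \<turnstile> a : subst \<sigma> A"
  shows "sub_ok S (case_nat a \<sigma>) (A # \<Gamma>) \<Delta>"
  unfolding sub_ok_def
proof (intro conjI allI impI)
  fix n assume "n < length (A # \<Gamma>)"
  then show "S \<parallel> \<Delta> \<turnstile> case_nat a \<sigma> n : subst (case_nat a \<sigma>) (shift (Suc n) ((A # \<Gamma>) ! n))"
    using assms by (cases n) (auto simp: sub_ok_def subst_shift)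
qed (use assms in \<open>simp add: sub_ok_def\<close>)

lemma sub_ok_weaken:
  assumes "sub_ok S \<sigma> \<Gamma> \<Delta>" "S \<parallel> \<Delta> \<turnstile> B : Univ u"
  shows "sub_ok S (\<lambda>n. shift (Suc 0) (\<sigma> n)) \<Gamma> (B # \<Delta>)"
  unfolding sub_ok_def shift_subst[symmetric]
  using assms weakening1[OF assms(2)] by (auto simp: sub_ok_def intro: ctx_cons)

interpretation substitution: stable_subst S "sub_ok S"
proof
  fix \<sigma> \<Gamma> \<Delta> A u assume ok: "sub_ok S \<sigma> \<Gamma> \<Delta>" and A: "S \<parallel> \<Delta> \<turnstile> subst \<sigma> A : Univ u"
  show "sub_ok S (up \<sigma>) (A # \<Gamma>) (subst \<sigma> A # \<Delta>)"
    unfolding up_def One_nat_def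
    by (rule sub_ok_case_nat[OF sub_ok_weaken[OF ok A]])
      (use var[OF ctx_cons[OF A], of 0] in \<open>simp add: shift_subst[symmetric]\<close>)
qed (auto simp: sub_ok_def)

lemma sub_ok_shift: "wf_ctx S (\<Theta> @ \<Gamma>) \<Longrightarrow> k = length \<Theta> \<Longrightarrow> sub_ok S (instm k []) \<Gamma> (\<Theta> @ \<Gamma>)"
  using renaming.ok_var[OF ren_ok_shift] by (auto simp: sub_ok_def instm_Nil)

lemma sub_ok_Cons:
  "sub_ok S (instm k ts) \<Gamma> \<Delta> \<Longrightarrow> S \<parallel> \<Delta> \<turnstile> a : inst k ts A \<Longrightarrow> sub_ok S (instm k (a # ts)) (A # \<Gamma>) \<Delta>"
  unfolding instm_Cons inst_eq by (rule sub_ok_case_nat)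

lemma inst_Nil [simp]: "inst k [] t = shift k t"
  by (simp add: inst_eq instm_Nil shift_as_subst)

lemma sub_ok_Nil: "wf_ctx S \<Gamma> \<Longrightarrow> sub_ok S (instm 0 []) \<Gamma> \<Gamma>"
  using sub_ok_shift[of S "[]"] by simp

lemma inst_typing:
  assumes "sub_ok S (instm k ts) \<Gamma> \<Delta>"
  shows "S \<parallel> \<Gamma> \<turnstile> t : A \<Longrightarrow> S \<parallel> \<Delta> \<turnstile> inst k ts t : inst k ts A"
    and "S \<parallel> \<Gamma> \<turnstile> t \<equiv> s : A \<Longrightarrow> S \<parallel> \<Delta> \<turnstile> inst k ts t \<equiv> inst k ts s : inst k ts A"
  using substitution.subst_typing(2,3) assms unfolding inst_eq by blast+

section \<open>Context conversion, closed terms and inversion\<close>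

lemma wf_ctx_consD: "wf_ctx S (A # \<Gamma>) \<Longrightarrow> \<exists>u. S \<parallel> \<Gamma> \<turnstile> A : Univ u"
  by (cases rule: wf_ctx.cases) auto

lemma typing_wf:
  "wf_ctx S \<Gamma> \<Longrightarrow> \<forall>A \<Delta>. \<Gamma> = A # \<Delta> \<longrightarrow> wf_ctx S \<Delta>"
  "S \<parallel> \<Gamma> \<turnstile> t : A \<Longrightarrow> wf_ctx S \<Gamma>"
  "S \<parallel> \<Gamma> \<turnstile> t \<equiv> s : A \<Longrightarrow> wf_ctx S \<Gamma>"
  by (induction rule: wf_ctx_has_type_jeq.inducts) auto

text \<open>The identity substitution is read as one from \<open>A # \<Gamma>\<close> to
  \<open>A' # \<Gamma>\<close>: its most recent variable is converted from \<open>A'\<close> to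
  \<open>A\<close>.\<close>

lemma ctx_conv:
  assumes "S \<parallel> \<Gamma> \<turnstile> A' : Univ k" "S \<parallel> \<Gamma> \<turnstile> A' \<equiv> A : Univ l"
  shows "S \<parallel> A # \<Gamma> \<turnstile> t : T \<Longrightarrow> S \<parallel> A' # \<Gamma> \<turnstile> t : T"
    and "S \<parallel> A # \<Gamma> \<turnstile> t \<equiv> s : T \<Longrightarrow> S \<parallel> A' # \<Gamma> \<turnstile> t \<equiv> s : T"
proof -
  have wf: "wf_ctx S (A' # \<Gamma>)" by (rule ctx_cons[OF assms(1)])
  have "S \<parallel> A' # \<Gamma> \<turnstile> shift 1 A' \<equiv> shift 1 A : Univ l"
    using weakening1(2)[OF assms] by (simp add: shift_def)
  then have "S \<parallel> A' # \<Gamma> \<turnstile> Var 0 : shift 1 A"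
    using var[OF wf, of 0] by (auto intro: conv)
  then have "sub_ok S (case_nat (Var 0) (instm 1 [])) (A # \<Gamma>) (A' # \<Gamma>)"
    using sub_ok_case_nat[OF sub_ok_shift[of S "[A']" \<Gamma> 1], of "Var 0" A] wf
    by (simp add: inst_eq[symmetric])
  moreover have "case_nat (Var 0) (instm 1 []) = Var"
    by (auto simp: instm_Nil split: nat.split)
  ultimately have "sub_ok S Var (A # \<Gamma>) (A' # \<Gamma>)" by metis
  then show "S \<parallel> A # \<Gamma> \<turnstile> t : T \<Longrightarrow> S \<parallel> A' # \<Gamma> \<turnstile> t : T"
    and "S \<parallel> A # \<Gamma> \<turnstile> t \<equiv> s : T \<Longrightarrow> S \<parallel> A' # \<Gamma> \<turnstile> t \<equiv> s : T"
    using substitution.subst_typing(2,3)[of S "A # \<Gamma>"] by fastforce+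
qed

lemma inst1_typing:
  assumes "S \<parallel> \<Gamma> \<turnstile> a : A"
  shows "S \<parallel> A # \<Gamma> \<turnstile> t : T \<Longrightarrow> S \<parallel> \<Gamma> \<turnstile> inst 0 [a] t : inst 0 [a] T"
    and "S \<parallel> A # \<Gamma> \<turnstile> t \<equiv> s : T \<Longrightarrow> S \<parallel> \<Gamma> \<turnstile> inst 0 [a] t \<equiv> inst 0 [a] s : inst 0 [a] T"
  using inst_typing[OF sub_ok_Cons[OF sub_ok_Nil[OF typing_wf(2)[OF assms]]]] assms by simp_all

text \<open>Typing bounds the free variables by the length of the context. Phrasing this through
  substitutions avoids a separate notion of free variable.\<close>

lemma closed_aux:
  "wf_ctx S \<Gamma> \<Longrightarrow> True"
  "S \<parallel> \<Gamma> \<turnstile> t : A \<Longrightarrow> \<forall>\<sigma>. (\<forall>n < length \<Gamma>. \<sigma> n = Var n) \<longrightarrow> subst \<sigma> t = t"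
  "S \<parallel> \<Gamma> \<turnstile> t \<equiv> s : A \<Longrightarrow> True"
proof (induction rule: wf_ctx_has_type_jeq.inducts)
qed (simp_all add: up_def numeral_3_eq_3 numeral_2_eq_2 split: nat.split)

lemma closed_subst: "S \<parallel> [] \<turnstile> t : A \<Longrightarrow> subst \<sigma> t = t"
  using closed_aux(2) by fastforce

lemma closed_shift: "S \<parallel> [] \<turnstile> t : A \<Longrightarrow> shift k t = t"
  by (simp add: shift_as_subst closed_subst)

lemma weakening_closed:
  assumes "wf_ctx S \<Gamma>" "S \<parallel> [] \<turnstile> t : A" "S \<parallel> [] \<turnstile> A : Univ u"
  shows "S \<parallel> \<Gamma> \<turnstile> t : A"
  using weakening(1)[of S \<Gamma> "[]" t A] assms by (simp add: closed_shift)

text \<open>A \<open>Pi\<close> is typed only by its formation rule or by converting its universe,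
  so induction on the derivation suffices; nothing is claimed about judgementally equal product
  types.\<close>

lemma Pi_inversion: "S \<parallel> \<Gamma> \<turnstile> Pi A B : T \<Longrightarrow> \<exists>u v. S \<parallel> \<Gamma> \<turnstile> A : Univ u \<and> S \<parallel> A # \<Gamma> \<turnstile> B : Univ v"
  by (induction \<Gamma> "Pi A B" T rule: wf_ctx_has_type_jeq.inducts(2)[where ?P1.0 = "\<lambda>_. True" and ?P3.0 = "\<lambda>_ _ _ _. True"]) auto


section \<open>A normalising type checker\<close>

text \<open>
  \<open>Lv a b c d e\<close> is the join of those of the levels \<open>u\<close>, \<open>v\<close>, \<open>lsuc u\<close>, \<open>lsuc (sup u v)\<close> and
  \<open>lsuc (sup (lsuc u) (lsuc (sup u v)))\<close> whose flags are set. No other levels occur in the proof,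
  which is why \<open>lsucc\<close> may be partial.
\<close>

datatype lv = Lv bool bool bool bool bool

fun lsup :: "lv \<Rightarrow> lv \<Rightarrow> lv" where
  "lsup (Lv a b c d e) (Lv a' b' c' d' e') = Lv (a \<or> a') (b \<or> b') (c \<or> c') (d \<or> d') (e \<or> e')"

fun lsucc :: "lv \<Rightarrow> lv option" where
  "lsucc (Lv True False False False False) = Some (Lv False False True False False)"
| "lsucc (Lv True True False False False) = Some (Lv False False False True False)"
| "lsucc (Lv False False True True False) = Some (Lv False False False False True)"
| "lsucc _ = None"

text \<open>
  Pairs are annotated with the two components of their type, so that all types can be inferred;
  \<open>G i\<close> stands for the (opaque) proof of the \<open>i\<close>-th result established before.
\<close>

datatype ptm =
    V nat
  | G nat
  | U lv
  | PI ptm ptm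
  | LAM ptm ptm
  | AP ptm ptm
  | SG ptm ptm
  | PAIR ptm ptm ptm ptm
  | SPLIT ptm ptm ptm
  | ONE lv
  | STAR lv
  | ELIM1 ptm ptm ptm
  | ID ptm ptm ptm
  | RFL ptm
  | JJ ptm ptm ptm ptm ptm

text \<open>\<open>lft\<close> and \<open>ins\<close> are first-order counterparts of
  \<open>rename\<close> and \<open>inst\<close> under \<open>d\<close> binders: with numbers in
  place of functions the simplifier can evaluate them. \<open>er_lft\<close> and
  \<open>er_ins\<close> make the connection.\<close>

primrec lft :: "nat \<Rightarrow> nat \<Rightarrow> ptm \<Rightarrow> ptm" where
  "lft d k (V n) = V (if n < d then n else n + k)"
| "lft d k (G i) = G i"
| "lft d k (U l) = U l"
| "lft d k (PI A B) = PI (lft d k A) (lft (Suc d) k B)"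
| "lft d k (LAM A b) = LAM (lft d k A) (lft (Suc d) k b)"
| "lft d k (AP f a) = AP (lft d k f) (lft d k a)"
| "lft d k (SG A B) = SG (lft d k A) (lft (Suc d) k B)"
| "lft d k (PAIR A B a b) = PAIR (lft d k A) (lft (Suc d) k B) (lft d k a) (lft d k b)"
| "lft d k (SPLIT C g p) = SPLIT (lft (Suc d) k C) (lft (Suc (Suc d)) k g) (lft d k p)"
| "lft d k (ONE l) = ONE l"
| "lft d k (STAR l) = STAR l"
| "lft d k (ELIM1 C c t) = ELIM1 (lft (Suc d) k C) (lft d k c) (lft d k t)"
| "lft d k (ID A a b) = ID (lft d k A) (lft d k a) (lft d k b)"
| "lft d k (RFL a) = RFL (lft d k a)"
| "lft d k (JJ C c a b p) =
     JJ (lft (Suc (Suc (Suc d))) k C) (lft (Suc d) k c) (lft d k a) (lft d k b) (lft d k p)"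

primrec ins :: "nat \<Rightarrow> nat \<Rightarrow> ptm list \<Rightarrow> ptm \<Rightarrow> ptm" where
  "ins d k ts (V n) =
     (if n < d then V n else if n - d < length ts then lft 0 d (ts ! (n - d)) else V (n - length ts + k))"
| "ins d k ts (G i) = G i"
| "ins d k ts (U l) = U l"
| "ins d k ts (PI A B) = PI (ins d k ts A) (ins (Suc d) k ts B)"
| "ins d k ts (LAM A b) = LAM (ins d k ts A) (ins (Suc d) k ts b)"
| "ins d k ts (AP f a) = AP (ins d k ts f) (ins d k ts a)"
| "ins d k ts (SG A B) = SG (ins d k ts A) (ins (Suc d) k ts B)"
| "ins d k ts (PAIR A B a b) = PAIR (ins d k ts A) (ins (Suc d) k ts B) (ins d k ts a) (ins d k ts b)"
| "ins d k ts (SPLIT C g p) = SPLIT (ins (Suc d) k ts C) (ins (Suc (Suc d)) k ts g) (ins d k ts p)"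
| "ins d k ts (ONE l) = ONE l"
| "ins d k ts (STAR l) = STAR l"
| "ins d k ts (ELIM1 C c t) = ELIM1 (ins (Suc d) k ts C) (ins d k ts c) (ins d k ts t)"
| "ins d k ts (ID A a b) = ID (ins d k ts A) (ins d k ts a) (ins d k ts b)"
| "ins d k ts (RFL a) = RFL (ins d k ts a)"
| "ins d k ts (JJ C c a b p) =
     JJ (ins (Suc (Suc (Suc d))) k ts C) (ins (Suc d) k ts c) (ins d k ts a) (ins d k ts b) (ins d k ts p)"

fun is_lam where "is_lam (LAM A b) = True" | "is_lam _ = False"
fun lam_body where "lam_body (LAM A b) = b" | "lam_body t = t"
fun is_pair where "is_pair (PAIR A B a b) = True" | "is_pair _ = False"
fun pair_1 where "pair_1 (PAIR A B a b) = a" | "pair_1 t = t"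
fun pair_2 where "pair_2 (PAIR A B a b) = b" | "pair_2 t = t"
fun is_rfl where "is_rfl (RFL a) = True" | "is_rfl _ = False"
fun is_ap0 where "is_ap0 (AP f (V n)) = (n = 0)" | "is_ap0 _ = False"
fun ap_fun where "ap_fun (AP f a) = f" | "ap_fun t = t"

text \<open>A shortcut that spares the evaluation of types. Soundness holds whatever it accepts,
  since \<open>nrm\<close> then returns the type unchanged; a wrong answer could only make a later
  comparison fail. \<open>ELIM1\<close> has no redex condition because \<open>step\<close> never
  reduces it.\<close>

primrec normal :: "ptm \<Rightarrow> bool" where
  "normal (V n) = True"
| "normal (G i) = True"
| "normal (U l) = True"
| "normal (PI A B) = (normal A \<and> normal B)"
| "normal (LAM A b) = (normal A \<and> normal b \<and> \<not> is_ap0 b)"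
| "normal (AP f a) = (\<not> is_lam f \<and> normal f \<and> normal a)"
| "normal (SG A B) = (normal A \<and> normal B)"
| "normal (PAIR A B a b) = (normal A \<and> normal B \<and> normal a \<and> normal b)"
| "normal (SPLIT C g p) = (\<not> is_pair p \<and> normal C \<and> normal g \<and> normal p)"
| "normal (ONE l) = True"
| "normal (STAR l) = True"
| "normal (ELIM1 C c t) = (normal C \<and> normal c \<and> normal t)"
| "normal (ID A a b) = (normal A \<and> normal a \<and> normal b)"
| "normal (RFL a) = normal a"
| "normal (JJ C c a b p) = (\<not> is_rfl p \<and> normal C \<and> normal c \<and> normal a \<and> normal b \<and> normal p)"

text \<open>Named binds in place of \<open>case\<close> expressions allow \<open>weak_congs\<close>
  to keep the simplifier out of the continuations.\<close>

fun on2 :: "(ptm \<times> ptm) option \<Rightarrow> (ptm \<Rightarrow> ptm \<Rightarrow> 'b option) \<Rightarrow> 'b option" where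
  "on2 (Some (t, T)) f = f t T" | "on2 None f = None"
fun onU :: "(ptm \<times> ptm) option \<Rightarrow> (ptm \<Rightarrow> lv \<Rightarrow> 'b option) \<Rightarrow> 'b option" where
  "onU (Some (t, U l)) f = f t l" | "onU _ f = None"
fun onPI :: "(ptm \<times> ptm) option \<Rightarrow> (ptm \<Rightarrow> ptm \<Rightarrow> ptm \<Rightarrow> 'b option) \<Rightarrow> 'b option" where
  "onPI (Some (t, PI A B)) f = f t A B" | "onPI _ f = None"
fun onSG :: "(ptm \<times> ptm) option \<Rightarrow> (ptm \<Rightarrow> ptm \<Rightarrow> ptm \<Rightarrow> 'b option) \<Rightarrow> 'b option" where
  "onSG (Some (t, SG A B)) f = f t A B" | "onSG _ f = None"
fun onONE :: "(ptm \<times> ptm) option \<Rightarrow> (ptm \<Rightarrow> lv \<Rightarrow> 'b option) \<Rightarrow> 'b option" where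
  "onONE (Some (t, ONE l)) f = f t l" | "onONE _ f = None"
fun onID :: "(ptm \<times> ptm) option \<Rightarrow> (ptm \<Rightarrow> ptm \<Rightarrow> ptm \<Rightarrow> ptm \<Rightarrow> 'b option) \<Rightarrow> 'b option" where
  "onID (Some (t, ID A a b)) f = f t A a b" | "onID _ f = None"
fun onT :: "ptm option \<Rightarrow> (ptm \<Rightarrow> 'b option) \<Rightarrow> 'b option" where
  "onT (Some t) f = f t" | "onT None f = None"
fun onL :: "lv option \<Rightarrow> (lv \<Rightarrow> 'b option) \<Rightarrow> 'b option" where
  "onL (Some t) f = f t" | "onL None f = None"

type_synonym evt = "ptm list \<Rightarrow> ptm \<Rightarrow> (ptm \<times> ptm) option"

definition nrm :: "evt \<Rightarrow> ptm list \<Rightarrow> ptm \<Rightarrow> ptm option" where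
  "nrm E \<Gamma> T = (if normal T then Some T else onU (E \<Gamma> T) (\<lambda>T' l. Some T'))"

definition ev_at :: "evt \<Rightarrow> ptm list \<Rightarrow> ptm \<Rightarrow> ptm \<Rightarrow> (ptm \<times> ptm) option" where
  "ev_at E \<Gamma> t T = on2 (E \<Gamma> t) (\<lambda>t' T'. if T' = T then Some (t', T) else None)"

text \<open>
  One layer of a function that maps a term to its beta-eta normal form and the normal form of its
  type. In the eta rule, \<open>A\<close> is a dummy that replaces the bound variable, which does not occur if
  shifting the result back gives \<open>ap_fun b\<close>.
\<close>

primrec step :: "evt \<Rightarrow> (nat \<Rightarrow> ptm option) \<Rightarrow> ptm list \<Rightarrow> ptm \<Rightarrow> (ptm \<times> ptm) option" where
  "step E gl \<Gamma> (V n) = (if n < length \<Gamma> then Some (V n, lft 0 (Suc n) (\<Gamma> ! n)) else None)"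
| "step E gl \<Gamma> (G i) = onT (gl i) (\<lambda>T. Some (G i, T))"
| "step E gl \<Gamma> (U l) = onL (lsucc l) (\<lambda>m. Some (U l, U m))"
| "step E gl \<Gamma> (PI A B) = onU (E \<Gamma> A) (\<lambda>A l. onU (E (A # \<Gamma>) B) (\<lambda>B m. Some (PI A B, U (lsup l m))))"
| "step E gl \<Gamma> (SG A B) = onU (E \<Gamma> A) (\<lambda>A l. onU (E (A # \<Gamma>) B) (\<lambda>B m. Some (SG A B, U (lsup l m))))"
| "step E gl \<Gamma> (LAM A b) = onU (E \<Gamma> A) (\<lambda>A l. on2 (E (A # \<Gamma>) b) (\<lambda>b B.
     if is_ap0 b \<and> lft 0 (Suc 0) (ins 0 0 [A] (ap_fun b)) = ap_fun b
     then ev_at E \<Gamma> (ins 0 0 [A] (ap_fun b)) (PI A B)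
     else Some (LAM A b, PI A B)))"
| "step E gl \<Gamma> (AP f a) = onPI (E \<Gamma> f) (\<lambda>f A B. on2 (E \<Gamma> a) (\<lambda>a A'. if A' = A then
     onT (nrm E \<Gamma> (ins 0 0 [a] B)) (\<lambda>T.
       if is_lam f then ev_at E \<Gamma> (ins 0 0 [a] (lam_body f)) T else Some (AP f a, T)) else None))"
| "step E gl \<Gamma> (PAIR A B a b) = onU (E \<Gamma> A) (\<lambda>A l. onU (E (A # \<Gamma>) B) (\<lambda>B m. on2 (E \<Gamma> a) (\<lambda>a A'.
     if A' = A then onT (nrm E \<Gamma> (ins 0 0 [a] B)) (\<lambda>Ba. on2 (E \<Gamma> b) (\<lambda>b B'.
       if B' = Ba then Some (PAIR A B a b, SG A B) else None)) else None)))"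
| "step E gl \<Gamma> (SPLIT C g p) = onSG (E \<Gamma> p) (\<lambda>p A B. onU (E (SG A B # \<Gamma>) C) (\<lambda>C l.
     onT (nrm E (B # A # \<Gamma>) (ins 0 2 [PAIR (lft 0 2 A) (lft (Suc 0) 2 B) (V (Suc 0)) (V 0)] C)) (\<lambda>Tg.
     on2 (E (B # A # \<Gamma>) g) (\<lambda>g Tg'. if Tg' = Tg then
     onT (nrm E \<Gamma> (ins 0 0 [p] C)) (\<lambda>T.
       if is_pair p then ev_at E \<Gamma> (ins 0 0 [pair_2 p, pair_1 p] g) T else Some (SPLIT C g p, T)) else None))))"
| "step E gl \<Gamma> (ONE l) = Some (ONE l, U l)"
| "step E gl \<Gamma> (STAR l) = Some (STAR l, ONE l)"
| "step E gl \<Gamma> (ELIM1 C c t) = onONE (E \<Gamma> t) (\<lambda>t l. onU (E (ONE l # \<Gamma>) C) (\<lambda>C m.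
     onT (nrm E \<Gamma> (ins 0 0 [STAR l] C)) (\<lambda>Tc. on2 (E \<Gamma> c) (\<lambda>c Tc'. if Tc' = Tc then
     onT (nrm E \<Gamma> (ins 0 0 [t] C)) (\<lambda>T. Some (ELIM1 C c t, T)) else None))))"
| "step E gl \<Gamma> (ID A a b) = onU (E \<Gamma> A) (\<lambda>A l. on2 (E \<Gamma> a) (\<lambda>a A1. if A1 = A then
     on2 (E \<Gamma> b) (\<lambda>b A2. if A2 = A then Some (ID A a b, U l) else None) else None))"
| "step E gl \<Gamma> (RFL a) = on2 (E \<Gamma> a) (\<lambda>a A. Some (RFL a, ID A a a))"
| "step E gl \<Gamma> (JJ C c a b p) = onID (E \<Gamma> p) (\<lambda>p A a1 b1. on2 (E \<Gamma> a) (\<lambda>a2 A2. on2 (E \<Gamma> b) (\<lambda>b2 A3.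
     if A2 = A \<and> A3 = A \<and> a2 = a1 \<and> b2 = b1 then
     onU (E (ID (lft 0 2 A) (V (Suc 0)) (V 0) # lft 0 (Suc 0) A # A # \<Gamma>) C) (\<lambda>C l.
     onT (nrm E (A # \<Gamma>) (ins 0 (Suc 0) [RFL (V 0), V 0, V 0] C)) (\<lambda>Tc.
     on2 (E (A # \<Gamma>) c) (\<lambda>c Tc'. if Tc' = Tc then
     onT (nrm E \<Gamma> (ins 0 0 [p, b1, a1] C)) (\<lambda>T.
       if is_rfl p then ev_at E \<Gamma> (ins 0 0 [a1] c) T else Some (JJ C c a1 b1 p, T)) else None))) else None)))"

primrec ev :: "(nat \<Rightarrow> ptm option) \<Rightarrow> nat \<Rightarrow> evt" where
  "ev gl 0 = (\<lambda>\<Gamma> t. None)"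
| "ev gl (Suc n) = step (ev gl n) gl"


section \<open>Functionality of instantiation\<close>

lemma Sg_inversion: "S \<parallel> \<Gamma> \<turnstile> Sg A B : T \<Longrightarrow> \<exists>u v. S \<parallel> \<Gamma> \<turnstile> A : Univ u \<and> S \<parallel> A # \<Gamma> \<turnstile> B : Univ v"
  by (induction \<Gamma> "Sg A B" T rule: wf_ctx_has_type_jeq.inducts(2)[where ?P1.0 = "\<lambda>_. True" and ?P3.0 = "\<lambda>_ _ _ _. True"]) auto

lemma inst_Univ [simp]: "inst k ts (Univ u) = Univ u"
  by (simp add: inst_eq)

text \<open>
  Functionality of instantiation is obtained by beta expansion from the congruence rule of
  application, which avoids a further induction on derivations.
\<close>

lemma inst1_type_cong:
  assumes "S \<parallel> \<Gamma> \<turnstile> A : Univ k" "S \<parallel> A # \<Gamma> \<turnstile> B : Univ l"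
    "S \<parallel> \<Gamma> \<turnstile> a : A" "S \<parallel> \<Gamma> \<turnstile> a' : A" "S \<parallel> \<Gamma> \<turnstile> a \<equiv> a' : A"
  shows "S \<parallel> \<Gamma> \<turnstile> inst 0 [a] B \<equiv> inst 0 [a'] B : Univ l"
proof -
  have "S \<parallel> \<Gamma> \<turnstile> App (Lam A B) a \<equiv> App (Lam A B) a' : Univ l"
    using app_cong[OF jeq_refl[OF lam[OF assms(1,2)]] assms(5)] by simp
  moreover have "S \<parallel> \<Gamma> \<turnstile> App (Lam A B) a \<equiv> inst 0 [a] B : Univ l"
    using pi_beta[OF assms(1-3)] by simp
  moreover have "S \<parallel> \<Gamma> \<turnstile> App (Lam A B) a' \<equiv> inst 0 [a'] B : Univ l"
    using pi_beta[OF assms(1,2,4)] by simp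
  ultimately show ?thesis by (meson jeq_sym jeq_trans)
qed

lemma inst1_cong:
  assumes "S \<parallel> \<Gamma> \<turnstile> A : Univ k" "S \<parallel> A # \<Gamma> \<turnstile> B : Univ l" "S \<parallel> A # \<Gamma> \<turnstile> t : B"
    "S \<parallel> \<Gamma> \<turnstile> a : A" "S \<parallel> \<Gamma> \<turnstile> a' : A" "S \<parallel> \<Gamma> \<turnstile> a \<equiv> a' : A"
  shows "S \<parallel> \<Gamma> \<turnstile> inst 0 [a] t \<equiv> inst 0 [a'] t : inst 0 [a] B"
proof -
  have "S \<parallel> \<Gamma> \<turnstile> App (Lam A t) a \<equiv> App (Lam A t) a' : inst 0 [a] B"
    by (rule app_cong[OF jeq_refl[OF lam[OF assms(1,3)]] assms(6)])
  moreover have "S \<parallel> \<Gamma> \<turnstile> App (Lam A t) a \<equiv> inst 0 [a] t : inst 0 [a] B"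
    by (rule pi_beta[OF assms(1,3,4)])
  moreover have "S \<parallel> \<Gamma> \<turnstile> App (Lam A t) a' \<equiv> inst 0 [a'] t : inst 0 [a] B"
    by (rule jeq_conv[OF pi_beta[OF assms(1,3,5)] jeq_sym[OF inst1_type_cong[OF assms(1,2,4,5,6)]]])
  ultimately show ?thesis by (meson jeq_sym jeq_trans)
qed

abbreviation "path_ctx A \<equiv> [Id (shift 2 A) (Var 1) (Var 0), shift 1 A, A]"

lemma inst0_shift [simp]: "inst 0 [a] (shift (Suc 0) t) = t"
  "inst 0 [b, a] (shift 2 t) = t"
  "inst 0 [c, b, a] (shift 3 t) = t"
  by (simp_all add: inst_eq subst_shift instm_def cong: if_cong)

lemma inst0_Var [simp]: "inst 0 (a # as) (Var 0) = a" "inst 0 (b # a # as) (Var (Suc 0)) = a"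
  by (simp_all add: inst_def)

lemma path_ctx_wf:
  assumes "S \<parallel> \<Gamma> \<turnstile> A : Univ u"
  shows "wf_ctx S (path_ctx A @ \<Gamma>)" "S \<parallel> [shift 1 A, A] @ \<Gamma> \<turnstile> Id (shift 2 A) (Var 1) (Var 0) : Univ u"
    "S \<parallel> A # \<Gamma> \<turnstile> shift 1 A : Univ u"
proof -
  have 1: "S \<parallel> A # \<Gamma> \<turnstile> shift 1 A : Univ u"
    using weakening1(1)[OF assms assms] by (simp add: shift_def)
  then have wf: "wf_ctx S ([shift 1 A, A] @ \<Gamma>)" by (auto intro: ctx_cons)
  have 2: "S \<parallel> [shift 1 A, A] @ \<Gamma> \<turnstile> shift 2 A : Univ u"
    using weakening(1)[OF wf assms] by (simp add: shift_def numeral_2_eq_2)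
  show 3: "S \<parallel> [shift 1 A, A] @ \<Gamma> \<turnstile> Id (shift 2 A) (Var 1) (Var 0) : Univ u"
    using id_form[OF 2] var[OF wf, of 0] var[OF wf, of 1] by (simp add: shift_shift numeral_2_eq_2)
  show "S \<parallel> A # \<Gamma> \<turnstile> shift 1 A : Univ u" by (rule 1)
  show "wf_ctx S (path_ctx A @ \<Gamma>)" using ctx_cons[OF 3] by simp
qed

lemma subst_typingD: "S \<parallel> \<Gamma> \<turnstile> t : A \<Longrightarrow> sub_ok S \<sigma> \<Gamma> \<Delta> \<Longrightarrow> S \<parallel> \<Delta> \<turnstile> subst \<sigma> t : subst \<sigma> A"
  using substitution.subst_typing(2) by blast

text \<open>Only the last two variables of the motive are abstracted and removed by beta. The first
  stays an \<open>inst\<close>, to which \<open>inst1_cong\<close> applies in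
  \<open>inst3_type_cong\<close>.\<close>

lemma inst3_beta:
  assumes C: "S \<parallel> path_ctx A @ \<Gamma> \<turnstile> C : Univ w" and A: "S \<parallel> \<Gamma> \<turnstile> A : Univ u"
    and a: "S \<parallel> \<Gamma> \<turnstile> a : A" and b: "S \<parallel> \<Gamma> \<turnstile> b : A" and p: "S \<parallel> \<Gamma> \<turnstile> p : Id A a b"
  shows "S \<parallel> \<Gamma> \<turnstile> App (App (inst 0 [a] (Lam (shift 1 A) (Lam (Id (shift 2 A) (Var 1) (Var 0)) C))) b) p
    \<equiv> inst 0 [p, b, a] C : Univ w"
proof -
  let ?I = "Id (shift 2 A) (Var 1) (Var 0)"
  note wf = typing_wf(2)[OF A]
  have ok1: "sub_ok S (instm 0 [a]) (A # \<Gamma>) \<Gamma>"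
    using sub_ok_Cons[OF sub_ok_Nil[OF wf]] a by simp
  have sA: "subst (instm 0 [a]) (shift 1 A) = A"
    using inst0_shift(1)[of a A] by (simp add: inst_eq)
  have ok2: "sub_ok S (up (instm 0 [a])) (shift 1 A # A # \<Gamma>) (A # \<Gamma>)"
    using substitution.ok_up[OF ok1, of "shift 1 A" u] A unfolding sA by simp
  have body: "S \<parallel> shift 1 A # A # \<Gamma> \<turnstile> Lam ?I C : Pi ?I (Univ w)"
    using lam[OF path_ctx_wf(2)[OF A]] C by simp
  define D where "D = subst (up (instm 0 [a])) (Lam ?I C)"
  have D: "S \<parallel> A # \<Gamma> \<turnstile> D : Pi (subst (up (instm 0 [a])) ?I) (Univ w)"
    using subst_typingD[OF body ok2] unfolding D_def by (simp only: subst.simps)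
  have N: "inst 0 [a] (Lam (shift 1 A) (Lam ?I C)) = Lam A D"
    using sA by (simp add: inst_eq D_def)
  have e1: "inst 0 [b] (subst (up (instm 0 [a])) ?I) = Id A a b"
    by (simp add: inst_eq subst_subst subst_shift numeral_2_eq_2 comp_def)
       (simp add: instm_def shift_as_subst subst_subst comp_def)
  have beta1: "S \<parallel> \<Gamma> \<turnstile> App (Lam A D) b \<equiv> inst 0 [b] D : Pi (Id A a b) (Univ w)"
    using pi_beta[OF A D b] e1 by (simp add: inst_eq)
  define E where "E = subst (up (instm 0 [b])) (subst (up (up (instm 0 [a]))) C)"
  have DE: "inst 0 [b] D = Lam (Id A a b) E"
    using e1 by (simp add: D_def E_def inst_eq)
  have ok3: "sub_ok S (instm 0 [b]) (A # \<Gamma>) \<Gamma>"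
    using sub_ok_Cons[OF sub_ok_Nil[OF wf]] b by simp
  have I1: "S \<parallel> A # \<Gamma> \<turnstile> subst (up (instm 0 [a])) ?I : Univ u"
    using subst_typingD[OF path_ctx_wf(2)[OF A, simplified] ok2[simplified]] by simp
  have I2: "S \<parallel> \<Gamma> \<turnstile> Id A a b : Univ u" by (rule id_form[OF A a b])
  have C1: "S \<parallel> subst (up (instm 0 [a])) ?I # A # \<Gamma> \<turnstile> subst (up (up (instm 0 [a]))) C : Univ w"
    using subst_typingD[OF C[simplified] substitution.ok_up[OF ok2 I1, simplified]] by simp
  have "sub_ok S (up (instm 0 [b])) (subst (up (instm 0 [a])) ?I # A # \<Gamma>) (Id A a b # \<Gamma>)"
    using substitution.ok_up[OF ok3, of "subst (up (instm 0 [a])) ?I" u] I2 e1[unfolded inst_eq] by simp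
  then have E: "S \<parallel> Id A a b # \<Gamma> \<turnstile> E : Univ w"
    using subst_typingD[OF C1] by (simp add: E_def)
  have "S \<parallel> \<Gamma> \<turnstile> App (App (Lam A D) b) p \<equiv> App (Lam (Id A a b) E) p : Univ w"
    using app_cong[OF beta1 jeq_refl[OF p]] DE by simp
  moreover have "S \<parallel> \<Gamma> \<turnstile> App (Lam (Id A a b) E) p \<equiv> inst 0 [p] E : Univ w"
    using pi_beta[OF I2 E p] by simp
  \<comment> \<open>Instantiating successively by \<open>a\<close>, \<open>b\<close>,
    \<open>p\<close> under the remaining binders agrees with the simultaneous instantiation; the
    variables 0, 1, 2 and the later ones are compared separately.\<close>
  moreover have "inst 0 [p] E = inst 0 [p, b, a] C"
    unfolding E_def inst_eq subst_subst
  proof (rule subst_cong)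
    fix n
    show "(subst (instm 0 [p]) \<circ> (subst (up (instm 0 [b])) \<circ> up (up (instm 0 [a])))) n = instm 0 [p, b, a] n"
      by (cases n; cases "n - 1"; cases "n - 2") (simp_all add: instm_def subst_shift)
  qed
  ultimately show ?thesis unfolding N by (metis jeq_trans)
qed

lemma inst3_type_cong:
  assumes C: "S \<parallel> path_ctx A @ \<Gamma> \<turnstile> C : Univ w" and A: "S \<parallel> \<Gamma> \<turnstile> A : Univ u"
    and a: "S \<parallel> \<Gamma> \<turnstile> a : A" "S \<parallel> \<Gamma> \<turnstile> a' : A" "S \<parallel> \<Gamma> \<turnstile> a \<equiv> a' : A"
    and b: "S \<parallel> \<Gamma> \<turnstile> b : A" "S \<parallel> \<Gamma> \<turnstile> b' : A" "S \<parallel> \<Gamma> \<turnstile> b \<equiv> b' : A"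
    and p: "S \<parallel> \<Gamma> \<turnstile> p : Id A a b" "S \<parallel> \<Gamma> \<turnstile> p' : Id A a' b'" "S \<parallel> \<Gamma> \<turnstile> p \<equiv> p' : Id A a b"
  shows "S \<parallel> \<Gamma> \<turnstile> inst 0 [p, b, a] C \<equiv> inst 0 [p', b', a'] C : Univ w"
proof -
  let ?I = "Id (shift 2 A) (Var 1) (Var 0)"
  let ?N = "Lam (shift 1 A) (Lam ?I C)" and ?T = "Pi (shift 1 A) (Pi ?I (Univ w))"
  have "S \<parallel> shift 1 A # A # \<Gamma> \<turnstile> Lam ?I C : Pi ?I (Univ w)"
    using lam[OF path_ctx_wf(2)[OF A]] C by simp
  then have N: "S \<parallel> A # \<Gamma> \<turnstile> ?N : ?T"
    by (rule lam[OF path_ctx_wf(3)[OF A]])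
  have "S \<parallel> shift 1 A # A # \<Gamma> \<turnstile> Pi ?I (Univ w) : Univ (sup u (lsuc w))"
    using pi_form[OF path_ctx_wf(2)[OF A] univ] path_ctx_wf(1)[OF A] by simp
  then have T: "S \<parallel> A # \<Gamma> \<turnstile> ?T : Univ (sup u (sup u (lsuc w)))"
    by (rule pi_form[OF path_ctx_wf(3)[OF A]])
  have e: "inst 0 [a] ?T = Pi A (Pi (Id (shift 1 A) (shift 1 a) (Var 0)) (Univ w))"
    by (simp add: inst_eq subst_shift instm_def shift_as_subst numeral_2_eq_2 subst_subst comp_def)
  have "S \<parallel> \<Gamma> \<turnstile> inst 0 [a] ?N \<equiv> inst 0 [a'] ?N : Pi A (Pi (Id (shift 1 A) (shift 1 a) (Var 0)) (Univ w))"
    using inst1_cong[OF A T N a] unfolding e .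
  from app_cong[OF this b(3)]
  have "S \<parallel> \<Gamma> \<turnstile> App (inst 0 [a] ?N) b \<equiv> App (inst 0 [a'] ?N) b' : Pi (Id A a b) (Univ w)"
    by (simp add: inst_eq subst_shift instm_def)
  from app_cong[OF this p(3)]
  have "S \<parallel> \<Gamma> \<turnstile> App (App (inst 0 [a] ?N) b) p \<equiv> App (App (inst 0 [a'] ?N) b') p' : Univ w"
    by simp
  then show ?thesis
    using inst3_beta[OF C A a(1) b(1) p(1)] inst3_beta[OF C A a(2) b(2) p(2)] by (meson jeq_sym jeq_trans)
qed


section \<open>Soundness of the type checker\<close>

fun lvl :: "'l::universe_level \<Rightarrow> 'l \<Rightarrow> lv \<Rightarrow> 'l" where
  "lvl u v (Lv a b c d e) =
     sup (if a then u else bot) (sup (if b then v else bot) (sup (if c then lsuc u else bot)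
       (sup (if d then lsuc (sup u v) else bot) (if e then lsuc (sup (lsuc u) (lsuc (sup u v))) else bot))))"

lemma lvl_lsup: "lvl u v (lsup l m) = sup (lvl u v l) (lvl u v m)"
  by (cases l; cases m) (auto simp: ac_simps)

lemma lvl_lsucc: "lsucc l = Some m \<Longrightarrow> lvl u v m = lsuc (lvl u v l)"
  by (cases l rule: lsucc.cases) auto

text \<open>Closedness lets the term standing for \<open>G i\<close> pass unchanged through renaming
  and substitution, as \<open>lft\<close> and \<open>ins\<close> presuppose.\<close>

locale erasure =
  fixes S :: "'l::universe_level postulate set" and u v :: 'l and I :: "nat \<Rightarrow> 'l tm"
  assumes closed: "subst \<sigma> (I i) = I i"
begin

primrec er :: "ptm \<Rightarrow> 'l tm" where
  "er (V n) = Var n"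
| "er (G i) = I i"
| "er (U l) = Univ (lvl u v l)"
| "er (PI A B) = Pi (er A) (er B)"
| "er (LAM A b) = Lam (er A) (er b)"
| "er (AP f a) = App (er f) (er a)"
| "er (SG A B) = Sg (er A) (er B)"
| "er (PAIR A B a b) = MkPair (er a) (er b)"
| "er (SPLIT C g p) = SgElim (er C) (er g) (er p)"
| "er (ONE l) = Unit (lvl u v l)"
| "er (STAR l) = Star (lvl u v l)"
| "er (ELIM1 C c t) = UnitElim (er C) (er c) (er t)"
| "er (ID A a b) = Id (er A) (er a) (er b)"
| "er (RFL a) = Refl (er a)"
| "er (JJ C c a b p) = IdElim (er C) (er c) (er a) (er b) (er p)"

lemma up_ren_cutoff: "up_ren (\<lambda>n. if n < d then n else n + k) = (\<lambda>n. if n < Suc d then n else n + k)"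
  by (auto simp: up_ren_def fun_eq_iff split: nat.split)

lemma er_lft: "er (lft d k t) = rename (\<lambda>n. if n < d then n else n + k) (er t)"
  by (induction t arbitrary: d) (simp_all add: up_ren_cutoff rename_as_subst[of _ "I _"] closed)

lemma er_lft0 [simp]: "er (lft 0 k t) = shift k (er t)"
  by (simp add: er_lft shift_def)

lemma er_ins: "er (ins d k ts t) = subst (ups d (instm k (map er ts))) (er t)"
proof (induction t arbitrary: d)
  case (V n)
  show ?case
  proof (cases "n < d")
    case False
    then obtain m where "n = m + d" by (metis add.commute le_Suc_ex not_less)
    then show ?thesis by (auto simp: ups_add instm_def)
  qed (simp add: ups_less)
qed (simp_all add: closed flip: ups.simps)

lemma er_ins0 [simp]: "er (ins 0 k ts t) = inst k (map er ts) (er t)"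
  by (simp add: er_ins inst_eq)

text \<open>
  A normal form that is introduced by \<open>LAM\<close>, \<open>PAIR\<close> or \<open>RFL\<close> comes with the typing of its components
  at the type that was computed with it. Recovering this from the mere typing of the term would
  require injectivity of the type formers up to judgemental equality.
\<close>

definition val :: "'l tm list \<Rightarrow> ptm \<Rightarrow> ptm \<Rightarrow> bool" where
  "val \<Gamma> t T \<longleftrightarrow>
     (\<forall>A b. t = LAM A b \<longrightarrow> (\<exists>B. T = PI A B \<and> S \<parallel> er A # \<Gamma> \<turnstile> er b : er B)) \<and>
     (\<forall>A B a b. t = PAIR A B a b \<longrightarrow>
       T = SG A B \<and> S \<parallel> \<Gamma> \<turnstile> er a : er A \<and> S \<parallel> \<Gamma> \<turnstile> er b : inst 0 [er a] (er B)) \<and>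
     (\<forall>a. t = RFL a \<longrightarrow> (\<exists>A. T = ID A a a \<and> S \<parallel> \<Gamma> \<turnstile> er a : er A))"

text \<open>The typing of both sides and of the type itself is part of the invariant, because an
  equality judgement is not shown to imply it; the cases of \<open>step\<close> consume all of these
  components.\<close>

definition evs :: "'l tm list \<Rightarrow> ptm \<Rightarrow> ptm \<Rightarrow> ptm \<Rightarrow> bool" where
  "evs \<Gamma> t t' T \<longleftrightarrow> S \<parallel> \<Gamma> \<turnstile> er t : er T \<and> S \<parallel> \<Gamma> \<turnstile> er t \<equiv> er t' : er T \<and> S \<parallel> \<Gamma> \<turnstile> er t' : er T \<and>
     (\<exists>l. S \<parallel> \<Gamma> \<turnstile> er T : Univ l) \<and> val \<Gamma> t' T"

definition sound :: "evt \<Rightarrow> bool" where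
  "sound E \<longleftrightarrow> (\<forall>\<Gamma> t t' T. wf_ctx S (map er \<Gamma>) \<longrightarrow> E \<Gamma> t = Some (t', T) \<longrightarrow> evs (map er \<Gamma>) t t' T)"

lemma soundD: "sound E \<Longrightarrow> wf_ctx S (map er \<Gamma>) \<Longrightarrow> E \<Gamma> t = Some (t', T) \<Longrightarrow> evs (map er \<Gamma>) t t' T"
  by (simp add: sound_def)

lemma evsD:
  assumes "evs \<Gamma> t t' T"
  shows "S \<parallel> \<Gamma> \<turnstile> er t : er T" "S \<parallel> \<Gamma> \<turnstile> er t \<equiv> er t' : er T" "S \<parallel> \<Gamma> \<turnstile> er t' : er T"
    "\<exists>l. S \<parallel> \<Gamma> \<turnstile> er T : Univ l" "val \<Gamma> t' T"
  using assms by (simp_all add: evs_def)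

lemma val_neutral [simp]:
  "val \<Gamma> (V n) T" "val \<Gamma> (G n) T" "val \<Gamma> (U l) T" "val \<Gamma> (PI A B) T" "val \<Gamma> (SG A B) T"
  "val \<Gamma> (AP f a) T" "val \<Gamma> (SPLIT C g p) T" "val \<Gamma> (ONE l) T" "val \<Gamma> (STAR l) T"
  "val \<Gamma> (ELIM1 C g p) T" "val \<Gamma> (ID A a b) T" "val \<Gamma> (JJ C c a b p) T"
  by (simp_all add: val_def)

lemma evs_same: "S \<parallel> \<Gamma> \<turnstile> er t : er T \<Longrightarrow> S \<parallel> \<Gamma> \<turnstile> er T : Univ l \<Longrightarrow> val \<Gamma> t T \<Longrightarrow> evs \<Gamma> t t T"
  by (auto simp: evs_def intro: jeq_refl)

lemma evs_red:
  "S \<parallel> \<Gamma> \<turnstile> er t : er T \<Longrightarrow> S \<parallel> \<Gamma> \<turnstile> er t \<equiv> er r : er T \<Longrightarrow> evs \<Gamma> r t' T \<Longrightarrow> evs \<Gamma> t t' T"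
  by (auto simp: evs_def intro: jeq_trans)

lemma on_simps:
  "on2 m f = Some r \<longleftrightarrow> (\<exists>t T. m = Some (t, T) \<and> f t T = Some r)"
  "onU m f' = Some r \<longleftrightarrow> (\<exists>t l. m = Some (t, U l) \<and> f' t l = Some r)"
  "onPI m g = Some r \<longleftrightarrow> (\<exists>t A B. m = Some (t, PI A B) \<and> g t A B = Some r)"
  "onSG m g = Some r \<longleftrightarrow> (\<exists>t A B. m = Some (t, SG A B) \<and> g t A B = Some r)"
  "onONE m f' = Some r \<longleftrightarrow> (\<exists>t l. m = Some (t, ONE l) \<and> f' t l = Some r)"
  "onID m h = Some r \<longleftrightarrow> (\<exists>t A a b. m = Some (t, ID A a b) \<and> h t A a b = Some r)"
  "onT t k = Some r \<longleftrightarrow> (\<exists>x. t = Some x \<and> k x = Some r)"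
  "onL l k' = Some r \<longleftrightarrow> (\<exists>x. l = Some x \<and> k' x = Some r)"
         apply (cases "(m, f)" rule: on2.cases; simp)
        apply (cases "(m, f')" rule: onU.cases; simp)
       apply (cases "(m, g)" rule: onPI.cases; simp)
      apply (cases "(m, g)" rule: onSG.cases; simp)
     apply (cases "(m, f')" rule: onONE.cases; simp)
    apply (cases "(m, h)" rule: onID.cases; simp)
   apply (cases t; simp)
  apply (cases l; simp)
  done

text \<open>The level is existential because evaluation infers a universe of its own, and nothing
  ties it to \<open>l\<close>.\<close>

lemma nrm_sound:
  assumes "sound E" "wf_ctx S (map er \<Gamma>)" "nrm E \<Gamma> T = Some T'" "S \<parallel> map er \<Gamma> \<turnstile> er T : Univ l"
  shows "\<exists>m. S \<parallel> map er \<Gamma> \<turnstile> er T \<equiv> er T' : Univ m \<and> S \<parallel> map er \<Gamma> \<turnstile> er T' : Univ m"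
proof (cases "normal T")
  case True
  then show ?thesis using assms(3,4) by (auto simp: nrm_def intro: jeq_refl)
next
  case False
  then obtain m where "E \<Gamma> T = Some (T', U m)"
    using assms(3) by (auto simp: nrm_def on_simps)
  from evsD[OF soundD[OF assms(1,2) this]] show ?thesis by auto
qed

lemma ev_at_sound:
  assumes "sound E" "wf_ctx S (map er \<Gamma>)" "ev_at E \<Gamma> t T = Some (t', T')"
  shows "T' = T \<and> evs (map er \<Gamma>) t t' T"
  using assms(3) soundD[OF assms(1,2)] by (auto simp: ev_at_def on_simps split: if_splits)

lemma shift_Univ [simp]: "shift k (Univ l) = Univ l"
  by (simp add: shift_def)

context
  fixes E gl
  assumes E: "sound E"
    and gl: "\<And>i T. gl i = Some T \<Longrightarrow> S \<parallel> [] \<turnstile> I i : er T \<and> (\<exists>l. S \<parallel> [] \<turnstile> er T : Univ l)"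
begin

lemma step_V: "wf_ctx S (map er \<Gamma>) \<Longrightarrow> step E gl \<Gamma> (V n) = Some (t', T) \<Longrightarrow> evs (map er \<Gamma>) (V n) t' T"
proof -
  assume wf: "wf_ctx S (map er \<Gamma>)" and s: "step E gl \<Gamma> (V n) = Some (t', T)"
  then have n: "n < length \<Gamma>" and eq: "t' = V n" "T = lft 0 (Suc n) (\<Gamma> ! n)"
    by (auto split: if_splits)
  \<comment> \<open>The invariant also asks for the typing of the variable's type. It is found in
    the part of the context below the variable and weakened back.\<close>
  have split: "map er \<Gamma> = map er (take (Suc n) \<Gamma>) @ map er (drop (Suc n) \<Gamma>)"
    by (simp flip: map_append)
  have wf': "wf_ctx S (\<Delta> @ \<Gamma>') \<Longrightarrow> wf_ctx S \<Gamma>'" for \<Delta> \<Gamma>'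
    by (induction \<Delta>) (auto dest: typing_wf(1))
  have "wf_ctx S (map er (drop n \<Gamma>))"
    using wf wf'[of "map er (take n \<Gamma>)" "map er (drop n \<Gamma>)"] by (simp flip: map_append)
  then have "wf_ctx S (er (\<Gamma> ! n) # map er (drop (Suc n) \<Gamma>))"
    using n by (simp flip: Cons_nth_drop_Suc)
  then obtain l where "S \<parallel> map er (drop (Suc n) \<Gamma>) \<turnstile> er (\<Gamma> ! n) : Univ l"
    using wf_ctx_consD by blast
  from weakening(1)[of S "map er (take (Suc n) \<Gamma>)", OF _ this] wf n
  have "S \<parallel> map er \<Gamma> \<turnstile> er T : Univ l"
    unfolding eq split[symmetric] by (simp add: min_absorb2)
  moreover have "S \<parallel> map er \<Gamma> \<turnstile> er (V n) : er T"
    using var[OF wf, of n] n eq by simp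
  ultimately show ?thesis unfolding eq(1) by (intro evs_same) simp_all
qed

lemma step_G: "wf_ctx S (map er \<Gamma>) \<Longrightarrow> step E gl \<Gamma> (G i) = Some (t', T) \<Longrightarrow> evs (map er \<Gamma>) (G i) t' T"
proof -
  assume wf: "wf_ctx S (map er \<Gamma>)" and s: "step E gl \<Gamma> (G i) = Some (t', T)"
  then obtain l where "t' = G i" "S \<parallel> [] \<turnstile> I i : er T" "S \<parallel> [] \<turnstile> er T : Univ l"
    using gl by (auto simp: on_simps)
  then show ?thesis
    using weakening_closed[OF wf] evs_same[of "map er \<Gamma>" "G i" T]
      weakening_closed[OF wf, of "er T" "Univ l"] univ[of S "[]"] ctx_nil by fastforce
qed

lemma step_U: "wf_ctx S (map er \<Gamma>) \<Longrightarrow> step E gl \<Gamma> (U l) = Some (t', T) \<Longrightarrow> evs (map er \<Gamma>) (U l) t' T"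
  by (auto simp: on_simps lvl_lsucc intro!: evs_same univ)

text \<open>The body is evaluated under the normalised domain \<open>A'\<close>, while the rules for
  the original term need it under \<open>A\<close>; \<open>ctx_conv\<close> moves between the
  two.\<close>

lemma binder_sound:
  assumes wf: "wf_ctx S (map er \<Gamma>)" and A: "E \<Gamma> A = Some (A', U l)" and b: "E (A' # \<Gamma>) b = Some (b', B)"
  shows "evs (map er \<Gamma>) A A' (U l)" "evs (er A' # map er \<Gamma>) b b' B"
    "S \<parallel> er A # map er \<Gamma> \<turnstile> er b : er B" "S \<parallel> er A # map er \<Gamma> \<turnstile> er b \<equiv> er b' : er B"
    "S \<parallel> er A # map er \<Gamma> \<turnstile> er b' : er B" "\<exists>m. S \<parallel> er A # map er \<Gamma> \<turnstile> er B : Univ m"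
proof -
  show A': "evs (map er \<Gamma>) A A' (U l)" by (rule soundD[OF E wf A])
  note AD = evsD[OF this, simplified]
  show b': "evs (er A' # map er \<Gamma>) b b' B"
    using soundD[OF E _ b] ctx_cons[OF AD(3)] by simp
  note bD = evsD[OF this]
  show "S \<parallel> er A # map er \<Gamma> \<turnstile> er b : er B" "S \<parallel> er A # map er \<Gamma> \<turnstile> er b \<equiv> er b' : er B"
    "S \<parallel> er A # map er \<Gamma> \<turnstile> er b' : er B" "\<exists>m. S \<parallel> er A # map er \<Gamma> \<turnstile> er B : Univ m"
    using ctx_conv[OF AD(1,2)] bD by blast+
qed

lemma step_PI: "wf_ctx S (map er \<Gamma>) \<Longrightarrow> step E gl \<Gamma> (PI A B) = Some (t', T) \<Longrightarrow> evs (map er \<Gamma>) (PI A B) t' T"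
proof -
  assume wf: "wf_ctx S (map er \<Gamma>)" and s: "step E gl \<Gamma> (PI A B) = Some (t', T)"
  then obtain A' B' l m where A: "E \<Gamma> A = Some (A', U l)" and B: "E (A' # \<Gamma>) B = Some (B', U m)"
    and eq: "t' = PI A' B'" "T = U (lsup l m)"
    by (auto simp: on_simps)
  note b = binder_sound[OF wf A B]
  note AD = evsD[OF b(1), simplified] and BD = evsD[OF b(2), simplified]
  show ?thesis unfolding eq evs_def er.simps lvl_lsup
    using pi_form[OF AD(1)] pi_cong[OF AD(2,1)] pi_form[OF AD(3) BD(3)] b univ[OF wf, of "sup (lvl u v l) (lvl u v m)"] by auto
qed

lemma step_SG: "wf_ctx S (map er \<Gamma>) \<Longrightarrow> step E gl \<Gamma> (SG A B) = Some (t', T) \<Longrightarrow> evs (map er \<Gamma>) (SG A B) t' T"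
proof -
  assume wf: "wf_ctx S (map er \<Gamma>)" and s: "step E gl \<Gamma> (SG A B) = Some (t', T)"
  then obtain A' B' l m where A: "E \<Gamma> A = Some (A', U l)" and B: "E (A' # \<Gamma>) B = Some (B', U m)"
    and eq: "t' = SG A' B'" "T = U (lsup l m)"
    by (auto simp: on_simps)
  note b = binder_sound[OF wf A B]
  note AD = evsD[OF b(1), simplified] and BD = evsD[OF b(2), simplified]
  show ?thesis unfolding eq evs_def er.simps lvl_lsup
    using sg_form[OF AD(1)] sg_cong[OF AD(2,1)] sg_form[OF AD(3) BD(3)] b univ[OF wf, of "sup (lvl u v l) (lvl u v m)"] by auto
qed

lemma is_ap0_eq: "is_ap0 b \<Longrightarrow> b = AP (ap_fun b) (V 0)"
  by (cases b rule: is_ap0.cases) auto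

lemma step_LAM: "wf_ctx S (map er \<Gamma>) \<Longrightarrow> step E gl \<Gamma> (LAM A b) = Some (t', T) \<Longrightarrow> evs (map er \<Gamma>) (LAM A b) t' T"
proof -
  assume wf: "wf_ctx S (map er \<Gamma>)" and s: "step E gl \<Gamma> (LAM A b) = Some (t', T)"
  then obtain A' b' B l where A: "E \<Gamma> A = Some (A', U l)" and b0: "E (A' # \<Gamma>) b = Some (b', B)"
    and r: "(if is_ap0 b' \<and> lft 0 (Suc 0) (ins 0 0 [A'] (ap_fun b')) = ap_fun b'
     then ev_at E \<Gamma> (ins 0 0 [A'] (ap_fun b')) (PI A' B)
     else Some (LAM A' b', PI A' B)) = Some (t', T)"
    by (auto simp: on_simps)
  note b = binder_sound[OF wf A b0]
  note AD = evsD[OF b(1), simplified] and BD = evsD[OF b(2), simplified]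
  obtain m where m: "S \<parallel> er A # map er \<Gamma> \<turnstile> er B : Univ m" using b(6) by blast
  obtain m' where m': "S \<parallel> er A' # map er \<Gamma> \<turnstile> er B : Univ m'" using BD(4) by blast
  have T: "S \<parallel> map er \<Gamma> \<turnstile> Pi (er A) (er B) \<equiv> Pi (er A') (er B) : Univ (sup (lvl u v l) m)"
    by (rule pi_cong[OF AD(2,1) jeq_refl[OF m]])
  have T': "S \<parallel> map er \<Gamma> \<turnstile> er (PI A' B) : Univ (sup (lvl u v l) m')"
    using pi_form[OF AD(3) m'] by simp
  have 1: "S \<parallel> map er \<Gamma> \<turnstile> er (LAM A b) : er (PI A' B)"
    using conv[OF lam[OF AD(1) b(3)] T] by simp
  have 2: "S \<parallel> map er \<Gamma> \<turnstile> er (LAM A b) \<equiv> er (LAM A' b') : er (PI A' B)"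
    using jeq_conv[OF lam_cong[OF AD(2,1) b(4)] T] by simp
  have 3: "S \<parallel> map er \<Gamma> \<turnstile> er (LAM A' b') : er (PI A' B)"
    using lam[OF AD(3) BD(3)] by simp
  show ?thesis
  proof (cases "is_ap0 b' \<and> lft 0 (Suc 0) (ins 0 0 [A'] (ap_fun b')) = ap_fun b'")
    case True
    \<comment> \<open>Evaluating the contracted function in the smaller context provides its typing
      there, in place of a strengthening lemma; \<open>pi_eta\<close> then relates it to the
      abstraction.\<close>
    let ?f = "ins 0 0 [A'] (ap_fun b')"
    from True r have f: "T = PI A' B" "evs (map er \<Gamma>) ?f t' (PI A' B)"
      using ev_at_sound[OF E wf] by auto
    have "b' = AP (lft 0 (Suc 0) ?f) (V 0)" using True is_ap0_eq by metis
    then have "er b' = App (shift 1 (er ?f)) (Var 0)"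
      by (metis One_nat_def er.simps(1,6) er_lft0)
    then have "S \<parallel> map er \<Gamma> \<turnstile> er ?f \<equiv> er (LAM A' b') : er (PI A' B)"
      using pi_eta[of S "map er \<Gamma>" "er ?f" "er A'" "er B"] evsD(1)[OF f(2)] by (simp del: er_ins0)
    then have "S \<parallel> map er \<Gamma> \<turnstile> er (LAM A b) \<equiv> er ?f : er (PI A' B)"
      using 2 jeq_sym jeq_trans by blast
    then show ?thesis unfolding f(1) by (rule evs_red[OF 1 _ f(2)])
  next
    case False
    then have "t' = LAM A' b'" "T = PI A' B" using r by auto
    then show ?thesis using 1 2 3 T' BD(3) by (auto simp: evs_def val_def)
  qed
qed

lemma step_AP: "wf_ctx S (map er \<Gamma>) \<Longrightarrow> step E gl \<Gamma> (AP f a) = Some (t', T) \<Longrightarrow> evs (map er \<Gamma>) (AP f a) t' T"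
proof -
  assume wf: "wf_ctx S (map er \<Gamma>)" and s: "step E gl \<Gamma> (AP f a) = Some (t', T)"
  then obtain f' A B a' T0 where f: "E \<Gamma> f = Some (f', PI A B)" and a: "E \<Gamma> a = Some (a', A)"
    and n: "nrm E \<Gamma> (ins 0 0 [a'] B) = Some T0"
    and r: "(if is_lam f' then ev_at E \<Gamma> (ins 0 0 [a'] (lam_body f')) T0 else Some (AP f' a', T0)) = Some (t', T)"
    by (auto simp: on_simps split: if_splits)
  let ?G = "map er \<Gamma>"
  note fD = evsD[OF soundD[OF E wf f], simplified] and aD = evsD[OF soundD[OF E wf a]]
  obtain k l where A: "S \<parallel> ?G \<turnstile> er A : Univ k" and B: "S \<parallel> er A # ?G \<turnstile> er B : Univ l"
    using fD(4) Pi_inversion by blast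
  have "S \<parallel> ?G \<turnstile> er (ins 0 0 [a'] B) : Univ l"
    using inst1_typing(1)[OF aD(3) B] by simp
  from nrm_sound[OF E wf n this] obtain m where
    T0: "S \<parallel> ?G \<turnstile> inst 0 [er a'] (er B) \<equiv> er T0 : Univ m" "S \<parallel> ?G \<turnstile> er T0 : Univ m" by auto
  have BB: "S \<parallel> ?G \<turnstile> inst 0 [er a] (er B) \<equiv> inst 0 [er a'] (er B) : Univ l"
    by (rule inst1_type_cong[OF A B aD(1,3,2)])
  have 1: "S \<parallel> ?G \<turnstile> er (AP f a) : er T0"
    using conv[OF conv[OF app[OF fD(1) aD(1)] BB] T0(1)] by simp
  have 2: "S \<parallel> ?G \<turnstile> er (AP f a) \<equiv> er (AP f' a') : er T0"
    using jeq_conv[OF jeq_conv[OF app_cong[OF fD(2) aD(2)] BB] T0(1)] by simp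
  have 3: "S \<parallel> ?G \<turnstile> er (AP f' a') : er T0"
    using conv[OF app[OF fD(3) aD(3)] T0(1)] by simp
  show ?thesis
  proof (cases "is_lam f'")
    case True
    then obtain A1 b where f': "f' = LAM A1 b" by (cases f') auto
    then have b: "A1 = A" "S \<parallel> er A # ?G \<turnstile> er b : er B" using fD(5) by (auto simp: val_def)
    have red: "T = T0" "evs ?G (ins 0 0 [a'] b) t' T0"
      using r True f' ev_at_sound[OF E wf] by auto
    have "S \<parallel> ?G \<turnstile> er (AP f' a') \<equiv> er (ins 0 0 [a'] b) : er T0"
      using jeq_conv[OF pi_beta[OF A b(2) aD(3)] T0(1)] f' b(1) by simp
    then show ?thesis unfolding red(1) by (intro evs_red[OF 1 jeq_trans[OF 2] red(2)])
  next
    case False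
    then show ?thesis using r 1 2 3 T0(2) by (auto simp: evs_def)
  qed
qed

lemma step_PAIR: "wf_ctx S (map er \<Gamma>) \<Longrightarrow> step E gl \<Gamma> (PAIR A B a b) = Some (t', T) \<Longrightarrow>
  evs (map er \<Gamma>) (PAIR A B a b) t' T"
proof -
  assume wf: "wf_ctx S (map er \<Gamma>)" and s: "step E gl \<Gamma> (PAIR A B a b) = Some (t', T)"
  then obtain A' l B' m a' b' Ba where A: "E \<Gamma> A = Some (A', U l)" and B: "E (A' # \<Gamma>) B = Some (B', U m)"
    and a: "E \<Gamma> a = Some (a', A')" and n: "nrm E \<Gamma> (ins 0 0 [a'] B') = Some Ba" and b: "E \<Gamma> b = Some (b', Ba)"
    and eq: "t' = PAIR A' B' a' b'" "T = SG A' B'"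
    by (auto simp: on_simps split: if_splits)
  let ?G = "map er \<Gamma>"
  note AB = binder_sound[OF wf A B]
  note AD = evsD[OF AB(1), simplified] and BD = evsD[OF AB(2), simplified]
  note aD = evsD[OF soundD[OF E wf a]] and bD = evsD[OF soundD[OF E wf b]]
  have "S \<parallel> ?G \<turnstile> er (ins 0 0 [a'] B') : Univ (lvl u v m)"
    using inst1_typing(1)[OF aD(3) BD(3)] by simp
  from nrm_sound[OF E wf n this] obtain k where
    Ba: "S \<parallel> ?G \<turnstile> inst 0 [er a'] (er B') \<equiv> er Ba : Univ k" by auto
  have BB: "S \<parallel> ?G \<turnstile> inst 0 [er a] (er B') \<equiv> inst 0 [er a'] (er B') : Univ (lvl u v m)"
    by (rule inst1_type_cong[OF AD(3) BD(3) aD(1,3,2)])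
  note Ba' = jeq_sym[OF Ba] and BB' = jeq_sym[OF BB]
  have 1: "S \<parallel> ?G \<turnstile> er (PAIR A B a b) : er (SG A' B')"
    using pair[OF BD(3) aD(1) conv[OF conv[OF bD(1) Ba'] BB']] by simp
  have 2: "S \<parallel> ?G \<turnstile> er (PAIR A B a b) \<equiv> er t' : er (SG A' B')"
    using pair_cong[OF BD(3) aD(2) jeq_conv[OF jeq_conv[OF bD(2) Ba'] BB']] eq by simp
  have 3: "S \<parallel> ?G \<turnstile> er t' : er (SG A' B')"
    using pair[OF BD(3) aD(3) conv[OF bD(3) Ba']] eq by simp
  show ?thesis
    using 1 2 3 sg_form[OF AD(3) BD(3)] aD(3) conv[OF bD(3) Ba'] unfolding eq evs_def val_def by auto
qed

lemma step_SPLIT: "wf_ctx S (map er \<Gamma>) \<Longrightarrow> step E gl \<Gamma> (SPLIT C g p) = Some (t', T) \<Longrightarrow>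
  evs (map er \<Gamma>) (SPLIT C g p) t' T"
proof -
  assume wf: "wf_ctx S (map er \<Gamma>)" and s: "step E gl \<Gamma> (SPLIT C g p) = Some (t', T)"
  then obtain p' A B C' l Tg g' T0 where p: "E \<Gamma> p = Some (p', SG A B)"
    and C: "E (SG A B # \<Gamma>) C = Some (C', U l)"
    and n: "nrm E (B # A # \<Gamma>) (ins 0 2 [PAIR (lft 0 2 A) (lft (Suc 0) 2 B) (V (Suc 0)) (V 0)] C') = Some Tg"
    and g: "E (B # A # \<Gamma>) g = Some (g', Tg)" and n0: "nrm E \<Gamma> (ins 0 0 [p'] C') = Some T0"
    and r: "(if is_pair p' then ev_at E \<Gamma> (ins 0 0 [pair_2 p', pair_1 p'] g') T0
      else Some (SPLIT C' g' p', T0)) = Some (t', T)"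
    by (auto simp: on_simps split: if_splits)
  let ?G = "map er \<Gamma>"
  note pD = evsD[OF soundD[OF E wf p], simplified]
  obtain k where SG: "S \<parallel> ?G \<turnstile> Sg (er A) (er B) : Univ k" using pD(4) by blast
  obtain ka kb where A: "S \<parallel> ?G \<turnstile> er A : Univ ka" and B: "S \<parallel> er A # ?G \<turnstile> er B : Univ kb"
    using Sg_inversion[OF SG] by blast
  have wf1: "wf_ctx S (map er (SG A B # \<Gamma>))" using ctx_cons[OF SG] by simp
  have wf2: "wf_ctx S (map er (B # A # \<Gamma>))" using ctx_cons[OF B] by simp
  note CD = evsD[OF soundD[OF E wf1 C], simplified] and gD = evsD[OF soundD[OF E wf2 g], simplified]
  let ?D = "[er B, er A] @ ?G"
  have wfD: "wf_ctx S ?D" using wf2 by simp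
  define B2 where "B2 = rename (up_ren (\<lambda>n. n + 2)) (er B)"
  have SG2: "shift 2 (Sg (er A) (er B)) = Sg (shift 2 (er A)) B2"
    by (simp add: shift_def B2_def)
  \<comment> \<open>Inverting the weakened sum type yields the family \<open>B2\<close> over which
    the generic pair of the two newest variables is formed.\<close>
  have "S \<parallel> ?D \<turnstile> Sg (shift 2 (er A)) B2 : Univ k"
    using weakening(1)[OF wfD SG] SG2 by (simp add: shift_def numeral_2_eq_2)
  then obtain kc where B2: "S \<parallel> shift 2 (er A) # ?D \<turnstile> B2 : Univ kc" using Sg_inversion by blast
  \<comment> \<open>\<open>Var 0\<close> has the type on the right; the pairing rule asks for it in
    the form on the left.\<close>
  have "inst 0 [Var (Suc 0)] B2 = shift (Suc 0) (er B)"
    unfolding B2_def inst_eq subst_rename shift_as_subst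
    by (rule subst_cong) (simp add: instm_def up_ren_def split: nat.split)
  then have "S \<parallel> ?D \<turnstile> MkPair (Var (Suc 0)) (Var 0) : inst 2 [] (Sg (er A) (er B))"
    using pair[OF B2, of "Var (Suc 0)" "Var 0"] var[OF wfD, of 0] var[OF wfD, of 1] SG2
    by (simp add: numeral_2_eq_2)
  then have ok: "sub_ok S (instm 2 [MkPair (Var 1) (Var 0)]) (Sg (er A) (er B) # ?G) ?D"
    using sub_ok_Cons[OF sub_ok_shift[OF wfD, of 2]] by simp
  have "S \<parallel> map er (B # A # \<Gamma>) \<turnstile>
      er (ins 0 2 [PAIR (lft 0 2 A) (lft (Suc 0) 2 B) (V (Suc 0)) (V 0)] C') : Univ (lvl u v l)"
    using inst_typing(1)[OF ok CD(3)] by simp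
  from nrm_sound[OF E wf2 n this] obtain mg where
    "S \<parallel> er B # er A # ?G \<turnstile> inst 2 [MkPair (Var 1) (Var 0)] (er C') \<equiv> er Tg : Univ mg" by auto
  note Tg' = jeq_sym[OF this]
  have Tg: "S \<parallel> er B # er A # ?G \<turnstile> inst 2 [MkPair (Var 1) (Var 0)] (er C') \<equiv>
      inst 2 [MkPair (Var 1) (Var 0)] (er C) : Univ (lvl u v l)"
    using jeq_sym[OF inst_typing(2)[OF ok CD(2)]] by simp
  have g1: "S \<parallel> er B # er A # ?G \<turnstile> er g : inst 2 [MkPair (Var 1) (Var 0)] (er C)"
    by (rule conv[OF conv[OF gD(1) Tg'] Tg])
  have g2: "S \<parallel> er B # er A # ?G \<turnstile> er g \<equiv> er g' : inst 2 [MkPair (Var 1) (Var 0)] (er C)"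
    by (rule jeq_conv[OF jeq_conv[OF gD(2) Tg'] Tg])
  have g3: "S \<parallel> er B # er A # ?G \<turnstile> er g' : inst 2 [MkPair (Var 1) (Var 0)] (er C')"
    by (rule conv[OF gD(3) Tg'])
  have "S \<parallel> ?G \<turnstile> er (ins 0 0 [p'] C') : Univ (lvl u v l)"
    using inst1_typing(1)[OF pD(3) CD(3)] by simp
  from nrm_sound[OF E wf n0 this] obtain m where
    T0: "S \<parallel> ?G \<turnstile> inst 0 [er p'] (er C') \<equiv> er T0 : Univ m" "S \<parallel> ?G \<turnstile> er T0 : Univ m" by auto
  have CC: "S \<parallel> ?G \<turnstile> inst 0 [er p] (er C) \<equiv> inst 0 [er p'] (er C') : Univ (lvl u v l)"
    using inst1_typing(2)[OF pD(1) CD(2)] inst1_type_cong[OF SG CD(3) pD(1,3,2)]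
    by (auto intro: jeq_trans)
  have 1: "S \<parallel> ?G \<turnstile> er (SPLIT C g p) : er T0"
    using conv[OF conv[OF sg_elim[OF CD(1) g1 pD(1)] CC] T0(1)] by simp
  have 2: "S \<parallel> ?G \<turnstile> er (SPLIT C g p) \<equiv> er (SPLIT C' g' p') : er T0"
    using jeq_conv[OF jeq_conv[OF sg_elim_cong[OF CD(1,2) g2 pD(2)] CC] T0(1)] by simp
  have 3: "S \<parallel> ?G \<turnstile> er (SPLIT C' g' p') : er T0"
    using conv[OF sg_elim[OF CD(3) g3 pD(3)] T0(1)] by simp
  show ?thesis
  proof (cases "is_pair p'")
    case True
    then obtain A1 B1 a b where p': "p' = PAIR A1 B1 a b" by (cases p') auto
    then have ab: "S \<parallel> ?G \<turnstile> er a : er A" "S \<parallel> ?G \<turnstile> er b : inst 0 [er a] (er B)"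
      using pD(5) by (auto simp: val_def)
    have red: "T = T0" "evs ?G (ins 0 0 [b, a] g') t' T0"
      using r True p' ev_at_sound[OF E wf] by auto
    have "S \<parallel> ?G \<turnstile> er (SPLIT C' g' p') \<equiv> er (ins 0 0 [b, a] g') : er T0"
      using jeq_conv[OF sg_beta[OF CD(3) g3 ab]] T0(1) p' by auto
    then show ?thesis unfolding red(1) by (intro evs_red[OF 1 jeq_trans[OF 2] red(2)])
  next
    case False
    then show ?thesis using r 1 2 3 T0(2) by (auto simp: evs_def)
  qed
qed

lemma step_ONE: "wf_ctx S (map er \<Gamma>) \<Longrightarrow> step E gl \<Gamma> (ONE l) = Some (t', T) \<Longrightarrow> evs (map er \<Gamma>) (ONE l) t' T"
  by (auto intro!: evs_same unit_form univ)

lemma step_STAR: "wf_ctx S (map er \<Gamma>) \<Longrightarrow> step E gl \<Gamma> (STAR l) = Some (t', T) \<Longrightarrow> evs (map er \<Gamma>) (STAR l) t' T"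
  by (auto intro!: evs_same star unit_form)

lemma step_ELIM1: "wf_ctx S (map er \<Gamma>) \<Longrightarrow> step E gl \<Gamma> (ELIM1 C c t) = Some (t', T) \<Longrightarrow>
  evs (map er \<Gamma>) (ELIM1 C c t) t' T"
proof -
  assume wf: "wf_ctx S (map er \<Gamma>)" and s: "step E gl \<Gamma> (ELIM1 C c t) = Some (t', T)"
  then obtain t1 l C' m Tc c' where t: "E \<Gamma> t = Some (t1, ONE l)" and C: "E (ONE l # \<Gamma>) C = Some (C', U m)"
    and n: "nrm E \<Gamma> (ins 0 0 [STAR l] C') = Some Tc" and c: "E \<Gamma> c = Some (c', Tc)"
    and n0: "nrm E \<Gamma> (ins 0 0 [t1] C') = Some T" and eq: "t' = ELIM1 C' c' t1"
    by (auto simp: on_simps split: if_splits)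
  let ?G = "map er \<Gamma>" and ?l = "lvl u v l"
  note tD = evsD[OF soundD[OF E wf t], simplified] and cD = evsD[OF soundD[OF E wf c]]
  have one: "S \<parallel> ?G \<turnstile> Unit ?l : Univ ?l" and st: "S \<parallel> ?G \<turnstile> Star ?l : Unit ?l"
    using wf by (auto intro: unit_form star)
  have wf1: "wf_ctx S (map er (ONE l # \<Gamma>))" using ctx_cons[OF one] by simp
  note CD = evsD[OF soundD[OF E wf1 C], simplified]
  have "S \<parallel> ?G \<turnstile> er (ins 0 0 [STAR l] C') : Univ (lvl u v m)"
    using inst1_typing(1)[OF st CD(3)] by simp
  from nrm_sound[OF E wf n this] obtain k where
    "S \<parallel> ?G \<turnstile> inst 0 [Star ?l] (er C') \<equiv> er Tc : Univ k" by auto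
  note Tc' = jeq_sym[OF this]
  have Tc: "S \<parallel> ?G \<turnstile> inst 0 [Star ?l] (er C') \<equiv> inst 0 [Star ?l] (er C) : Univ (lvl u v m)"
    using jeq_sym[OF inst1_typing(2)[OF st CD(2)]] by simp
  have "S \<parallel> ?G \<turnstile> er (ins 0 0 [t1] C') : Univ (lvl u v m)"
    using inst1_typing(1)[OF tD(3) CD(3)] by simp
  from nrm_sound[OF E wf n0 this] obtain k where
    T0: "S \<parallel> ?G \<turnstile> inst 0 [er t1] (er C') \<equiv> er T : Univ k" "S \<parallel> ?G \<turnstile> er T : Univ k" by auto
  have CC: "S \<parallel> ?G \<turnstile> inst 0 [er t] (er C) \<equiv> inst 0 [er t1] (er C') : Univ (lvl u v m)"
    using inst1_typing(2)[OF tD(1) CD(2)] inst1_type_cong[OF one CD(3) tD(1,3,2)]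
    by (auto intro: jeq_trans)
  have "S \<parallel> ?G \<turnstile> er (ELIM1 C c t) : er T"
    using conv[OF conv[OF unit_elim[OF CD(1) conv[OF conv[OF cD(1) Tc'] Tc] tD(1)] CC] T0(1)] by simp
  moreover have "S \<parallel> ?G \<turnstile> er (ELIM1 C c t) \<equiv> er (ELIM1 C' c' t1) : er T"
    using jeq_conv[OF jeq_conv[OF unit_elim_cong[OF CD(1,2) jeq_conv[OF jeq_conv[OF cD(2) Tc'] Tc] tD(2)] CC] T0(1)]
    by simp
  moreover have "S \<parallel> ?G \<turnstile> er (ELIM1 C' c' t1) : er T"
    using conv[OF unit_elim[OF CD(3) conv[OF cD(3) Tc'] tD(3)] T0(1)] by simp
  ultimately show ?thesis using T0(2) unfolding eq by (auto simp: evs_def)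
qed

lemma step_ID: "wf_ctx S (map er \<Gamma>) \<Longrightarrow> step E gl \<Gamma> (ID A a b) = Some (t', T) \<Longrightarrow> evs (map er \<Gamma>) (ID A a b) t' T"
proof -
  assume wf: "wf_ctx S (map er \<Gamma>)" and s: "step E gl \<Gamma> (ID A a b) = Some (t', T)"
  then obtain A' l a' b' where A: "E \<Gamma> A = Some (A', U l)" and a: "E \<Gamma> a = Some (a', A')"
    and b: "E \<Gamma> b = Some (b', A')" and eq: "t' = ID A' a' b'" "T = U l"
    by (auto simp: on_simps split: if_splits)
  note AD = evsD[OF soundD[OF E wf A], simplified]
    and aD = evsD[OF soundD[OF E wf a]] and bD = evsD[OF soundD[OF E wf b]]
  note AA = jeq_sym[OF AD(2)]
  have "S \<parallel> map er \<Gamma> \<turnstile> Id (er A) (er a) (er b) : Univ (lvl u v l)"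
    by (rule id_form[OF AD(1) conv[OF aD(1) AA] conv[OF bD(1) AA]])
  moreover have "S \<parallel> map er \<Gamma> \<turnstile> Id (er A) (er a) (er b) \<equiv> Id (er A') (er a') (er b') : Univ (lvl u v l)"
    by (rule id_cong[OF AD(2) jeq_conv[OF aD(2) AA] jeq_conv[OF bD(2) AA]])
  ultimately show ?thesis using id_form[OF AD(3) aD(3) bD(3)] univ[OF wf] unfolding eq evs_def by auto
qed

lemma step_RFL: "wf_ctx S (map er \<Gamma>) \<Longrightarrow> step E gl \<Gamma> (RFL a) = Some (t', T) \<Longrightarrow> evs (map er \<Gamma>) (RFL a) t' T"
proof -
  assume wf: "wf_ctx S (map er \<Gamma>)" and s: "step E gl \<Gamma> (RFL a) = Some (t', T)"
  then obtain a' A where a: "E \<Gamma> a = Some (a', A)" and eq: "t' = RFL a'" "T = ID A a' a'"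
    by (auto simp: on_simps)
  note aD = evsD[OF soundD[OF E wf a]]
  obtain l where A: "S \<parallel> map er \<Gamma> \<turnstile> er A : Univ l" using aD(4) by blast
  have T: "S \<parallel> map er \<Gamma> \<turnstile> Id (er A) (er a) (er a) \<equiv> er T : Univ l"
    using id_cong[OF jeq_refl[OF A] aD(2,2)] eq by simp
  have "S \<parallel> map er \<Gamma> \<turnstile> er (RFL a) : er T"
    using conv[OF refl[OF A aD(1)] T] by simp
  moreover have "S \<parallel> map er \<Gamma> \<turnstile> er (RFL a) \<equiv> er (RFL a') : er T"
    using jeq_conv[OF refl_cong[OF A aD(2)] T] by simp
  ultimately show ?thesis
    using refl[OF A aD(3)] id_form[OF A aD(3,3)] aD(3) unfolding eq evs_def val_def by auto
qed

lemma step_JJ: "wf_ctx S (map er \<Gamma>) \<Longrightarrow> step E gl \<Gamma> (JJ C c a b p) = Some (t', T) \<Longrightarrow>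
  evs (map er \<Gamma>) (JJ C c a b p) t' T"
proof -
  assume wf: "wf_ctx S (map er \<Gamma>)" and s: "step E gl \<Gamma> (JJ C c a b p) = Some (t', T)"
  then obtain p' A a' b' C' l Tc c' T0 where p: "E \<Gamma> p = Some (p', ID A a' b')"
    and a: "E \<Gamma> a = Some (a', A)" and b: "E \<Gamma> b = Some (b', A)"
    and C: "E (ID (lft 0 2 A) (V (Suc 0)) (V 0) # lft 0 (Suc 0) A # A # \<Gamma>) C = Some (C', U l)"
    and n: "nrm E (A # \<Gamma>) (ins 0 (Suc 0) [RFL (V 0), V 0, V 0] C') = Some Tc"
    and c: "E (A # \<Gamma>) c = Some (c', Tc)" and n0: "nrm E \<Gamma> (ins 0 0 [p', b', a'] C') = Some T0"
    and r: "(if is_rfl p' then ev_at E \<Gamma> (ins 0 0 [a'] c') T0 else Some (JJ C' c' a' b' p', T0)) = Some (t', T)"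
    by (auto simp: on_simps split: if_splits)
  let ?G = "map er \<Gamma>"
  note pD = evsD[OF soundD[OF E wf p], simplified]
    and aD = evsD[OF soundD[OF E wf a]] and bD = evsD[OF soundD[OF E wf b]]
  obtain k where A: "S \<parallel> ?G \<turnstile> er A : Univ k" using aD(4) by blast
  have wf1: "wf_ctx S (map er (A # \<Gamma>))" using ctx_cons[OF A] by simp
  have wf3: "wf_ctx S (map er (ID (lft 0 2 A) (V (Suc 0)) (V 0) # lft 0 (Suc 0) A # A # \<Gamma>))"
    using path_ctx_wf(1)[OF A] by simp
  note CD = evsD[OF soundD[OF E wf3 C], simplified] and cD = evsD[OF soundD[OF E wf1 c], simplified]
  note ID = id_cong[OF jeq_refl[OF A] aD(2) bD(2)]
  \<comment> \<open>Evaluation types \<open>p\<close> over the normalised end points, whereas the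
    rule for the original term needs the given ones.\<close>
  have p1: "S \<parallel> ?G \<turnstile> er p : Id (er A) (er a) (er b)" by (rule conv[OF pD(1) jeq_sym[OF ID]])
  have p2: "S \<parallel> ?G \<turnstile> er p \<equiv> er p' : Id (er A) (er a) (er b)" by (rule jeq_conv[OF pD(2) jeq_sym[OF ID]])
  have wfA: "wf_ctx S ([er A] @ ?G)" using wf1 by simp
  have sA: "S \<parallel> [er A] @ ?G \<turnstile> shift 1 (er A) : Univ k" using path_ctx_wf(3)[OF A] by simp
  have v0: "S \<parallel> [er A] @ ?G \<turnstile> Var 0 : shift 1 (er A)" using var[OF wfA, of 0] by simp
  have s2: "inst 1 [Var 0] (shift (Suc 0) (er A)) = shift 1 (er A)"
    by (simp add: inst_eq subst_shift instm_def shift_as_subst subst_subst comp_def)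
  have s3: "inst 1 [Var 0, Var 0] (Id (shift 2 (er A)) (Var 1) (Var 0)) = Id (shift 1 (er A)) (Var 0) (Var 0)"
    by (simp add: inst_eq subst_shift instm_def shift_as_subst subst_subst comp_def)
  \<comment> \<open>This substitutes the generic reflexivity path for the three variables of the
    motive, which gives the type of the branch.\<close>
  have ok: "sub_ok S (instm 1 [Refl (Var 0), Var 0, Var 0]) (path_ctx (er A) @ ?G) ([er A] @ ?G)"
    using sub_ok_Cons[OF sub_ok_Cons[OF sub_ok_Cons[OF sub_ok_shift[OF wfA, of 1]]], of "Var 0" "er A" "Var 0"
        "shift 1 (er A)" "Refl (Var 0)" "Id (shift 2 (er A)) (Var 1) (Var 0)"]
      v0 refl[OF sA v0] s2 s3 by simp
  have "S \<parallel> map er (A # \<Gamma>) \<turnstile> er (ins 0 (Suc 0) [RFL (V 0), V 0, V 0] C') : Univ (lvl u v l)"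
    using inst_typing(1)[OF ok, of "er C'" "Univ (lvl u v l)"] CD(3) by simp
  from nrm_sound[OF E wf1 n this] obtain m where
    "S \<parallel> er A # ?G \<turnstile> inst 1 [Refl (Var 0), Var 0, Var 0] (er C') \<equiv> er Tc : Univ m" by auto
  note Tc' = jeq_sym[OF this]
  have Tc: "S \<parallel> er A # ?G \<turnstile> inst 1 [Refl (Var 0), Var 0, Var 0] (er C') \<equiv>
      inst 1 [Refl (Var 0), Var 0, Var 0] (er C) : Univ (lvl u v l)"
    using inst_typing(2)[OF ok, of "er C" "er C'" "Univ (lvl u v l)"] CD(2) by (auto intro: jeq_sym)
  have c1: "S \<parallel> er A # ?G \<turnstile> er c : inst 1 [Refl (Var 0), Var 0, Var 0] (er C)"
    by (rule conv[OF conv[OF cD(1) Tc'] Tc])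
  have c2: "S \<parallel> er A # ?G \<turnstile> er c \<equiv> er c' : inst 1 [Refl (Var 0), Var 0, Var 0] (er C)"
    by (rule jeq_conv[OF jeq_conv[OF cD(2) Tc'] Tc])
  have c3: "S \<parallel> er A # ?G \<turnstile> er c' : inst 1 [Refl (Var 0), Var 0, Var 0] (er C')"
    by (rule conv[OF cD(3) Tc'])
  have ok3: "sub_ok S (instm 0 [p0, b0, a0]) (path_ctx (er A) @ ?G) ?G"
    if "S \<parallel> ?G \<turnstile> a0 : er A" "S \<parallel> ?G \<turnstile> b0 : er A" "S \<parallel> ?G \<turnstile> p0 : Id (er A) a0 b0" for a0 b0 p0
  proof -
    have "inst 0 [b0, a0] (Id (shift 2 (er A)) (Var 1) (Var 0)) = Id (er A) a0 b0"
      by (simp add: inst_eq subst_shift instm_def)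
    then show ?thesis
      using sub_ok_Cons[OF sub_ok_Cons[OF sub_ok_Cons[OF sub_ok_Nil[OF wf]]], of a0 "er A" b0
        "shift 1 (er A)" p0 "Id (shift 2 (er A)) (Var 1) (Var 0)"] that by simp
  qed
  have C1: "S \<parallel> path_ctx (er A) @ ?G \<turnstile> er C : Univ (lvl u v l)"
    and C2: "S \<parallel> path_ctx (er A) @ ?G \<turnstile> er C \<equiv> er C' : Univ (lvl u v l)"
    and C3: "S \<parallel> path_ctx (er A) @ ?G \<turnstile> er C' : Univ (lvl u v l)"
    using CD by simp_all
  have "S \<parallel> ?G \<turnstile> er (ins 0 0 [p', b', a'] C') : Univ (lvl u v l)"
    using inst_typing(1)[OF ok3[OF aD(3) bD(3) pD(3)] C3] by simp
  from nrm_sound[OF E wf n0 this] obtain m where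
    T0: "S \<parallel> ?G \<turnstile> inst 0 [er p', er b', er a'] (er C') \<equiv> er T0 : Univ m" "S \<parallel> ?G \<turnstile> er T0 : Univ m" by auto
  have "S \<parallel> ?G \<turnstile> inst 0 [er p, er b, er a] (er C) \<equiv> inst 0 [er p, er b, er a] (er C') : Univ (lvl u v l)"
    using inst_typing(2)[OF ok3[OF aD(1) bD(1) p1] C2] by simp
  moreover have "S \<parallel> ?G \<turnstile> inst 0 [er p, er b, er a] (er C') \<equiv> inst 0 [er p', er b', er a'] (er C') : Univ (lvl u v l)"
    by (rule inst3_type_cong[OF C3 A aD(1,3,2) bD(1,3,2) p1 pD(3) p2])
  ultimately have CC: "S \<parallel> ?G \<turnstile> inst 0 [er p, er b, er a] (er C) \<equiv> inst 0 [er p', er b', er a'] (er C') : Univ (lvl u v l)"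
    by (rule jeq_trans)
  have 1: "S \<parallel> ?G \<turnstile> er (JJ C c a b p) : er T0"
    using conv[OF conv[OF id_elim[OF CD(1)[simplified, folded One_nat_def] c1 aD(1) bD(1) p1] CC] T0(1)] by simp
  have 2: "S \<parallel> ?G \<turnstile> er (JJ C c a b p) \<equiv> er (JJ C' c' a' b' p') : er T0"
    using jeq_conv[OF jeq_conv[OF id_elim_cong[OF C1[simplified, folded One_nat_def] C2[simplified, folded One_nat_def] c2 aD(2) bD(2) p2] CC] T0(1)] by simp
  have 3: "S \<parallel> ?G \<turnstile> er (JJ C' c' a' b' p') : er T0"
    using conv[OF id_elim[OF C3[simplified, folded One_nat_def] c3 aD(3) bD(3) pD(3)] T0(1)] by simp
  show ?thesis
  proof (cases "is_rfl p'")
    case True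
    then obtain x where p': "p' = RFL x" by (cases p') auto
    then have ab: "a' = x" "b' = x" using pD(5) by (auto simp: val_def)
    have red: "T = T0" "evs ?G (ins 0 0 [x] c') t' T0"
      using r True ab ev_at_sound[OF E wf] by auto
    have "S \<parallel> ?G \<turnstile> er (JJ C' c' a' b' p') \<equiv> er (ins 0 0 [x] c') : er T0"
      using jeq_conv[OF id_beta[OF C3[simplified, folded One_nat_def] c3 aD(3)]] T0(1) p' ab by auto
    then show ?thesis unfolding red(1) by (intro evs_red[OF 1 jeq_trans[OF 2] red(2)])
  next
    case False
    then show ?thesis using r 1 2 3 T0(2) by (auto simp: evs_def)
  qed
qed

lemma step_sound: "sound (step E gl)"
  unfolding sound_def
proof (intro allI impI)
  fix \<Gamma> t t' T assume "wf_ctx S (map er \<Gamma>)" "step E gl \<Gamma> t = Some (t', T)"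
  then show "evs (map er \<Gamma>) t t' T"
    by (cases t) (auto simp del: step.simps intro: step_V step_G step_U step_PI step_LAM step_AP step_SG
      step_PAIR step_SPLIT step_ONE step_STAR step_ELIM1 step_ID step_RFL step_JJ)
qed

end

theorem ev_sound:
  assumes "\<And>i T. gl i = Some T \<Longrightarrow> S \<parallel> [] \<turnstile> I i : er T \<and> (\<exists>l. S \<parallel> [] \<turnstile> er T : Univ l)"
  shows "sound (ev gl n)"
proof (induction n)
  case 0 show ?case by (simp add: sound_def)
next
  case (Suc n) then show ?case using step_sound assms by auto
qed

end


section \<open>Proof terms\<close>

text \<open>
  A term is represented as a function of the length \<open>n\<close> of its context. A variable that is bound in a
  context of length \<open>n\<close> has index \<open>m - Suc n\<close> in a context of length \<open>m\<close>.
\<close>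

type_synonym hoas = "nat \<Rightarrow> ptm"

definition bind_var :: "(hoas \<Rightarrow> hoas) \<Rightarrow> hoas" where "bind_var F n = F (\<lambda>m. V (m - Suc n)) (Suc n)"
definition hG :: "nat \<Rightarrow> hoas" where "hG i n = G i"
definition hU :: "lv \<Rightarrow> hoas" where "hU l n = U l"
definition hPi :: "hoas \<Rightarrow> (hoas \<Rightarrow> hoas) \<Rightarrow> hoas" where "hPi A B n = PI (A n) (bind_var B n)"
definition hLam :: "hoas \<Rightarrow> (hoas \<Rightarrow> hoas) \<Rightarrow> hoas" where "hLam A b n = LAM (A n) (bind_var b n)"
definition hApp :: "hoas \<Rightarrow> hoas \<Rightarrow> hoas" (infixl "\<cdot>" 90) where "(f \<cdot> a) n = AP (f n) (a n)"
definition hSg :: "hoas \<Rightarrow> (hoas \<Rightarrow> hoas) \<Rightarrow> hoas" where "hSg A B n = SG (A n) (bind_var B n)"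
definition hPair :: "hoas \<Rightarrow> (hoas \<Rightarrow> hoas) \<Rightarrow> hoas \<Rightarrow> hoas \<Rightarrow> hoas" where
  "hPair A B a b n = PAIR (A n) (bind_var B n) (a n) (b n)"
definition hSplit :: "(hoas \<Rightarrow> hoas) \<Rightarrow> (hoas \<Rightarrow> hoas \<Rightarrow> hoas) \<Rightarrow> hoas \<Rightarrow> hoas" where
  "hSplit C g p n = SPLIT (bind_var C n) (bind_var (\<lambda>x. bind_var (g x)) n) (p n)"
definition hUnit :: "lv \<Rightarrow> hoas" where "hUnit l n = ONE l"
definition hStar :: "lv \<Rightarrow> hoas" where "hStar l n = STAR l"
definition hUnitElim :: "(hoas \<Rightarrow> hoas) \<Rightarrow> hoas \<Rightarrow> hoas \<Rightarrow> hoas" where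
  "hUnitElim C c t n = ELIM1 (bind_var C n) (c n) (t n)"
definition hId :: "hoas \<Rightarrow> hoas \<Rightarrow> hoas \<Rightarrow> hoas" where "hId A a b n = ID (A n) (a n) (b n)"
definition hRefl :: "hoas \<Rightarrow> hoas" where "hRefl a n = RFL (a n)"
definition hJ :: "(hoas \<Rightarrow> hoas \<Rightarrow> hoas \<Rightarrow> hoas) \<Rightarrow> (hoas \<Rightarrow> hoas) \<Rightarrow> hoas \<Rightarrow> hoas \<Rightarrow> hoas \<Rightarrow> hoas" where
  "hJ C c a b p n = JJ (bind_var (\<lambda>x. bind_var (\<lambda>y. bind_var (C x y))) n) (bind_var c n) (a n) (b n) (p n)"

definition hArrow :: "hoas \<Rightarrow> hoas \<Rightarrow> hoas" (infixr "\<rightarrow>" 60) where "A \<rightarrow> B = hPi A (\<lambda>_. B)"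
definition proj1 :: "hoas \<Rightarrow> hoas \<Rightarrow> hoas" where "proj1 A p = hSplit (\<lambda>_. A) (\<lambda>x y. x) p"
definition proj2 :: "hoas \<Rightarrow> (hoas \<Rightarrow> hoas) \<Rightarrow> hoas \<Rightarrow> hoas" where
  "proj2 A B p = hSplit (\<lambda>z. B (proj1 A z)) (\<lambda>x y. y) p"
definition transp :: "(hoas \<Rightarrow> hoas) \<Rightarrow> hoas \<Rightarrow> hoas \<Rightarrow> hoas \<Rightarrow> hoas \<Rightarrow> hoas" where
  "transp P a b p x = hJ (\<lambda>x y q. P x \<rightarrow> P y) (\<lambda>x. hLam (P x) (\<lambda>z. z)) a b p \<cdot> x"
definition ap_path :: "hoas \<Rightarrow> (hoas \<Rightarrow> hoas) \<Rightarrow> hoas \<Rightarrow> hoas \<Rightarrow> hoas \<Rightarrow> hoas" where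
  "ap_path B F a b p = hJ (\<lambda>x y q. hId B (F x) (F y)) (\<lambda>x. hRefl (F x)) a b p"
definition sym_path :: "hoas \<Rightarrow> hoas \<Rightarrow> hoas \<Rightarrow> hoas \<Rightarrow> hoas" where
  "sym_path A a b p = hJ (\<lambda>x y q. hId A y x) (\<lambda>x. hRefl x) a b p"
definition trans_path :: "hoas \<Rightarrow> hoas \<Rightarrow> hoas \<Rightarrow> hoas \<Rightarrow> hoas \<Rightarrow> hoas \<Rightarrow> hoas" where
  "trans_path A a b c p q = transp (\<lambda>z. hId A a z) b c q p"

definition isprop :: "hoas \<Rightarrow> hoas" where "isprop A = hPi A (\<lambda>x. hPi A (\<lambda>y. hId A x y))"

text \<open>The map is a meta-level function so that composites come out beta-reduced: the types in
  \<open>thm_types\<close> are compared syntactically with computed normal forms.\<close>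

definition rlaw :: "hoas \<Rightarrow> (hoas \<Rightarrow> hoas) \<Rightarrow> hoas \<Rightarrow> hoas" where
  "rlaw B f g = hPi B (\<lambda>b. hId B (f (g \<cdot> b)) b)"
definition llaw :: "hoas \<Rightarrow> (hoas \<Rightarrow> hoas) \<Rightarrow> hoas \<Rightarrow> hoas" where
  "llaw A f g = hPi A (\<lambda>a. hId A (g \<cdot> f a) a)"
definition rinv :: "hoas \<Rightarrow> hoas \<Rightarrow> (hoas \<Rightarrow> hoas) \<Rightarrow> hoas" where "rinv A B f = hSg (B \<rightarrow> A) (rlaw B f)"
definition linv :: "hoas \<Rightarrow> hoas \<Rightarrow> (hoas \<Rightarrow> hoas) \<Rightarrow> hoas" where "linv A B f = hSg (B \<rightarrow> A) (llaw A f)"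
definition iseqv :: "hoas \<Rightarrow> hoas \<Rightarrow> (hoas \<Rightarrow> hoas) \<Rightarrow> hoas" where
  "iseqv A B f = hSg (rinv A B f) (\<lambda>_. linv A B f)"
definition iseqm :: "hoas \<Rightarrow> hoas \<Rightarrow> hoas \<Rightarrow> hoas" where "iseqm A B f = iseqv A B (\<lambda>x. f \<cdot> x)"
definition eqv :: "hoas \<Rightarrow> hoas \<Rightarrow> hoas" where "eqv A B = hSg (A \<rightarrow> B) (iseqm A B)"
definition mkiseqv :: "hoas \<Rightarrow> hoas \<Rightarrow> (hoas \<Rightarrow> hoas) \<Rightarrow> (hoas \<Rightarrow> hoas) \<Rightarrow> (hoas \<Rightarrow> hoas) \<Rightarrow> (hoas \<Rightarrow> hoas) \<Rightarrow> (hoas \<Rightarrow>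
      hoas) \<Rightarrow> hoas" where
  "mkiseqv A B f g fg h hf = hPair (rinv A B f) (\<lambda>_. linv A B f)
       (hPair (B \<rightarrow> A) (rlaw B f) (hLam B g) (hLam B fg)) (hPair (B \<rightarrow> A) (llaw A f) (hLam B h) (hLam A hf))"
definition mkeqv :: "hoas \<Rightarrow> hoas \<Rightarrow> (hoas \<Rightarrow> hoas) \<Rightarrow> (hoas \<Rightarrow> hoas) \<Rightarrow> (hoas \<Rightarrow> hoas) \<Rightarrow> (hoas \<Rightarrow> hoas) \<Rightarrow> hoas" where
  "mkeqv A B f g fg gf = hPair (A \<rightarrow> B) (iseqm A B) (hLam A f) (mkiseqv A B f g fg g gf)"
definition ideqv :: "hoas \<Rightarrow> hoas" where
  "ideqv A = mkeqv A A (\<lambda>x. x) (\<lambda>x. x) (\<lambda>x. hRefl x) (\<lambda>x. hRefl x)"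
definition toeqv :: "hoas \<Rightarrow> hoas \<Rightarrow> hoas \<Rightarrow> hoas" where
  "toeqv X Y p = hJ (\<lambda>x y q. eqv x y) (\<lambda>x. ideqv x) X Y p"
definition efun :: "hoas \<Rightarrow> hoas \<Rightarrow> hoas \<Rightarrow> hoas" where
  "efun A B e = proj1 (A \<rightarrow> B) e"
definition eis :: "hoas \<Rightarrow> hoas \<Rightarrow> hoas \<Rightarrow> hoas" where
  "eis A B e = proj2 (A \<rightarrow> B) (iseqm A B) e"

definition iseq1 :: "hoas \<Rightarrow> hoas \<Rightarrow> (hoas \<Rightarrow> hoas) \<Rightarrow> hoas \<Rightarrow> hoas" where
  "iseq1 A B f i = proj1 (rinv A B f) i"

definition inv1 :: "hoas \<Rightarrow> hoas \<Rightarrow> (hoas \<Rightarrow> hoas) \<Rightarrow> hoas \<Rightarrow> hoas" where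
  "inv1 A B f i = proj1 (B \<rightarrow> A) (iseq1 A B f i)"
definition inv1_law :: "hoas \<Rightarrow> hoas \<Rightarrow> (hoas \<Rightarrow> hoas) \<Rightarrow> hoas \<Rightarrow> hoas" where
  "inv1_law A B f i = proj2 (B \<rightarrow> A) (rlaw B f) (iseq1 A B f i)"

abbreviation "LU \<equiv> Lv True False False False False"
abbreviation "LV \<equiv> Lv False True False False False"
abbreviation "LW \<equiv> Lv True True False False False"
text \<open>The level of \<open>fibre Y\<close>, which pairs an element of \<open>Univ u\<close>
  with an identification in \<open>Univ (sup u v)\<close>.\<close>

abbreviation "LA \<equiv> Lv False False True True False"
definition "hU_u = hU LU"
definition "hU_w = hU LW"

definition ua_type :: "lv \<Rightarrow> hoas" where
  "ua_type l = hPi (hU l) (\<lambda>X. hPi (hU l) (\<lambda>Y. iseqv (hId (hU l) X Y) (eqv X Y) (toeqv X Y)))"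

definition resize_type :: "lv \<Rightarrow> lv \<Rightarrow> hoas" where
  "resize_type l m = hPi (hU l) (\<lambda>X. isprop X \<rightarrow> hSg (hU m) (eqv X))"

text \<open>
  The numbers are positions in the list \<open>thm_types\<close> below.
\<close>

abbreviation "ua_u_thm \<equiv> hG 0"
abbreviation "ua_w_thm \<equiv> hG 1"
abbreviation "resize_thm \<equiv> hG 2"
abbreviation "eqind_thm \<equiv> hG 3"
abbreviation "ua_section_thm \<equiv> hG 4"
abbreviation "singleton_thm \<equiv> hG 5"
abbreviation "postcomp_thm \<equiv> hG 6"
abbreviation "precomp_thm \<equiv> hG 7"
abbreviation "htpy_id_thm \<equiv> hG 8"
abbreviation "product_prop_thm \<equiv> hG 9"
abbreviation "is_eqv_prop_thm \<equiv> hG 10"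
abbreviation "eqv_ext_thm \<equiv> hG 11"
abbreviation "collapse_htpy_thm \<equiv> hG 12"
abbreviation "collapse_post_thm \<equiv> hG 13"
abbreviation "collapse_pre_thm \<equiv> hG 14"
abbreviation "lift_unlift_thm \<equiv> hG 15"
abbreviation "coe_ap_lift_thm \<equiv> hG 16"
abbreviation "unlift_eqv_thm \<equiv> hG 17"
abbreviation "ua_inj_thm \<equiv> hG 18"
abbreviation "ap_lift_unlift_thm \<equiv> hG 19"
abbreviation "ap_lift_surj_thm \<equiv> hG 20"
abbreviation "path_cancel_thm \<equiv> hG 21"
abbreviation "fibre_prop_thm \<equiv> hG 22"
abbreviation "transp_inv1_thm \<equiv> hG 23"
abbreviation "transp_inv2_thm \<equiv> hG 24"
abbreviation "resized_sum_thm \<equiv> hG 25"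

section \<open>Equivalence induction and other consequences of univalence\<close>

definition "eqind_type =
  hPi (hPi hU_w (\<lambda>X. hPi hU_w (\<lambda>Y. eqv X Y \<rightarrow> hU_w))) (\<lambda>P. hPi hU_w (\<lambda>X. P \<cdot> X \<cdot> X \<cdot> ideqv X) \<rightarrow>
    hPi hU_w (\<lambda>X. hPi hU_w (\<lambda>Y. hPi (eqv X Y) (\<lambda>e. P \<cdot> X \<cdot> Y \<cdot> e))))"
text \<open>Univalence identifies \<open>e\<close> with \<open>toeqv X Y (g e)\<close>. For
  equivalences of this form path induction reduces the goal to \<open>ideqv\<close>, and the result
  is transported along \<open>law e\<close>.\<close>

definition "eqind_term =
  hLam (hPi hU_w (\<lambda>X. hPi hU_w (\<lambda>Y. eqv X Y \<rightarrow> hU_w))) (\<lambda>P. hLam (hPi hU_w (\<lambda>X. P \<cdot> X \<cdot> X \<cdot> ideqv X)) (\<lambda>d.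
    hLam hU_w (\<lambda>X. hLam hU_w (\<lambda>Y. hLam (eqv X Y) (\<lambda>e.
      hSplit (\<lambda>_. P \<cdot> X \<cdot> Y \<cdot> e) (\<lambda>r _. hSplit (\<lambda>_. P \<cdot> X \<cdot> Y \<cdot> e) (\<lambda>g law.
        transp (\<lambda>e. P \<cdot> X \<cdot> Y \<cdot> e) (toeqv X Y (g \<cdot> e)) e (law \<cdot> e)
          (hJ (\<lambda>x y q. P \<cdot> x \<cdot> y \<cdot> toeqv x y q) (\<lambda>x. d \<cdot> x) X Y (g \<cdot> e))) r) (ua_w_thm \<cdot> X \<cdot> Y))))))"

definition "ua_section_goal X Y e = hSg (hId hU_u X Y) (\<lambda>p. hId (eqv X Y) (toeqv X Y p) e)"
definition "ua_section_type = hPi hU_u (\<lambda>X. hPi hU_u (\<lambda>Y. hPi (eqv X Y) (ua_section_goal X Y)))"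
definition "ua_section_term = hLam hU_u (\<lambda>X. hLam hU_u (\<lambda>Y. hLam (eqv X Y) (\<lambda>e.
  hSplit (\<lambda>_. ua_section_goal X Y e) (\<lambda>r _. hSplit (\<lambda>_. ua_section_goal X Y e) (\<lambda>g law.
    hPair (hId hU_u X Y) (\<lambda>p. hId (eqv X Y) (toeqv X Y p) e) (g \<cdot> e) (law \<cdot> e)) r) (ua_u_thm \<cdot> X \<cdot> Y))))"

definition "singleton_type = hPi hU_w (\<lambda>T. hPi T (\<lambda>k. isprop (hSg T (\<lambda>s. hId T s k))))"
text \<open>Every element is contracted to \<open>(k, refl)\<close> by path induction; two elements
  are then joined through this centre.\<close>

definition "singleton_term = hLam hU_w (\<lambda>T. hLam T (\<lambda>k.
  let S = (\<lambda>k. hSg T (\<lambda>s. hId T s k)); mk = (\<lambda>k s p. hPair T (\<lambda>s. hId T s k) s p); c = mk k k (hRefl k);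
      contr = hSplit (\<lambda>w. hId (S k) w c)
        (\<lambda>s p. hJ (\<lambda>x y q. hId (S y) (mk y x q) (mk y y (hRefl y))) (\<lambda>x. hRefl (mk x x (hRefl x))) s k p)
  in hLam (S k) (\<lambda>w1. hLam (S k) (\<lambda>w2. trans_path (S k) w1 c w2 (contr w1) (sym_path (S k) w2 c (contr
        w2))))))"

text \<open>
  By equivalence induction, the fibres of composition with an equivalence are propositions: for an
  identity equivalence they are singletons, by eta.
\<close>

definition postfib :: "hoas \<Rightarrow> hoas \<Rightarrow> hoas \<Rightarrow> (hoas \<Rightarrow> hoas) \<Rightarrow> hoas \<Rightarrow> hoas \<Rightarrow> hoas" where
  "postfib Z B A e k s = hId (Z \<rightarrow> A) (hLam Z (\<lambda>z. e (s \<cdot> z))) k"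
definition "postcomp_body Z B A e = hPi (Z \<rightarrow> A) (\<lambda>k. isprop (hSg (Z \<rightarrow> B) (postfib Z B A (\<lambda>x. efun B A e \<cdot> x)
      k)))"
definition "postcomp_type = hPi hU_w (\<lambda>Z. hPi hU_w (\<lambda>B. hPi hU_w (\<lambda>A. hPi (eqv B A) (\<lambda>e. postcomp_body Z B A
      e))))"
definition "postcomp_term = hLam hU_w (\<lambda>Z. eqind_thm \<cdot> hLam hU_w (\<lambda>B. hLam hU_w (\<lambda>A. hLam (eqv B A) (\<lambda>e.
      postcomp_body Z B A e)))
   \<cdot> hLam hU_w (\<lambda>X. hLam (Z \<rightarrow> X) (\<lambda>k. singleton_thm \<cdot> (Z \<rightarrow> X) \<cdot> k)))"

definition prefib :: "hoas \<Rightarrow> hoas \<Rightarrow> hoas \<Rightarrow> (hoas \<Rightarrow> hoas) \<Rightarrow> hoas \<Rightarrow> hoas \<Rightarrow> hoas" where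
  "prefib Z B A e k s = hId (B \<rightarrow> Z) (hLam B (\<lambda>b. s \<cdot> e b)) k"
definition "precomp_body Z B A e = hPi (B \<rightarrow> Z) (\<lambda>k. isprop (hSg (A \<rightarrow> Z) (prefib Z B A (\<lambda>x. efun B A e \<cdot> x)
      k)))"
definition "precomp_type = hPi hU_w (\<lambda>Z. hPi hU_w (\<lambda>B. hPi hU_w (\<lambda>A. hPi (eqv B A) (\<lambda>e. precomp_body Z B A
      e))))"
definition "precomp_term = hLam hU_w (\<lambda>Z. eqind_thm \<cdot> hLam hU_w (\<lambda>B. hLam hU_w (\<lambda>A. hLam (eqv B A) (\<lambda>e.
      precomp_body Z B A e)))
   \<cdot> hLam hU_w (\<lambda>X. hLam (X \<rightarrow> Z) (\<lambda>k. singleton_thm \<cdot> (X \<rightarrow> Z) \<cdot> k)))"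

text \<open>
  Functions homotopic to the identity form a retract of the fibre over the identity of composition with
  the second projection of the path space, which is an equivalence.
\<close>

definition "htpy_id A = hSg (A \<rightarrow> A) (rlaw A (\<lambda>x. x))"
definition "htpy_id_type = hPi hU_w (\<lambda>A. isprop (htpy_id A))"
definition "path_from A x = hSg A (\<lambda>y. hId A x y)"
definition "path_space A = hSg A (path_from A)"
definition "end1 A z = proj1 A z"
definition "end2 A z = proj1 A (proj2 A (path_from A) z)"
definition "between A z = proj2 A (\<lambda>y. hId A (end1 A z) y) (proj2 A (path_from A) z)"
definition "mk_path_space A x y q = hPair A (path_from A) x (hPair A (\<lambda>y. hId A x y) y q)"
definition "path_space_eqv A = mkeqv (path_space A) A (end2 A) (\<lambda>a. mk_path_space A a a (hRefl a)) (\<lambda>b.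
      hRefl b)
  (hSplit (\<lambda>z. hId (path_space A) (mk_path_space A (end2 A z) (end2 A z) (hRefl (end2 A z))) z)
    (\<lambda>x. hSplit (\<lambda>w. hId (path_space A) (mk_path_space A (proj1 A w) (proj1 A w) (hRefl (proj1 A w))) (hPair
          A (path_from A) x w))
      (\<lambda>y q. hJ (\<lambda>x y q. hId (path_space A) (mk_path_space A y y (hRefl y)) (mk_path_space A x y q))
        (\<lambda>x. hRefl (mk_path_space A x x (hRefl x))) x y q)))"
text \<open>\<open>back (elt g h)\<close> reduces to the pair of \<open>g\<close> and
  \<open>h\<close>, since transport along \<open>hRefl i\<close> disappears and eta removes the
  abstractions. So \<open>back\<close> carries the identification of fibre elements given by
  \<open>postcomp_thm\<close> to one of pairs.\<close>

definition "htpy_id_term = hLam hU_w (\<lambda>A.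
  let i = hLam A (\<lambda>z. z);
      elt = (\<lambda>g h. hPair (A \<rightarrow> path_space A) (postfib A (path_space A) A (end2 A) i) (hLam A (\<lambda>a.
            mk_path_space A (g \<cdot> a) a (h \<cdot> a))) (hRefl i));
      mk = hPair (A \<rightarrow> A) (rlaw A (\<lambda>x. x));
      back = hSplit (\<lambda>_. htpy_id A) (\<lambda>s q. mk (hLam A (\<lambda>a. end1 A (s \<cdot> a)))
        (hLam A (\<lambda>a. transp (\<lambda>k. hId A (end1 A (s \<cdot> a)) (k \<cdot> a)) (hLam A (\<lambda>z. end2 A (s \<cdot> z))) i q (between
              A (s \<cdot> a)))))
  in hLam (htpy_id A) (\<lambda>w1. hLam (htpy_id A) (\<lambda>w2.
    hSplit (\<lambda>w1. hId (htpy_id A) w1 w2) (\<lambda>g h. hSplit (\<lambda>w2. hId (htpy_id A) (mk g h) w2) (\<lambda>g' h'.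
      ap_path (htpy_id A) back (elt g h) (elt g' h')
        (postcomp_thm \<cdot> A \<cdot> path_space A \<cdot> A \<cdot> path_space_eqv A \<cdot> i \<cdot> elt g h \<cdot> elt g' h')) w2) w1)))"

definition "product_prop_type = hPi hU_w (\<lambda>A. hPi hU_w (\<lambda>B. isprop A \<rightarrow> isprop B \<rightarrow> isprop (hSg A (\<lambda>_. B))))"
definition "product_prop_term = hLam hU_w (\<lambda>A. hLam hU_w (\<lambda>B. hLam (isprop A) (\<lambda>i. hLam (isprop B) (\<lambda>j.
  let P = hSg A (\<lambda>_. B); mk = hPair A (\<lambda>_. B) in
  hLam P (\<lambda>w1. hLam P (\<lambda>w2. hSplit (\<lambda>w1. hId P w1 w2) (\<lambda>a b. hSplit (\<lambda>w2. hId P (mk a b) w2) (\<lambda>a' b'.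
    trans_path P (mk a b) (mk a' b) (mk a' b') (ap_path P (\<lambda>x. mk x b) a a' (i \<cdot> a \<cdot> a'))
      (ap_path P (\<lambda>y. mk a' y) b b' (j \<cdot> b \<cdot> b'))) w2) w1))))))"

definition "is_eqv_prop_type = hPi hU_w (\<lambda>X. hPi hU_w (\<lambda>Y. hPi (eqv X Y) (\<lambda>e. isprop (iseqm X Y (efun X Y
      e)))))"
text \<open>At \<open>ideqv X\<close> the types of right inverses and of left inverses both reduce
  to \<open>htpy_id X\<close>, so the goal becomes a product of two propositions.\<close>

definition "is_eqv_prop_term = eqind_thm \<cdot> hLam hU_w (\<lambda>X. hLam hU_w (\<lambda>Y. hLam (eqv X Y) (\<lambda>e. isprop (iseqm X
      Y (efun X Y e)))))
  \<cdot> hLam hU_w (\<lambda>X. product_prop_thm \<cdot> htpy_id X \<cdot> htpy_id X \<cdot> (htpy_id_thm \<cdot> X) \<cdot> (htpy_id_thm \<cdot> X))"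

definition "eqv_ext_type = hPi hU_w (\<lambda>X. hPi hU_w (\<lambda>Y. hPi (eqv X Y) (\<lambda>e. hPi (eqv X Y) (\<lambda>e'.
  hId (X \<rightarrow> Y) (efun X Y e) (efun X Y e') \<rightarrow> hId (eqv X Y) e e'))))"
text \<open>Both proofs of being an equivalence are generalised before the path induction on
  \<open>q\<close>. Then \<open>is_eqv_prop_thm\<close> applies at \<open>mk x i\<close>, whose
  underlying map reduces to \<open>x\<close>.\<close>

definition "eqv_ext_term = hLam hU_w (\<lambda>X. hLam hU_w (\<lambda>Y. hLam (eqv X Y) (\<lambda>e. hLam (eqv X Y) (\<lambda>e'.
  let E = eqv X Y; mk = hPair (X \<rightarrow> Y) (iseqm X Y) in
  hSplit (\<lambda>e. hId (X \<rightarrow> Y) (efun X Y e) (efun X Y e') \<rightarrow> hId E e e') (\<lambda>f i.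
    hSplit (\<lambda>e'. hId (X \<rightarrow> Y) f (efun X Y e') \<rightarrow> hId E (mk f i) e') (\<lambda>f' i'.
      hLam (hId (X \<rightarrow> Y) f f') (\<lambda>q.
        hJ (\<lambda>x y q. hPi (iseqm X Y x) (\<lambda>i. hPi (iseqm X Y y) (\<lambda>i'. hId E (mk x i) (mk y i'))))
          (\<lambda>x. hLam (iseqm X Y x) (\<lambda>i. hLam (iseqm X Y x) (\<lambda>i'.
            ap_path E (mk x) i i' (is_eqv_prop_thm \<cdot> X \<cdot> Y \<cdot> mk x i \<cdot> i \<cdot> i')))) f f' q \<cdot> i \<cdot> i')) e') e))))"

text \<open>
  The map \<open>collapse\<close> is homotopic to the identity and idempotent judgementally. As the fibres of composition
  with it are propositions, composing a function with it gives an identical function. This replaces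
  function extensionality.
\<close>

definition "lift X = hSg X (\<lambda>_. hUnit LV)"
definition "mk_lift X x = hPair X (\<lambda>_. hUnit LV) x (hStar LV)"
definition "collapse X z = mk_lift X (proj1 X z)"

definition "collapse_htpy_type = hPi hU_u (\<lambda>X. hPi (lift X) (\<lambda>z. hId (lift X) (collapse X z) z))"
definition "collapse_htpy_term = hLam hU_u (\<lambda>X. hLam (lift X) (\<lambda>z. hSplit (\<lambda>z. hId (lift X) (collapse X z) z)
  (\<lambda>x t. hUnitElim (\<lambda>t. hId (lift X) (mk_lift X x) (hPair X (\<lambda>_. hUnit LV) x t)) (hRefl (mk_lift X x)) t) z))"

definition "collapse_eqv X = mkeqv (lift X) (lift X) (collapse X) (\<lambda>z. z) (\<lambda>z. collapse_htpy_thm \<cdot> X \<cdot> z)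
      (\<lambda>z. collapse_htpy_thm \<cdot> X \<cdot> z)"
definition "collapse_post_type = hPi hU_u (\<lambda>X. hPi hU_w (\<lambda>Z. hPi (Z \<rightarrow> lift X) (\<lambda>h. hId (Z \<rightarrow> lift X) (hLam Z
      (\<lambda>z. collapse X (h \<cdot> z))) h)))"
text \<open>Both \<open>k\<close> and \<open>h\<close> lie in the fibre over \<open>k\<close> by
  reflexivity, \<open>h\<close> by the choice of \<open>k\<close> and \<open>k\<close> by
  idempotence. As the fibre is a proposition, projecting gives the identification.\<close>

definition "collapse_post_term = hLam hU_u (\<lambda>X. hLam hU_w (\<lambda>Z. hLam (Z \<rightarrow> lift X) (\<lambda>h.
  let k = hLam Z (\<lambda>z. collapse X (h \<cdot> z)); mk = (\<lambda>s. hPair (Z \<rightarrow> lift X) (postfib Z (lift X) (lift X)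
        (collapse X) k) s (hRefl k)) in
  ap_path (Z \<rightarrow> lift X) (proj1 (Z \<rightarrow> lift X)) (mk k) (mk h) (postcomp_thm \<cdot> Z \<cdot> lift X \<cdot> lift X \<cdot> collapse_eqv
        X \<cdot> k \<cdot> mk k \<cdot> mk h))))"
definition "collapse_pre_type = hPi hU_u (\<lambda>X. hPi hU_w (\<lambda>Z. hPi (lift X \<rightarrow> Z) (\<lambda>h. hId (lift X \<rightarrow> Z) (hLam
      (lift X) (\<lambda>z. h \<cdot> collapse X z)) h)))"
definition "collapse_pre_term = hLam hU_u (\<lambda>X. hLam hU_w (\<lambda>Z. hLam (lift X \<rightarrow> Z) (\<lambda>h.
  let k = hLam (lift X) (\<lambda>z. h \<cdot> collapse X z); mk = (\<lambda>s. hPair (lift X \<rightarrow> Z) (prefib Z (lift X) (lift X)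
        (collapse X) k) s (hRefl k)) in
  ap_path (lift X \<rightarrow> Z) (proj1 (lift X \<rightarrow> Z)) (mk k) (mk h) (precomp_thm \<cdot> Z \<cdot> lift X \<cdot> lift X \<cdot> collapse_eqv
        X \<cdot> k \<cdot> mk k \<cdot> mk h))))"

definition "lift_map X X0 k = hLam (lift X) (\<lambda>z. mk_lift X0 (k (proj1 X z)))"
definition "unlift_map X X0 F x = proj1 X0 (F \<cdot> mk_lift X x)"
definition "lift_unlift_type = hPi hU_u (\<lambda>X. hPi hU_u (\<lambda>X0. hPi (lift X \<rightarrow> lift X0) (\<lambda>F.
  hId (lift X \<rightarrow> lift X0) (lift_map X X0 (unlift_map X X0 F)) F)))"
text \<open>The left-hand map sends \<open>z\<close> judgementally to
  \<open>collapse (F (collapse z))\<close>, so the two collapses are removed one after the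
  other.\<close>

definition "lift_unlift_term = hLam hU_u (\<lambda>X. hLam hU_u (\<lambda>X0. hLam (lift X \<rightarrow> lift X0) (\<lambda>F.
  let h = hLam (lift X) (\<lambda>z. F \<cdot> collapse X z) in
  trans_path (lift X \<rightarrow> lift X0) (lift_map X X0 (unlift_map X X0 F)) h F (collapse_post_thm \<cdot> X0 \<cdot> lift X \<cdot>
        h) (collapse_pre_thm \<cdot> X \<cdot> lift X0 \<cdot> F))))"

text \<open>
  Every identification \<open>q\<close> of \<open>lift X\<close> with \<open>lift X0\<close> comes from one of \<open>X\<close> with \<open>X0\<close>, namely
  the one that univalence assigns to \<open>unlift_map\<close> of the transport along \<open>q\<close>.
\<close>

definition "ap_lift X X0 p = ap_path hU_w lift X X0 p"
definition "coe X Y p = efun X Y (toeqv X Y p)"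
definition "coe_ap_lift_goal X X0 p = hId (lift X \<rightarrow> lift X0) (coe (lift X) (lift X0) (ap_lift X X0 p))
      (lift_map X X0 (\<lambda>x. coe X X0 p \<cdot> x))"
definition "coe_ap_lift_type = hPi hU_u (\<lambda>X. hPi hU_u (\<lambda>X0. hPi (hId hU_u X X0) (coe_ap_lift_goal X X0)))"
definition "coe_ap_lift_term = hLam hU_u (\<lambda>X. hLam hU_u (\<lambda>X0. hLam (hId hU_u X X0) (\<lambda>p.
  hJ coe_ap_lift_goal (\<lambda>X. let i = hLam (lift X) (\<lambda>z. z) in
    sym_path (lift X \<rightarrow> lift X) (hLam (lift X) (collapse X)) i (collapse_post_thm \<cdot> X \<cdot> lift X \<cdot> i)) X X0 p)))"

definition "unlift_eqv_type = hPi hU_u (\<lambda>X. hPi hU_u (\<lambda>X0. hPi (eqv (lift X) (lift X0)) (\<lambda>E.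
  iseqv X X0 (unlift_map X X0 (efun (lift X) (lift X0) E)))))"
text \<open>The right inverse \<open>G\<close> and the left inverse \<open>H\<close> of
  \<open>F\<close> are unlifted separately. Each composite contains one \<open>collapse\<close> in
  the middle, which \<open>collapse_htpy_thm\<close> removes before the inverse law applies.\<close>

definition "unlift_eqv_term = hLam hU_u (\<lambda>X. hLam hU_u (\<lambda>X0. hLam (eqv (lift X) (lift X0)) (\<lambda>E.
  hSplit (\<lambda>E. iseqv X X0 (unlift_map X X0 (efun (lift X) (lift X0) E))) (\<lambda>F i.
    hSplit (\<lambda>_. iseqv X X0 (unlift_map X X0 F)) (\<lambda>r l. hSplit (\<lambda>_. iseqv X X0 (unlift_map X X0 F)) (\<lambda>G FG.
      hSplit (\<lambda>_. iseqv X X0 (unlift_map X X0 F)) (\<lambda>H HF. mkiseqv X X0 (unlift_map X X0 F)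
        (unlift_map X0 X G)
        (\<lambda>y. let z = G \<cdot> mk_lift X0 y in
           trans_path X0 (proj1 X0 (F \<cdot> collapse X z)) (proj1 X0 (F \<cdot> z)) y
             (ap_path X0 (\<lambda>z. proj1 X0 (F \<cdot> z)) (collapse X z) z (collapse_htpy_thm \<cdot> X \<cdot> z))
             (ap_path X0 (proj1 X0) (F \<cdot> z) (mk_lift X0 y) (FG \<cdot> mk_lift X0 y)))
        (unlift_map X0 X H)
        (\<lambda>x. let z = F \<cdot> mk_lift X x in
           trans_path X (proj1 X (H \<cdot> collapse X0 z)) (proj1 X (H \<cdot> z)) x
             (ap_path X (\<lambda>z. proj1 X (H \<cdot> z)) (collapse X0 z) z (collapse_htpy_thm \<cdot> X0 \<cdot> z))
             (ap_path X (proj1 X) (H \<cdot> z) (mk_lift X x) (HF \<cdot> mk_lift X x)))) l) r) i) E)))"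

definition "ua_inj_type = hPi hU_w (\<lambda>A. hPi hU_w (\<lambda>B. hPi (hId hU_w A B) (\<lambda>q. hPi (hId hU_w A B) (\<lambda>q'.
  hId (A \<rightarrow> B) (coe A B q) (coe A B q') \<rightarrow> hId (hId hU_w A B) q q'))))"
text \<open>By \<open>eqv_ext_thm\<close> equal coercions give equal equivalences, and the left
  inverse \<open>g\<close> of \<open>toeqv\<close> recovers the identifications from these.\<close>

definition "ua_inj_term = hLam hU_w (\<lambda>A. hLam hU_w (\<lambda>B. hLam (hId hU_w A B) (\<lambda>q. hLam (hId hU_w A B) (\<lambda>q'.
  hLam (hId (A \<rightarrow> B) (coe A B q) (coe A B q')) (\<lambda>h.
  let I = hId hU_w A B; e = toeqv A B q; e' = toeqv A B q' in
  hSplit (\<lambda>_. hId I q q') (\<lambda>_ l. hSplit (\<lambda>_. hId I q q') (\<lambda>g law.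
    trans_path I q (g \<cdot> e) q' (sym_path I (g \<cdot> e) q (law \<cdot> q))
      (trans_path I (g \<cdot> e) (g \<cdot> e') q' (ap_path I (\<lambda>e. g \<cdot> e) e e' (eqv_ext_thm \<cdot> A \<cdot> B \<cdot> e \<cdot> e' \<cdot> h)) (law
            \<cdot> q'))) l)
    (ua_w_thm \<cdot> A \<cdot> B))))))"

definition "ap_lift_unlift_type = hPi hU_u (\<lambda>X. hPi hU_u (\<lambda>X0. hPi (hId hU_w (lift X) (lift X0)) (\<lambda>q. hPi
      (hId hU_u X X0) (\<lambda>p.
  hId (X \<rightarrow> X0) (coe X X0 p) (hLam X (unlift_map X X0 (coe (lift X) (lift X0) q))) \<rightarrow>
    hId (hId hU_w (lift X) (lift X0)) (ap_lift X X0 p) q))))"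
text \<open>By \<open>ua_inj_thm\<close> it suffices to compare coercions: that of
  \<open>ap_lift p\<close> is the lift of that of \<open>p\<close>, which by \<open>h\<close> is the
  lift of the unlifted coercion of \<open>q\<close>, hence that coercion itself.\<close>

definition "ap_lift_unlift_term = hLam hU_u (\<lambda>X. hLam hU_u (\<lambda>X0. hLam (hId hU_w (lift X) (lift X0)) (\<lambda>q.
      hLam (hId hU_u X X0) (\<lambda>p.
  let F = coe (lift X) (lift X0) q; T = lift X \<rightarrow> lift X0; l = (\<lambda>k. lift_map X X0 (\<lambda>x. k \<cdot> x)); k = hLam X
        (unlift_map X X0 F) in
  hLam (hId (X \<rightarrow> X0) (coe X X0 p) k) (\<lambda>h.
    ua_inj_thm \<cdot> lift X \<cdot> lift X0 \<cdot> ap_lift X X0 p \<cdot> q \<cdot>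
      trans_path T (coe (lift X) (lift X0) (ap_lift X X0 p)) (l (coe X X0 p)) F (coe_ap_lift_thm \<cdot> X \<cdot> X0 \<cdot> p)
        (trans_path T (l (coe X X0 p)) (l k) F (ap_path T l (coe X X0 p) k h) (lift_unlift_thm \<cdot> X \<cdot> X0 \<cdot>
              F)))))))"

definition "ap_lift_surj_goal X X0 q = hSg (hId hU_u X X0) (\<lambda>p. hId (hId hU_w (lift X) (lift X0)) (ap_lift X
      X0 p) q)"
definition "ap_lift_surj_type = hPi hU_u (\<lambda>X. hPi hU_u (\<lambda>X0. hPi (hId hU_w (lift X) (lift X0))
      (ap_lift_surj_goal X X0)))"
definition "ap_lift_surj_term = hLam hU_u (\<lambda>X. hLam hU_u (\<lambda>X0. hLam (hId hU_w (lift X) (lift X0)) (\<lambda>q.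
  let e = hPair (X \<rightarrow> X0) (iseqm X X0) (hLam X (unlift_map X X0 (coe (lift X) (lift X0) q))) (unlift_eqv_thm
        \<cdot> X \<cdot> X0 \<cdot> toeqv (lift X) (lift X0) q) in
  hSplit (\<lambda>_. ap_lift_surj_goal X X0 q) (\<lambda>p b.
    hPair (hId hU_u X X0) (\<lambda>p. hId (hId hU_w (lift X) (lift X0)) (ap_lift X X0 p) q) p
      (ap_lift_unlift_thm \<cdot> X \<cdot> X0 \<cdot> q \<cdot> p \<cdot> ap_path (X \<rightarrow> X0) (efun X X0) (toeqv X X0 p) e b))
    (ua_section_thm \<cdot> X \<cdot> X0 \<cdot> e))))"

text \<open>The hypothesis is what remains in \<open>fibre_prop_term\<close> once path induction has
  turned \<open>ap_lift X X0 p\<close> into reflexivity. For \<open>q0\<close> reflexivity the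
  composite reduces to \<open>q\<close>.\<close>

definition "path_cancel_goal A B q q0 =
  hId (hId hU_w A A) (hRefl A) (trans_path hU_w A B A q (sym_path hU_w A B q0)) \<rightarrow> hId (hId hU_w A B) q q0"
definition "path_cancel_type = hPi hU_w (\<lambda>A. hPi hU_w (\<lambda>B. hPi (hId hU_w A B) (\<lambda>q. hPi (hId hU_w A B)
      (path_cancel_goal A B q))))"
definition "path_cancel_term = hLam hU_w (\<lambda>A. hLam hU_w (\<lambda>B. hLam (hId hU_w A B) (\<lambda>q. hLam (hId hU_w A B)
      (\<lambda>q0.
  hJ (\<lambda>x y q0. hPi (hId hU_w x y) (\<lambda>q. path_cancel_goal x y q q0))
    (\<lambda>x. hLam (hId hU_w x x) (\<lambda>q. hLam (hId (hId hU_w x x) (hRefl x) q) (\<lambda>h. sym_path (hId hU_w x x) (hRefl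
          x) q h))) A B q0 \<cdot> q))))"

section \<open>The fibres of the lifting map are propositions\<close>

definition "fibre Y = hSg hU_u (\<lambda>X. hId hU_w (lift X) Y)"
definition "mk_fibre Y X q = hPair hU_u (\<lambda>X. hId hU_w (lift X) Y) X q"
definition "fibre_prop_type = hPi hU_w (\<lambda>Y. isprop (fibre Y))"
text \<open>Surjectivity of \<open>ap_lift\<close> yields \<open>p\<close> over the composite of
  \<open>q\<close> with the inverse of \<open>q0\<close>. With \<open>q\<close>, \<open>q0\<close>
  and this relation generalised, path induction on \<open>p\<close> leaves two identifications out
  of the same lift, which \<open>path_cancel_thm\<close> equates.\<close>

definition "fibre_prop_term = hLam hU_w (\<lambda>Y. hLam (fibre Y) (\<lambda>w1. hLam (fibre Y) (\<lambda>w2.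
  let r = (\<lambda>X X0 q q0. trans_path hU_w (lift X) Y (lift X0) q (sym_path hU_w (lift X0) Y q0));
      a = (\<lambda>X X0 q q0 p. hId (hId hU_w (lift X) (lift X0)) (ap_lift X X0 p) (r X X0 q q0)) in
  hSplit (\<lambda>w1. hId (fibre Y) w1 w2) (\<lambda>X q. hSplit (\<lambda>w2. hId (fibre Y) (mk_fibre Y X q) w2) (\<lambda>X0 q0.
    let s = ap_lift_surj_thm \<cdot> X \<cdot> X0 \<cdot> r X X0 q q0 in
    hJ (\<lambda>X X0 p. hPi (hId hU_w (lift X) Y) (\<lambda>q. hPi (hId hU_w (lift X0) Y) (\<lambda>q0. a X X0 q q0 p \<rightarrow>
        hId (fibre Y) (mk_fibre Y X q) (mk_fibre Y X0 q0))))
      (\<lambda>X. hLam (hId hU_w (lift X) Y) (\<lambda>q. hLam (hId hU_w (lift X) Y) (\<lambda>q0. hLam (a X X q q0 (hRefl X)) (\<lambda>h.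
        ap_path (fibre Y) (mk_fibre Y X) q q0 (path_cancel_thm \<cdot> lift X \<cdot> Y \<cdot> q \<cdot> q0 \<cdot> h)))))
      X X0 (proj1 (hId hU_u X X0) s) \<cdot> q \<cdot> q0 \<cdot> proj2 (hId hU_u X X0) (a X X0 q q0) s) w2) w1)))"

section \<open>Sums indexed by a resized proposition\<close>

definition "transp_inv1_goal F A x y r = hPi (A \<cdot> y) (\<lambda>t.
  hId (A \<cdot> y) (transp (\<lambda>x. A \<cdot> x) x y r (transp (\<lambda>x. A \<cdot> x) y x (sym_path F x y r) t)) t)"
definition "transp_inv1_type = hPi (hU LA) (\<lambda>F. hPi (F \<rightarrow> hU_u) (\<lambda>A. hPi F (\<lambda>x. hPi F (\<lambda>y. hPi (hId F x y)
      (transp_inv1_goal F A x y)))))"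
definition "transp_inv1_term = hLam (hU LA) (\<lambda>F. hLam (F \<rightarrow> hU_u) (\<lambda>A. hLam F (\<lambda>x. hLam F (\<lambda>y. hLam (hId F x
      y) (\<lambda>r.
  hJ (transp_inv1_goal F A) (\<lambda>x. hLam (A \<cdot> x) (\<lambda>t. hRefl t)) x y r)))))"
definition "transp_inv2_goal F A x y r = hPi (A \<cdot> x) (\<lambda>t.
  hId (A \<cdot> x) (transp (\<lambda>x. A \<cdot> x) y x (sym_path F x y r) (transp (\<lambda>x. A \<cdot> x) x y r t)) t)"
definition "transp_inv2_type = hPi (hU LA) (\<lambda>F. hPi (F \<rightarrow> hU_u) (\<lambda>A. hPi F (\<lambda>x. hPi F (\<lambda>y. hPi (hId F x y)
      (transp_inv2_goal F A x y)))))"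
definition "transp_inv2_term = hLam (hU LA) (\<lambda>F. hLam (F \<rightarrow> hU_u) (\<lambda>A. hLam F (\<lambda>x. hLam F (\<lambda>y. hLam (hId F x
      y) (\<lambda>r.
  hJ (transp_inv2_goal F A) (\<lambda>x. hLam (A \<cdot> x) (\<lambda>t. hRefl t)) x y r)))))"

text \<open>
  If \<open>P\<close> is equivalent to the proposition \<open>F\<close> with element \<open>w0\<close>, then the sum of \<open>A\<close> over \<open>P\<close> is identical
  to \<open>A w0\<close>. Using sums where Escardo uses products again saves function extensionality.
\<close>

definition "resized_sum_type = hPi (hU LA) (\<lambda>F. hPi (isprop F) (\<lambda>i. hPi (F \<rightarrow> hU_u) (\<lambda>A. hPi F (\<lambda>w0. hPi hU_u
      (\<lambda>P.
  hPi (F \<rightarrow> P) (\<lambda>f. hPi (P \<rightarrow> F) (\<lambda>g. rlaw P (\<lambda>x. f \<cdot> x) g \<rightarrow> hId hU_u (hSg P (\<lambda>p. A \<cdot> (g \<cdot> p))) (A \<cdot> w0))))))))"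
text \<open>\<open>p0\<close> is joined to each \<open>p\<close> through \<open>f (g p)\<close>, by
  \<open>isprop F\<close> and then \<open>fg\<close>. The maps of the equivalence transport along
  \<open>d p\<close> forwards and backwards; path induction from \<open>p0\<close> to
  \<open>p\<close> makes these two transports cancel.\<close>

definition "resized_sum_term = hLam (hU LA) (\<lambda>F. hLam (isprop F) (\<lambda>i. hLam (F \<rightarrow> hU_u) (\<lambda>A. hLam F (\<lambda>w0. hLam
      hU_u (\<lambda>P.
  hLam (F \<rightarrow> P) (\<lambda>f. hLam (P \<rightarrow> F) (\<lambda>g. hLam (rlaw P (\<lambda>x. f \<cdot> x) g) (\<lambda>fg.
  let B = (\<lambda>p. A \<cdot> (g \<cdot> p)); S = hSg P B; mk = hPair P B; p0 = f \<cdot> w0;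
      d = (\<lambda>p. i \<cdot> (g \<cdot> p) \<cdot> w0);
      t1 = (\<lambda>p. transp (\<lambda>x. A \<cdot> x) (g \<cdot> p) w0 (d p));
      t2 = (\<lambda>p. transp (\<lambda>x. A \<cdot> x) w0 (g \<cdot> p) (sym_path F (g \<cdot> p) w0 (d p))) in
  proj1 (hId hU_u S (A \<cdot> w0)) (ua_section_thm \<cdot> S \<cdot> (A \<cdot> w0) \<cdot> mkeqv S (A \<cdot> w0) (hSplit (\<lambda>_. A \<cdot> w0) t1)
        (\<lambda>x. mk p0 (t2 p0 x))
    (\<lambda>x. transp_inv1_thm \<cdot> F \<cdot> A \<cdot> (g \<cdot> p0) \<cdot> w0 \<cdot> d p0 \<cdot> x)
    (hSplit (\<lambda>z. hId S (mk p0 (t2 p0 (hSplit (\<lambda>_. A \<cdot> w0) t1 z))) z) (\<lambda>p a.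
      hJ (\<lambda>x y _. hPi (B y) (\<lambda>a. hId S (mk x (t2 x (t1 y a))) (mk y a)))
        (\<lambda>x. hLam (B x) (\<lambda>a. ap_path S (mk x) (t2 x (t1 x a)) a (transp_inv2_thm \<cdot> F \<cdot> A \<cdot> (g \<cdot> x) \<cdot> w0 \<cdot> d
              x \<cdot> a)))
        p0 p (trans_path P p0 (f \<cdot> (g \<cdot> p)) p (ap_path P (\<lambda>x. f \<cdot> x) w0 (g \<cdot> p) (i \<cdot> w0 \<cdot> (g \<cdot> p))) (fg \<cdot>
              p)) \<cdot> a)))
  ))))))))"

section \<open>The section, the retraction and the final tuple\<close>

definition "retract_law s r = hPi hU_u (\<lambda>a. hId hU_u (r \<cdot> (s \<cdot> a)) a)"
definition "retract_emb s = hPi hU_w (\<lambda>B. isprop (hSg hU_u (\<lambda>X. hId hU_w (s \<cdot> X) B)))"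
definition "retract_type = hSg (hU_u \<rightarrow> hU_w) (\<lambda>s. hSg (hU_w \<rightarrow> hU_u) (\<lambda>r. hSg (retract_law s r) (\<lambda>_.
      retract_emb s)))"
text \<open>At \<open>Y = lift X\<close> the chosen fibre element is \<open>X\<close> with
  reflexivity, whose first component reduces to \<open>X\<close>, so \<open>resized_sum_thm\<close>
  has exactly the type of the retraction law. As \<open>s\<close> applied to \<open>X\<close>
  reduces to \<open>lift X\<close>, the embedding property is \<open>fibre_prop_thm\<close>.\<close>

definition "retract_term = (
  let Z = (\<lambda>Y. resize_thm \<cdot> fibre Y \<cdot> (fibre_prop_thm \<cdot> Y)); P = (\<lambda>Y. proj1 hU_u (Z Y)); E = (\<lambda>Y. proj2 hU_u
        (eqv (fibre Y)) (Z Y));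
      f = (\<lambda>Y. efun (fibre Y) (P Y) (E Y)); i = (\<lambda>Y. eis (fibre Y) (P Y) (E Y));
      g = (\<lambda>Y. inv1 (fibre Y) (P Y) (\<lambda>x. f Y \<cdot> x) (i Y)); fg = (\<lambda>Y. inv1_law (fibre Y) (P Y) (\<lambda>x. f Y \<cdot> x)
            (i Y));
      s = hLam hU_u lift; r = hLam hU_w (\<lambda>Y. hSg (P Y) (\<lambda>p. proj1 hU_u (g Y \<cdot> p))) in
  hPair (hU_u \<rightarrow> hU_w) (\<lambda>s. hSg (hU_w \<rightarrow> hU_u) (\<lambda>r. hSg (retract_law s r) (\<lambda>_. retract_emb s))) s
    (hPair (hU_w \<rightarrow> hU_u) (\<lambda>r. hSg (retract_law s r) (\<lambda>_. retract_emb s)) r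
      (hPair (retract_law s r) (\<lambda>_. retract_emb s)
        (hLam hU_u (\<lambda>X. let Y = lift X in
          resized_sum_thm \<cdot> fibre Y \<cdot> (fibre_prop_thm \<cdot> Y) \<cdot> hLam (fibre Y) (proj1 hU_u) \<cdot> mk_fibre Y X
                (hRefl Y) \<cdot> P Y \<cdot> f Y \<cdot> g Y \<cdot> fg Y))
        fibre_prop_thm)))"

definition "thm_types = [ua_type LU, ua_type LW, resize_type LA LU, eqind_type, ua_section_type,
      singleton_type, postcomp_type, precomp_type,
  htpy_id_type, product_prop_type, is_eqv_prop_type, eqv_ext_type, collapse_htpy_type, collapse_post_type,
        collapse_pre_type, lift_unlift_type, coe_ap_lift_type,
  unlift_eqv_type, ua_inj_type, ap_lift_unlift_type, ap_lift_surj_type, path_cancel_type, fibre_prop_type,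
        transp_inv1_type, transp_inv2_type, resized_sum_type, retract_type]"
definition "thm_terms = [eqind_term, ua_section_term, singleton_term, postcomp_term, precomp_term,
  htpy_id_term, product_prop_term, is_eqv_prop_term, eqv_ext_term, collapse_htpy_term, collapse_post_term,
        collapse_pre_term, lift_unlift_term, coe_ap_lift_term,
  unlift_eqv_term, ua_inj_term, ap_lift_unlift_term, ap_lift_surj_term, path_cancel_term, fibre_prop_term,
        transp_inv1_term, transp_inv2_term, resized_sum_term, retract_term]"


section \<open>Evaluation\<close>

text \<open>
  The continuations must not be simplified before their arguments are known, and \<open>ev\<close> may only be
  unfolded when fully applied; otherwise the simplifier evaluates all layers of fuel.
\<close>

lemma weak_congs:
  "m = m' \<Longrightarrow> on2 m f = on2 m' f" "m = m' \<Longrightarrow> onU m g = onU m' g" "m = m' \<Longrightarrow> onPI m h = onPI m' h"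
  "m = m' \<Longrightarrow> onSG m h = onSG m' h" "m = m' \<Longrightarrow> onONE m g = onONE m' g" "m = m' \<Longrightarrow> onID m k = onID m' k"
  "l = l' \<Longrightarrow> onL l p = onL l' p" "t = t' \<Longrightarrow> onT t q = onT t' q"
  by simp_all

lemma ev_numeral: "ev g (numeral k) \<Gamma> t = step (ev g (pred_numeral k)) g \<Gamma> t"
  by (simp add: numeral_eq_Suc)

definition env :: "nat \<Rightarrow> nat \<Rightarrow> ptm option" where
  "env k i = (if i < k then Some ((thm_types ! i) 0) else None)"

lemma thm_types_nth:
  "thm_types ! 0 = ua_type LU"
  "thm_types ! 1 = ua_type LW"
  "thm_types ! 2 = resize_type LA LU"
  "thm_types ! 3 = eqind_type"
  "thm_types ! 4 = ua_section_type"
  "thm_types ! 5 = singleton_type"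
  "thm_types ! 6 = postcomp_type"
  "thm_types ! 7 = precomp_type"
  "thm_types ! 8 = htpy_id_type"
  "thm_types ! 9 = product_prop_type"
  "thm_types ! 10 = is_eqv_prop_type"
  "thm_types ! 11 = eqv_ext_type"
  "thm_types ! 12 = collapse_htpy_type"
  "thm_types ! 13 = collapse_post_type"
  "thm_types ! 14 = collapse_pre_type"
  "thm_types ! 15 = lift_unlift_type"
  "thm_types ! 16 = coe_ap_lift_type"
  "thm_types ! 17 = unlift_eqv_type"
  "thm_types ! 18 = ua_inj_type"
  "thm_types ! 19 = ap_lift_unlift_type"
  "thm_types ! 20 = ap_lift_surj_type"
  "thm_types ! 21 = path_cancel_type"
  "thm_types ! 22 = fibre_prop_type"
  "thm_types ! 23 = transp_inv1_type"
  "thm_types ! 24 = transp_inv2_type"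
  "thm_types ! 25 = resized_sum_type"
  "thm_types ! 26 = retract_type"
  by (simp_all add: thm_types_def)

lemmas hoas_simps = bind_var_def hG_def hU_def hPi_def hLam_def hApp_def hSg_def hPair_def hSplit_def hUnit_def hStar_def hUnitElim_def hId_def
  hRefl_def hJ_def hArrow_def proj1_def proj2_def transp_def ap_path_def sym_path_def trans_path_def isprop_def rlaw_def llaw_def
  rinv_def linv_def iseqv_def iseqm_def eqv_def mkiseqv_def mkeqv_def ideqv_def toeqv_def efun_def
  eis_def iseq1_def inv1_def inv1_law_def hU_u_def hU_w_def ua_type_def resize_type_def eqind_type_def
  eqind_term_def ua_section_goal_def ua_section_type_def ua_section_term_def singleton_type_def singleton_term_def postfib_def
  postcomp_body_def postcomp_type_def postcomp_term_def prefib_def precomp_body_def precomp_type_def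
  precomp_term_def htpy_id_def htpy_id_type_def path_from_def path_space_def end1_def end2_def between_def mk_path_space_def
  path_space_eqv_def htpy_id_term_def product_prop_type_def product_prop_term_def is_eqv_prop_type_def is_eqv_prop_term_def eqv_ext_type_def
  eqv_ext_term_def lift_def mk_lift_def collapse_def collapse_htpy_type_def collapse_htpy_term_def collapse_eqv_def collapse_post_type_def
  collapse_post_term_def collapse_pre_type_def collapse_pre_term_def lift_map_def unlift_map_def lift_unlift_type_def lift_unlift_term_def ap_lift_def
  coe_def coe_ap_lift_goal_def coe_ap_lift_type_def coe_ap_lift_term_def unlift_eqv_type_def unlift_eqv_term_def ua_inj_type_def
  ua_inj_term_def ap_lift_unlift_type_def ap_lift_unlift_term_def ap_lift_surj_goal_def ap_lift_surj_type_def ap_lift_surj_term_def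
  path_cancel_goal_def path_cancel_type_def path_cancel_term_def fibre_def mk_fibre_def fibre_prop_type_def fibre_prop_term_def
  transp_inv1_goal_def transp_inv1_type_def transp_inv1_term_def transp_inv2_goal_def transp_inv2_type_def transp_inv2_term_def resized_sum_type_def
  resized_sum_term_def retract_law_def retract_emb_def retract_type_def retract_term_def Let_def

lemma length_Cons': "length (x # xs) = Suc (length xs)" by simp

lemmas ev_simps = Suc_less_eq zero_less_Suc not_less0 diff_Suc_Suc minus_nat.diff_0 diff_0_eq_0
  list.size(3) length_Cons' nth_Cons_0 nth_Cons_Suc if_True if_False add_0 add_Suc simp_thms
  not_True_eq_False not_False_eq_True nat.inject nat.distinct ptm.inject ptm.distinct lv.inject
  pred_numeral_simps(2,3) BitM.simps ev_numeral nrm_def ev_at_def lft.simps ins.simps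
  step.simps[unfolded numeral_2_eq_2] lsup.simps lsucc.simps is_lam.simps lam_body.simps is_pair.simps
  pair_1.simps pair_2.simps is_rfl.simps is_ap0.simps ap_fun.simps normal.simps on2.simps onU.simps onPI.simps
  onSG.simps onONE.simps onID.simps onT.simps onL.simps env_def thm_types_nth rel_simps

definition normalises :: "hoas \<Rightarrow> hoas \<Rightarrow> bool" where
  "normalises A B \<longleftrightarrow> onU (ev (\<lambda>i. None) 1000 [] (A 0)) (\<lambda>T l. Some T) = Some (B 0)"

text \<open>\<open>env k\<close> offers only the results before \<open>k\<close>, which excludes
  circularity. The fuel 1000 bounds the depth of recursion; \<open>ev_sound\<close> holds for every
  amount.\<close>

definition proves :: "nat \<Rightarrow> hoas \<Rightarrow> bool" where
  "proves k t \<longleftrightarrow> on2 (ev (env k) 1000 [] (t 0)) (\<lambda>_ T. Some T) = Some ((thm_types ! k) 0)"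

text \<open>This erases literally to \<open>univalence\<close>; its beta redexes are what separates
  it from \<open>ua_type\<close>.\<close>

definition "ua_src l = hPi (hU l) (\<lambda>X. hPi (hU l) (\<lambda>Y.
  iseqm (hId (hU l) X Y) (eqv X Y) (hLam (hId (hU l) X Y) (toeqv X Y))))"

lemmas check_simps = hoas_simps ev_simps normalises_def proves_def ua_src_def
lemmas check_congs = weak_congs if_weak_cong

lemma normalises_postulates:
  "normalises (ua_src LU) (ua_type LU)" "normalises (ua_src LW) (ua_type LW)"
  "normalises (resize_type LA LU) (resize_type LA LU)"
  by (simp_all only: check_simps cong: check_congs)

lemma proves_eqind: "proves 3 eqind_term"
  by (simp only: check_simps cong: check_congs)

lemma proves_ua_section: "proves 4 ua_section_term"
  by (simp only: check_simps cong: check_congs)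

lemma proves_singleton: "proves 5 singleton_term"
  by (simp only: check_simps cong: check_congs)

lemma proves_postcomp: "proves 6 postcomp_term"
  by (simp only: check_simps cong: check_congs)

lemma proves_precomp: "proves 7 precomp_term"
  by (simp only: check_simps cong: check_congs)

lemma proves_htpy_id: "proves 8 htpy_id_term"
  by (simp only: check_simps cong: check_congs)

lemma proves_product_prop: "proves 9 product_prop_term"
  by (simp only: check_simps cong: check_congs)

lemma proves_is_eqv_prop: "proves 10 is_eqv_prop_term"
  by (simp only: check_simps cong: check_congs)

lemma proves_eqv_ext: "proves 11 eqv_ext_term"
  by (simp only: check_simps cong: check_congs)

lemma proves_collapse_htpy: "proves 12 collapse_htpy_term"
  by (simp only: check_simps cong: check_congs)

lemma proves_collapse_post: "proves 13 collapse_post_term"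
  by (simp only: check_simps cong: check_congs)

lemma proves_collapse_pre: "proves 14 collapse_pre_term"
  by (simp only: check_simps cong: check_congs)

lemma proves_lift_unlift: "proves 15 lift_unlift_term"
  by (simp only: check_simps cong: check_congs)

lemma proves_coe_ap_lift: "proves 16 coe_ap_lift_term"
  by (simp only: check_simps cong: check_congs)

lemma proves_unlift_eqv: "proves 17 unlift_eqv_term"
  by (simp only: check_simps cong: check_congs)

lemma proves_ua_inj: "proves 18 ua_inj_term"
  by (simp only: check_simps cong: check_congs)

lemma proves_ap_lift_unlift: "proves 19 ap_lift_unlift_term"
  by (simp only: check_simps cong: check_congs)

lemma proves_ap_lift_surj: "proves 20 ap_lift_surj_term"
  by (simp only: check_simps cong: check_congs)

lemma proves_path_cancel: "proves 21 path_cancel_term"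
  by (simp only: check_simps cong: check_congs)

lemma proves_fibre_prop: "proves 22 fibre_prop_term"
  by (simp only: check_simps cong: check_congs)

lemma proves_transp_inv1: "proves 23 transp_inv1_term"
  by (simp only: check_simps cong: check_congs)

lemma proves_transp_inv2: "proves 24 transp_inv2_term"
  by (simp only: check_simps cong: check_congs)

lemma proves_resized_sum: "proves 25 resized_sum_term"
  by (simp only: check_simps cong: check_congs)

lemma proves_retract: "proves 26 retract_term"
  by (simp only: check_simps cong: check_congs)

section \<open>Realising the checked results by closed terms\<close>

primrec gfree :: "ptm \<Rightarrow> bool" where
  "gfree (V n) = True"
| "gfree (G i) = False"
| "gfree (U l) = True"
| "gfree (PI A B) = (gfree A \<and> gfree B)"
| "gfree (LAM A b) = (gfree A \<and> gfree b)"
| "gfree (AP f a) = (gfree f \<and> gfree a)"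
| "gfree (SG A B) = (gfree A \<and> gfree B)"
| "gfree (PAIR A B a b) = (gfree A \<and> gfree B \<and> gfree a \<and> gfree b)"
| "gfree (SPLIT C g p) = (gfree C \<and> gfree g \<and> gfree p)"
| "gfree (ONE l) = True"
| "gfree (STAR l) = True"
| "gfree (ELIM1 C c t) = (gfree C \<and> gfree c \<and> gfree t)"
| "gfree (ID A a b) = (gfree A \<and> gfree a \<and> gfree b)"
| "gfree (RFL a) = gfree a"
| "gfree (JJ C c a b p) = (gfree C \<and> gfree c \<and> gfree a \<and> gfree b \<and> gfree p)"

lemma list_all_simps': "list_all P [] = True" "list_all P (x # xs) = (P x \<and> list_all P xs)"
  by simp_all

lemma gfree_thm_types: "list_all (\<lambda>T. gfree (T 0)) thm_types"
  by (simp only: thm_types_def list_all_simps' hoas_simps gfree.simps simp_thms)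

lemma length_thm_types: "length thm_types = 27"
  by (simp add: thm_types_def)

definition realized :: "'l::universe_level postulate set \<Rightarrow> 'l \<Rightarrow> 'l \<Rightarrow> (nat \<Rightarrow> 'l tm) \<Rightarrow> nat \<Rightarrow> bool" where
  "realized S u v I k \<longleftrightarrow> erasure I \<and> (\<forall>i < k. S \<parallel> [] \<turnstile> I i : erasure.er u v I ((thm_types ! i) 0) \<and>
     (\<exists>l. S \<parallel> [] \<turnstile> erasure.er u v I ((thm_types ! i) 0) : Univ l))"

text \<open>Extending the interpretation by a new result must not disturb the types already
  realised; they mention no earlier proof.\<close>

lemma er_gfree:
  assumes "erasure I" "erasure I'" "gfree t"
  shows "erasure.er u v I t = erasure.er u v I' t"
proof -
  interpret a: erasure S u v I by fact
  interpret b: erasure S u v I' by fact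
  show ?thesis using assms(3) by (induction t) simp_all
qed

text \<open>The normal form \<open>t'\<close> is typed in the empty context, hence closed, and its
  erasure becomes the meaning of \<open>G k\<close>.\<close>

lemma realized_Suc:
  assumes "realized S u v I k" "proves k t" "k < 27"
  shows "\<exists>I. realized S u v I (Suc k)"
proof -
  interpret erasure S u v I using assms(1) by (simp add: realized_def)
  have snd: "sound (ev (env k) 1000)"
    by (rule ev_sound) (use assms(1) in \<open>auto simp: realized_def env_def split: if_splits\<close>)
  obtain t' where ev: "ev (env k) 1000 [] (t 0) = Some (t', (thm_types ! k) 0)"
    using assms(2) by (auto simp: proves_def on_simps)
  have "evs (map er []) (t 0) t' ((thm_types ! k) 0)"
    by (rule soundD[OF snd _ ev]) (simp add: ctx_nil)
  note t' = evsD(3,4)[OF this, simplified]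
  define I' where "I' = I(k := er t')"
  have I': "erasure I'"
    using closed closed_subst[OF t'(1)] by (simp add: erasure_def I'_def)
  have "erasure.er u v I' ((thm_types ! i) 0) = er ((thm_types ! i) 0)" if "i < Suc k" for i
    using gfree_thm_types that assms(3) by (intro er_gfree[OF I' erasure_axioms]) (simp add: list_all_length length_thm_types)
  then have "realized S u v I' (Suc k)"
    using assms(1) t' I' by (auto simp: realized_def I'_def less_Suc_eq)
  then show ?thesis by blast
qed

primrec all_prove :: "nat \<Rightarrow> hoas list \<Rightarrow> bool" where
  "all_prove k [] = True"
| "all_prove k (t # ts) \<longleftrightarrow> proves k t \<and> all_prove (Suc k) ts"

lemma realized_all:
  "realized S u v I k \<Longrightarrow> all_prove k ts \<Longrightarrow> k + length ts \<le> 27 \<Longrightarrow> \<exists>I. realized S u v I (k + length ts)"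
proof (induction ts arbitrary: k I)
  case (Cons t ts)
  then obtain I' where "realized S u v I' (Suc k)" using realized_Suc[of S u v I k t] by auto
  from Cons.IH[OF this] Cons.prems show ?case by simp
qed auto

lemma all_prove_thm_terms: "all_prove 3 thm_terms"
  by (simp add: thm_terms_def proves_eqind proves_ua_section proves_singleton proves_postcomp proves_precomp proves_htpy_id proves_product_prop proves_is_eqv_prop proves_eqv_ext proves_collapse_htpy proves_collapse_post proves_collapse_pre proves_lift_unlift proves_coe_ap_lift proves_unlift_eqv proves_ua_inj proves_ap_lift_unlift proves_ap_lift_surj proves_path_cancel proves_fibre_prop proves_transp_inv1 proves_transp_inv2 proves_resized_sum proves_retract)

lemmas univalent_defs = univalence_def prop_resizing_def retract_with_embedding_def is_embedding_def fiber_def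
  inverse_law_def is_prop_def arrow_def product_def equiv_def is_equiv_def id_to_equiv_def id_equiv_def
  id_map_def shift_def

theorem theorem29:
  fixes u v :: "'l::universe_level"
  shows "\<exists>t. foundation \<union> propositional_resizing \<parallel> [] \<turnstile> t :
           retract_with_embedding (Univ u) (Univ (sup u v))"
proof -
  let ?S = "foundation \<union> propositional_resizing :: 'l postulate set"
  \<comment> \<open>The value of \<open>LA\<close>, from which resizing leads down to
    \<open>u\<close>.\<close>
  define a where "a = sup (lsuc u) (lsuc (sup u v))"
  \<comment> \<open>Only the indices 0, 1, 2 are meant; the same closed postulate fills the later
    places until \<open>realized_Suc\<close> overwrites them.\<close>
  define I :: "nat \<Rightarrow> 'l tm" where "I = (\<lambda>i. Post (if i = 0 then Univalence u
    else if i = 1 then Univalence (sup u v) else Resizing a u))"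
  interpret erasure ?S u v I by (simp add: erasure_def I_def)
  \<comment> \<open>The types of the postulates are normalised with no earlier results in force, so
    the assumption of \<open>ev_sound\<close> is vacuous.\<close>
  have sound: "sound (ev (\<lambda>_. None) n)" for n
    by (rule ev_sound) simp
  have norm: "\<exists>l. ?S \<parallel> [] \<turnstile> er (A 0) \<equiv> er (B 0) : Univ l \<and> ?S \<parallel> [] \<turnstile> er (B 0) : Univ l"
    if AB: "normalises A B" for A B
  proof -
    obtain l where "ev (\<lambda>_. None) 1000 [] (A 0) = Some (B 0, U l)"
      using AB by (auto simp: normalises_def on_simps)
    from evsD[OF soundD[OF sound _ this]] ctx_nil show ?thesis by auto
  qed
  have src: "er (ua_src LU 0) = univalence u" "er (ua_src LW 0) = univalence (sup u v)"
    "er (resize_type LA LU 0) = prop_resizing a u"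
    by (simp_all add: hoas_simps ua_src_def univalent_defs a_def numeral_2_eq_2)
  have P: "?S \<parallel> [] \<turnstile> Post c : post_type c" if "c \<in> ?S" for c
    using post[OF ctx_nil that] .
  have "?S \<parallel> [] \<turnstile> I 0 : univalence u" "?S \<parallel> [] \<turnstile> I 1 : univalence (sup u v)" "?S \<parallel> [] \<turnstile> I 2 : prop_resizing a u"
    using P[of "Univalence u"] P[of "Univalence (sup u v)"] P[of "Resizing a u"]
    by (auto simp: I_def foundation_def propositional_resizing_def)
  then have "?S \<parallel> [] \<turnstile> I i : er ((thm_types ! i) 0) \<and> (\<exists>l. ?S \<parallel> [] \<turnstile> er ((thm_types ! i) 0) : Univ l)" if "i < 3" for i
  proof -
    consider "i = 0" | "i = 1" | "i = 2" using \<open>i < 3\<close> by linarith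
    then show ?thesis
      using norm[OF normalises_postulates(1)] norm[OF normalises_postulates(2)] norm[OF normalises_postulates(3)]
        \<open>?S \<parallel> [] \<turnstile> I 0 : _\<close> \<open>?S \<parallel> [] \<turnstile> I 1 : _\<close> \<open>?S \<parallel> [] \<turnstile> I 2 : _\<close>
      unfolding src by cases (auto simp: thm_types_nth[simplified] src intro: conv)
  qed
  then have "realized ?S u v I 3"
    using erasure_axioms by (simp add: realized_def)
  from realized_all[OF this all_prove_thm_terms] obtain J where J: "realized ?S u v J 27"
    by (auto simp: thm_terms_def)
  interpret J: erasure ?S u v J using J by (simp add: realized_def)
  \<comment> \<open>\<open>retract_type\<close> was written so that its erasure is literally the
    required type, so no conversion remains.\<close>
  have "J.er (retract_type 0) = retract_with_embedding (Univ u) (Univ (sup u v))"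
    by (simp add: hoas_simps univalent_defs numeral_2_eq_2)
  then show ?thesis
    using J[unfolded realized_def, THEN conjunct2, rule_format, of 26] thm_types_nth(27) by auto
qed

end
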